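(* Let $\pi$ be a Clairaut anti-invariant submersion from a nearly Kaehler manifold $(M,\varphi,g)$ onto a Riemannian manifold $(N,g_n)$ with $r=e^f$ and $\mathrm{grad}f\in\varphi\ker\pi_*$. If $\dim(\ker\pi_* )>1$, then the fibres of $\pi$ are totally geodesic if and only if $$A_{\varphi W}\varphi X+Q_W\varphi X=0$$ for all $W\in\Gamma(\ker\pi_* )$ such that $\varphi W$ is basic and all $X\in\Gamma(\mu)$.
   Context: An almost Hermitian manifold $(M,\varphi,g)$ is a smooth manifold with a $(1,1)$-tensor field $\varphi$, $\varphi^2=-I$, and a Riemannian metric $g$ with $g(\varphi E,\varphi F)=g(E,F)$. It is nearly Kaehler if $(\nabla_E\varphi)F+(\nabla_F\varphi)E=0$ for all vector fields $E,F$, where $\nabla$ is the Levi-Civita connection of $g$. A Riemannian submersion $\pi:(M,g)\to(N,g_n)$ (with $\dim M>\dim N$) is a smooth surjective map of maximal rank whose differential $\pi_*$ preserves lengths of horizontal vectors; vertical vectors are those in $\ker\pi_*$ (tangent to the fibres), horizontal vectors are those in $(\ker\pi_* )^\perp$. $\mathcal{V}$ and $\mathcal{H}$ denote the orthogonal projections onto $\ker\pi_*$ and $(\ker\pi_* )^\perp$. A vector field on $M$ is basic if it is horizontal and $\pi$-related to a vector field on $N$. The submersion is anti-invariant if $\varphi(\ker\pi_* )\subseteq(\ker\pi_* )^\perp$. Then $(\ker\pi_* )^\perp=\varphi\ker\pi_*\oplus\mu$ (orthogonal), where $\mu$ is the complementary distribution and $\varphi\mu\subset\mu$. O'Neill's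 tensor $A$ is, for vector fields $E,F$ on $M$, $A_EF=\mathcal{H}\nabla_{\mathcal{H}E}\mathcal{V}F+\mathcal{V}\nabla_{\mathcal{H}E}\mathcal{H}F$. $Q_EF$ denotes the vertical part of $(\nabla_E\varphi)F$. The Riemannian submersion $\pi$ is a Clairaut submersion with $r=e^f$ ($f$ a smooth function on $M$) if for every geodesic $h$ on $M$ the function $(r\circ h)\sin\theta$ is constant, where $\theta(s)$ is the angle between $\dot h(s)$ and the horizontal space at $h(s)$. "$\mathrm{grad}f\in\varphi\ker\pi_*$" means that the gradient of $f$ with respect to $g$ is a section of $\varphi\ker\pi_*$. *)

theory Defs
  imports "HOL-Analysis.Analysis" "HOL-Library.Function_Algebras"
begin

section \<open>Pointwise vector space structure on functions\<close>

instantiation "fun" :: (type, real_vector) real_vector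
begin

definition scaleR_fun :: "real \<Rightarrow> ('a \<Rightarrow> 'b) \<Rightarrow> 'a \<Rightarrow> 'b"
  where "scaleR_fun c f = (\<lambda>x. c *\<^sub>R f x)"

instance
  by standard (auto simp: scaleR_fun_def fun_eq_iff scaleR_add_right scaleR_add_left)

end


section \<open>Smooth manifolds and smooth maps\<close>

primrec Ck_on :: "nat \<Rightarrow> 'a::euclidean_space set \<Rightarrow> ('a \<Rightarrow> 'b::real_normed_vector) \<Rightarrow> bool" where
  "Ck_on 0 S f \<longleftrightarrow> continuous_on S f"
| "Ck_on (Suc k) S f \<longleftrightarrow>
     (\<forall>x\<in>S. f differentiable (at x)) \<and> (\<forall>v. Ck_on k S (\<lambda>x. frechet_derivative f (at x) v))"

text \<open>Only used for open \<open>S\<close>.\<close>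

definition smooth_on :: "'a::euclidean_space set \<Rightarrow> ('a \<Rightarrow> 'b::real_normed_vector) \<Rightarrow> bool" where
  "smooth_on S f \<longleftrightarrow> (\<forall>k. Ck_on k S f)"

text \<open>A chart is a domain together with a coordinate map, which is only relevant on that domain.
  The underlying set of a manifold is the whole type \<open>'m\<close>; its dimension is \<open>DIM('e)\<close>.\<close>

type_synonym ('m, 'e) chart = "'m set \<times> ('m \<Rightarrow> 'e)"

definition is_chart :: "('m::topological_space, 'e::euclidean_space) chart \<Rightarrow> bool" where
  "is_chart c \<longleftrightarrow> (case c of (U, \<kappa>) \<Rightarrow>
     open U \<and> open (\<kappa> ` U) \<and> homeomorphism U (\<kappa> ` U) \<kappa> (inv_into U \<kappa>))"

definition smooth_manifold ::
    "('m::{t2_space, second_countable_topology}, 'e::euclidean_space) chart set \<Rightarrow> bool" where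
  "smooth_manifold M \<longleftrightarrow>
     (\<forall>c\<in>M. is_chart c) \<and> (\<Union>(U, \<kappa>)\<in>M. U) = UNIV \<and>
     (\<forall>(U, \<kappa>)\<in>M. \<forall>(V, \<psi>)\<in>M. smooth_on (\<kappa> ` (U \<inter> V)) (\<psi> \<circ> inv_into U \<kappa>))"

definition euclidean_atlas :: "('e::euclidean_space, 'e) chart set" where
  "euclidean_atlas = {(UNIV, id)}"

text \<open>Smoothness of a map between manifolds on an open subset \<open>S\<close> of the source.\<close>

definition smooth_map_on ::
    "('m::topological_space, 'e::euclidean_space) chart set \<Rightarrow>
     ('n::topological_space, 'f::euclidean_space) chart set \<Rightarrow> 'm set \<Rightarrow> ('m \<Rightarrow> 'n) \<Rightarrow> bool" where
  "smooth_map_on M N S F \<longleftrightarrow> continuous_on S F \<and>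
     (\<forall>(U, \<kappa>)\<in>M. \<forall>(V, \<psi>)\<in>N.
        smooth_on (\<kappa> ` (S \<inter> U \<inter> F -` V)) (\<psi> \<circ> F \<circ> inv_into U \<kappa>))"

definition smooth_functions ::
    "('m::topological_space, 'e::euclidean_space) chart set \<Rightarrow> ('m \<Rightarrow> real) set" where
  "smooth_functions M = {f. smooth_map_on M euclidean_atlas UNIV f}"


section \<open>Tangent vectors and vector fields\<close>

text \<open>Tangent vectors at \<open>p\<close> are derivations at \<open>p\<close> of the algebra of smooth functions.
  A derivation is extended by \<open>0\<close> to non-smooth functions, so that derivations with the same
  action on smooth functions are equal.\<close>

type_synonym 'm tvec = "('m \<Rightarrow> real) \<Rightarrow> real"
type_synonym 'm vfield = "'m \<Rightarrow> 'm tvec"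
type_synonym 'm metric = "'m \<Rightarrow> 'm tvec \<Rightarrow> 'm tvec \<Rightarrow> real"
type_synonym 'm endo = "'m \<Rightarrow> 'm tvec \<Rightarrow> 'm tvec"
type_synonym 'm conn = "'m vfield \<Rightarrow> 'm vfield \<Rightarrow> 'm vfield"

definition tangent_space ::
    "('m::topological_space, 'e::euclidean_space) chart set \<Rightarrow> 'm \<Rightarrow> 'm tvec set" where
  "tangent_space M p = {v.
     (\<forall>a\<in>smooth_functions M. \<forall>b\<in>smooth_functions M.
        v (a + b) = v a + v b \<and> v (a * b) = v a * b p + a p * v b) \<and>
     (\<forall>c. \<forall>a\<in>smooth_functions M. v (c *\<^sub>R a) = c * v a) \<and>
     (\<forall>a. a \<notin> smooth_functions M \<longrightarrow> v a = 0)}"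

definition smooth_fields ::
    "('m::topological_space, 'e::euclidean_space) chart set \<Rightarrow> 'm vfield set" where
  "smooth_fields M = {E. (\<forall>p. E p \<in> tangent_space M p) \<and>
     (\<forall>a\<in>smooth_functions M. (\<lambda>p. E p a) \<in> smooth_functions M)}"

text \<open>Smooth sections of a distribution, given as a family of subspaces of the tangent spaces.\<close>

definition sections ::
    "('m::topological_space, 'e::euclidean_space) chart set \<Rightarrow> ('m \<Rightarrow> 'm tvec set) \<Rightarrow> 'm vfield set"
  where "sections M D = {E \<in> smooth_fields M. \<forall>p. E p \<in> D p}"

definition fscale :: "('m \<Rightarrow> real) \<Rightarrow> 'm vfield \<Rightarrow> 'm vfield" where
  "fscale a E = (\<lambda>p. a p *\<^sub>R E p)"

definition lie_bracket :: "'m vfield \<Rightarrow> 'm vfield \<Rightarrow> 'm vfield" where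
  "lie_bracket E F = (\<lambda>p a. E p (\<lambda>q. F q a) - F p (\<lambda>q. E q a))"

definition linear_between ::
    "'a::real_vector set \<Rightarrow> 'b::real_vector set \<Rightarrow> ('a \<Rightarrow> 'b) \<Rightarrow> bool" where
  "linear_between S T L \<longleftrightarrow> L ` S \<subseteq> T \<and>
     (\<forall>v\<in>S. \<forall>w\<in>S. \<forall>a b. L (a *\<^sub>R v + b *\<^sub>R w) = a *\<^sub>R L v + b *\<^sub>R L w)"

definition apply_endo :: "'m endo \<Rightarrow> 'm vfield \<Rightarrow> 'm vfield" where
  "apply_endo \<phi> E = (\<lambda>p. \<phi> p (E p))"

definition tensor_field_11 ::
    "('m::topological_space, 'e::euclidean_space) chart set \<Rightarrow> 'm endo \<Rightarrow> bool" where
  "tensor_field_11 M \<phi> \<longleftrightarrow>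
     (\<forall>p. linear_between (tangent_space M p) (tangent_space M p) (\<phi> p)) \<and>
     (\<forall>E\<in>smooth_fields M. apply_endo \<phi> E \<in> smooth_fields M)"

definition differential ::
    "('n::topological_space, 'f::euclidean_space) chart set \<Rightarrow> ('m \<Rightarrow> 'n) \<Rightarrow> 'm tvec \<Rightarrow> 'n tvec" where
  "differential N F v = (\<lambda>a. if a \<in> smooth_functions N then v (a \<circ> F) else 0)"


section \<open>Riemannian metrics and the Levi-Civita connection\<close>

definition riemannian_metric ::
    "('m::topological_space, 'e::euclidean_space) chart set \<Rightarrow> 'm metric \<Rightarrow> bool" where
  "riemannian_metric M g \<longleftrightarrow>
     (\<forall>p. (\<forall>v\<in>tangent_space M p. linear_between (tangent_space M p) UNIV (g p v)) \<and>
          (\<forall>v\<in>tangent_space M p. \<forall>w\<in>tangent_space M p. g p v w = g p w v) \<and>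
          (\<forall>v\<in>tangent_space M p. v \<noteq> 0 \<longrightarrow> 0 < g p v v)) \<and>
     (\<forall>E\<in>smooth_fields M. \<forall>F\<in>smooth_fields M. (\<lambda>p. g p (E p) (F p)) \<in> smooth_functions M)"

definition grad ::
    "('m::topological_space, 'e::euclidean_space) chart set \<Rightarrow> 'm metric \<Rightarrow> ('m \<Rightarrow> real) \<Rightarrow> 'm vfield"
  where "grad M g f = (\<lambda>p. THE v. v \<in> tangent_space M p \<and>
           (\<forall>w\<in>tangent_space M p. g p v w = w f))"

definition affine_connection ::
    "('m::topological_space, 'e::euclidean_space) chart set \<Rightarrow> 'm conn \<Rightarrow> bool" where
  "affine_connection M nabla \<longleftrightarrow>
     (\<forall>E\<in>smooth_fields M. \<forall>F\<in>smooth_fields M. nabla E F \<in> smooth_fields M) \<and>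
     (\<forall>E\<in>smooth_fields M. \<forall>E'\<in>smooth_fields M. \<forall>F\<in>smooth_fields M.
        nabla (E + E') F = nabla E F + nabla E' F \<and> nabla F (E + E') = nabla F E + nabla F E') \<and>
     (\<forall>a\<in>smooth_functions M. \<forall>E\<in>smooth_fields M. \<forall>F\<in>smooth_fields M.
        nabla (fscale a E) F = fscale a (nabla E F) \<and>
        nabla E (fscale a F) = fscale (\<lambda>p. E p a) F + fscale a (nabla E F))"

text \<open>The Levi-Civita connection is the unique \<open>nabla\<close> with the following property; only its values
  on smooth vector fields are meaningful.\<close>

definition levi_civita ::
    "('m::topological_space, 'e::euclidean_space) chart set \<Rightarrow> 'm metric \<Rightarrow> 'm conn \<Rightarrow> bool" where
  "levi_civita M g nabla \<longleftrightarrow> affine_connection M nabla \<and>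
     (\<forall>E\<in>smooth_fields M. \<forall>F\<in>smooth_fields M. nabla E F - nabla F E = lie_bracket E F) \<and>
     (\<forall>E\<in>smooth_fields M. \<forall>F\<in>smooth_fields M. \<forall>G\<in>smooth_fields M. \<forall>p.
        E p (\<lambda>q. g q (F q) (G q)) = g p (nabla E F p) (G p) + g p (F p) (nabla E G p))"

definition cov_deriv_endo :: "'m conn \<Rightarrow> 'm endo \<Rightarrow> 'm vfield \<Rightarrow> 'm vfield \<Rightarrow> 'm vfield" where
  "cov_deriv_endo nabla \<phi> E F = nabla E (apply_endo \<phi> F) - apply_endo \<phi> (nabla E F)"


section \<open>Geodesics\<close>

definition velocity ::
    "('m::topological_space, 'e::euclidean_space) chart set \<Rightarrow> (real \<Rightarrow> 'm) \<Rightarrow> real \<Rightarrow> 'm tvec" where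
  "velocity M h s = (\<lambda>a. if a \<in> smooth_functions M then deriv (a \<circ> h) s else 0)"

definition fields_along ::
    "('m::topological_space, 'e::euclidean_space) chart set \<Rightarrow> real set \<Rightarrow> (real \<Rightarrow> 'm) \<Rightarrow>
     (real \<Rightarrow> 'm tvec) set" where
  "fields_along M I h = {Y. (\<forall>s\<in>I. Y s \<in> tangent_space M (h s)) \<and>
     (\<forall>a\<in>smooth_functions M. smooth_on I (\<lambda>s. Y s a))}"

text \<open>The covariant derivative along a smooth curve \<open>h\<close> on an open interval \<open>I\<close> exists and is
  uniquely determined on \<open>I\<close> by the following axioms.  In the last one, the value of \<open>nabla X E\<close> at
  \<open>h s\<close> depends on \<open>X\<close> only through \<open>X (h s)\<close>.\<close>

definition cov_deriv_along ::
    "('m::topological_space, 'e::euclidean_space) chart set \<Rightarrow> 'm conn \<Rightarrow> real set \<Rightarrow> (real \<Rightarrow> 'm) \<Rightarrow>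
     ((real \<Rightarrow> 'm tvec) \<Rightarrow> real \<Rightarrow> 'm tvec) \<Rightarrow> bool" where
  "cov_deriv_along M nabla I h D \<longleftrightarrow>
     (\<forall>Y\<in>fields_along M I h. D Y \<in> fields_along M I h) \<and>
     (\<forall>Y\<in>fields_along M I h. \<forall>Z\<in>fields_along M I h. \<forall>s\<in>I. D (Y + Z) s = D Y s + D Z s) \<and>
     (\<forall>u Y. smooth_on I u \<longrightarrow> Y \<in> fields_along M I h \<longrightarrow>
        (\<forall>s\<in>I. D (\<lambda>t. u t *\<^sub>R Y t) s = deriv u s *\<^sub>R Y s + u s *\<^sub>R D Y s)) \<and>
     (\<forall>E\<in>smooth_fields M. \<forall>X\<in>smooth_fields M. \<forall>s\<in>I.
        X (h s) = velocity M h s \<longrightarrow> D (\<lambda>t. E (h t)) s = nabla X E (h s))"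

definition geodesic_on ::
    "('m::topological_space, 'e::euclidean_space) chart set \<Rightarrow> 'm conn \<Rightarrow> real set \<Rightarrow> (real \<Rightarrow> 'm) \<Rightarrow> bool"
  where "geodesic_on M nabla I h \<longleftrightarrow> open I \<and> is_interval I \<and> smooth_map_on euclidean_atlas M I h \<and>
     (\<exists>D. cov_deriv_along M nabla I h D \<and> (\<forall>s\<in>I. D (velocity M h) s = 0))"


section \<open>Nearly Kaehler manifolds\<close>

definition almost_hermitian ::
    "('m::topological_space, 'e::euclidean_space) chart set \<Rightarrow> 'm endo \<Rightarrow> 'm metric \<Rightarrow> bool" where
  "almost_hermitian M \<phi> g \<longleftrightarrow> tensor_field_11 M \<phi> \<and> riemannian_metric M g \<and>
     (\<forall>p. \<forall>v\<in>tangent_space M p. \<phi> p (\<phi> p v) = - v) \<and>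
     (\<forall>p. \<forall>v\<in>tangent_space M p. \<forall>w\<in>tangent_space M p. g p (\<phi> p v) (\<phi> p w) = g p v w)"

definition nearly_kaehler ::
    "('m::topological_space, 'e::euclidean_space) chart set \<Rightarrow> 'm endo \<Rightarrow> 'm metric \<Rightarrow> 'm conn \<Rightarrow> bool"
  where "nearly_kaehler M \<phi> g nabla \<longleftrightarrow> almost_hermitian M \<phi> g \<and> levi_civita M g nabla \<and>
     (\<forall>E\<in>smooth_fields M. \<forall>F\<in>smooth_fields M.
        cov_deriv_endo nabla \<phi> E F + cov_deriv_endo nabla \<phi> F E = 0)"


section \<open>Riemannian submersions\<close>

definition ker_space ::
    "('m::topological_space, 'e::euclidean_space) chart set \<Rightarrow>
     ('n::topological_space, 'f::euclidean_space) chart set \<Rightarrow> ('m \<Rightarrow> 'n) \<Rightarrow> 'm \<Rightarrow> 'm tvec set" where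
  "ker_space M N \<pi> p = {v \<in> tangent_space M p. differential N \<pi> v = 0}"

definition orth_compl ::
    "('m::topological_space, 'e::euclidean_space) chart set \<Rightarrow> 'm metric \<Rightarrow> ('m \<Rightarrow> 'm tvec set) \<Rightarrow>
     'm \<Rightarrow> 'm tvec set" where
  "orth_compl M g D p = {v \<in> tangent_space M p. \<forall>w\<in>D p. g p v w = 0}"

abbreviation hor_space ::
    "('m::topological_space, 'e::euclidean_space) chart set \<Rightarrow> 'm metric \<Rightarrow>
     ('n::topological_space, 'f::euclidean_space) chart set \<Rightarrow> ('m \<Rightarrow> 'n) \<Rightarrow> 'm \<Rightarrow> 'm tvec set" where
  "hor_space M g N \<pi> \<equiv> orth_compl M g (ker_space M N \<pi>)"

definition ver ::
    "('m::topological_space, 'e::euclidean_space) chart set \<Rightarrow> 'm metric \<Rightarrow>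
     ('n::topological_space, 'f::euclidean_space) chart set \<Rightarrow> ('m \<Rightarrow> 'n) \<Rightarrow> 'm endo" where
  "ver M g N \<pi> p v = (THE w. w \<in> ker_space M N \<pi> p \<and> v - w \<in> hor_space M g N \<pi> p)"

definition hor ::
    "('m::topological_space, 'e::euclidean_space) chart set \<Rightarrow> 'm metric \<Rightarrow>
     ('n::topological_space, 'f::euclidean_space) chart set \<Rightarrow> ('m \<Rightarrow> 'n) \<Rightarrow> 'm endo" where
  "hor M g N \<pi> p v = (THE w. w \<in> hor_space M g N \<pi> p \<and> v - w \<in> ker_space M N \<pi> p)"

definition riemannian_submersion ::
    "('m::topological_space, 'e::euclidean_space) chart set \<Rightarrow> 'm metric \<Rightarrow>
     ('n::topological_space, 'f::euclidean_space) chart set \<Rightarrow> 'n metric \<Rightarrow> ('m \<Rightarrow> 'n) \<Rightarrow> bool" where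
  "riemannian_submersion M g N g\<^sub>N \<pi> \<longleftrightarrow>
     DIM('e) > DIM('f) \<and> smooth_map_on M N UNIV \<pi> \<and> surj \<pi> \<and>
     (\<forall>p. differential N \<pi> ` tangent_space M p = tangent_space N (\<pi> p)) \<and>
     (\<forall>p. \<forall>v\<in>hor_space M g N \<pi> p.
        sqrt (g\<^sub>N (\<pi> p) (differential N \<pi> v) (differential N \<pi> v)) = sqrt (g p v v))"

definition basic_field ::
    "('m::topological_space, 'e::euclidean_space) chart set \<Rightarrow> 'm metric \<Rightarrow>
     ('n::topological_space, 'f::euclidean_space) chart set \<Rightarrow> ('m \<Rightarrow> 'n) \<Rightarrow> 'm vfield \<Rightarrow> bool" where
  "basic_field M g N \<pi> E \<longleftrightarrow> E \<in> sections M (hor_space M g N \<pi>) \<and>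
     (\<exists>Y\<in>smooth_fields N. \<forall>p. differential N \<pi> (E p) = Y (\<pi> p))"

definition anti_invariant ::
    "('m::topological_space, 'e::euclidean_space) chart set \<Rightarrow> 'm endo \<Rightarrow> 'm metric \<Rightarrow>
     ('n::topological_space, 'f::euclidean_space) chart set \<Rightarrow> ('m \<Rightarrow> 'n) \<Rightarrow> bool" where
  "anti_invariant M \<phi> g N \<pi> \<longleftrightarrow> (\<forall>p. \<phi> p ` ker_space M N \<pi> p \<subseteq> hor_space M g N \<pi> p)"

definition mu_space ::
    "('m::topological_space, 'e::euclidean_space) chart set \<Rightarrow> 'm endo \<Rightarrow> 'm metric \<Rightarrow>
     ('n::topological_space, 'f::euclidean_space) chart set \<Rightarrow> ('m \<Rightarrow> 'n) \<Rightarrow> 'm \<Rightarrow> 'm tvec set" where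
  "mu_space M \<phi> g N \<pi> p =
     hor_space M g N \<pi> p \<inter> orth_compl M g (\<lambda>q. \<phi> q ` ker_space M N \<pi> q) p"

definition oneill_A ::
    "('m::topological_space, 'e::euclidean_space) chart set \<Rightarrow> 'm metric \<Rightarrow> 'm conn \<Rightarrow>
     ('n::topological_space, 'f::euclidean_space) chart set \<Rightarrow> ('m \<Rightarrow> 'n) \<Rightarrow>
     'm vfield \<Rightarrow> 'm vfield \<Rightarrow> 'm vfield" where
  "oneill_A M g nabla N \<pi> E F =
     (let H = apply_endo (hor M g N \<pi>); V = apply_endo (ver M g N \<pi>)
      in H (nabla (H E) (V F)) + V (nabla (H E) (H F)))"

definition Q_tensor ::
    "('m::topological_space, 'e::euclidean_space) chart set \<Rightarrow> 'm endo \<Rightarrow> 'm metric \<Rightarrow> 'm conn \<Rightarrow>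
     ('n::topological_space, 'f::euclidean_space) chart set \<Rightarrow> ('m \<Rightarrow> 'n) \<Rightarrow>
     'm vfield \<Rightarrow> 'm vfield \<Rightarrow> 'm vfield" where
  "Q_tensor M \<phi> g nabla N \<pi> E F = apply_endo (ver M g N \<pi>) (cov_deriv_endo nabla \<phi> E F)"

text \<open>The second fundamental form of the fibres, \<open>(U, V) \<mapsto> hor (nabla U V)\<close> for vertical fields
  \<open>U\<close> and \<open>V\<close>, vanishes.\<close>

definition totally_geodesic_fibres ::
    "('m::topological_space, 'e::euclidean_space) chart set \<Rightarrow> 'm metric \<Rightarrow> 'm conn \<Rightarrow>
     ('n::topological_space, 'f::euclidean_space) chart set \<Rightarrow> ('m \<Rightarrow> 'n) \<Rightarrow> bool" where
  "totally_geodesic_fibres M g nabla N \<pi> \<longleftrightarrow>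
     (\<forall>U\<in>sections M (ker_space M N \<pi>). \<forall>V\<in>sections M (ker_space M N \<pi>).
        apply_endo (hor M g N \<pi>) (nabla U V) = 0)"

text \<open>The angle between a tangent vector and the horizontal space.  For \<open>v = 0\<close> it takes the junk
  value \<open>pi / 2\<close>; this only concerns constant geodesics, along which the Clairaut condition then
  holds trivially.\<close>

definition hor_angle ::
    "('m::topological_space, 'e::euclidean_space) chart set \<Rightarrow> 'm metric \<Rightarrow>
     ('n::topological_space, 'f::euclidean_space) chart set \<Rightarrow> ('m \<Rightarrow> 'n) \<Rightarrow>
     'm \<Rightarrow> 'm tvec \<Rightarrow> real" where
  "hor_angle M g N \<pi> p v =
     (let w = hor M g N \<pi> p v in arccos (sqrt (g p w w) / sqrt (g p v v)))"

definition clairaut ::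
    "('m::topological_space, 'e::euclidean_space) chart set \<Rightarrow> 'm metric \<Rightarrow> 'm conn \<Rightarrow>
     ('n::topological_space, 'f::euclidean_space) chart set \<Rightarrow> ('m \<Rightarrow> 'n) \<Rightarrow> ('m \<Rightarrow> real) \<Rightarrow> bool" where
  "clairaut M g nabla N \<pi> r \<longleftrightarrow>
     (\<forall>I h. geodesic_on M nabla I h \<longrightarrow>
        (\<lambda>s. r (h s) * sin (hor_angle M g N \<pi> (h s) (velocity M h s))) constant_on I)"

end

theory Submission
  imports Defs
begin

text \<open>Under these hypotheses the fibres are always totally geodesic, and the displayed identity always
  holds.  Differentiating the Clairaut relation at time \<open>0\<close> along the geodesic with initial velocity
  \<open>U + Z\<close> (\<open>U\<close> vertical, \<open>Z\<close> horizontal) gives \<open>g (Z, nabla\<^bsub>U+Z\<^esub> U) = - (U + Z)(f) g (U, U)\<close>; comparing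
  \<open>U\<close> with \<open>-U\<close> and polarising, the fibres are totally umbilical with mean curvature \<open>- grad f\<close>.
  Near-Kaehlerness gives \<open>g (nabla\<^bsub>U\<^esub> W, \<phi> U) = g (nabla\<^bsub>U\<^esub> U, \<phi> W)\<close> for vertical \<open>U, W\<close>.  Choosing \<open>W\<close>
  with \<open>\<phi> W = grad f\<close> and \<open>U \<noteq> 0\<close> orthogonal to \<open>W\<close>, possible as the fibres have dimension at least
  two, forces \<open>grad f = 0\<close>, hence a vanishing second fundamental form.  Conversely the pairing of
  \<open>A\<^bsub>\<phi>W\<^esub> \<phi>X + Q\<^bsub>W\<^esub> \<phi>X\<close> with a vertical \<open>V\<close> is \<open>- g (X, nabla\<^bsub>V\<^esub> W)\<close>, because \<open>[\<phi> W, V]\<close> is vertical for basic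
  \<open>\<phi> W\<close>.  Geodesics through every tangent vector come from a Picard iteration in a chart.\<close>

section \<open>Calculus of smooth maps\<close>

text \<open>The Clairaut relation hides two square roots and an arccosine. Squared and multiplied by
  the squared speed it reads
  \<open>(exp (f (h t)))\<^sup>2 * \<beta> t = C\<^sup>2 * \<gamma> t\<close>, where
  \<open>\<gamma>\<close> and \<open>\<beta>\<close> evaluate two smooth symmetric forms on the
  velocity: the metric, and the metric of the vertical parts. One formula serves both: the
  derivative of B(h', h') at 0 is X(B(X, X)) - 2 B(nabla X X, v), where X extends the initial
  velocity v with constant coefficients in coordinates. It turns a statement about curves into one
  about fields at a point, without differentiating B covariantly. The other obstacle is that vectors
  are derivations of globally defined functions and connections act on global fields. Local
  constructions therefore have to be cut off by bump functions, and derivations and connections have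
  to be shown to be local. The vertical and horizontal parts are given pointwise by definite
  descriptions; they are smooth because the horizontal spaces are spanned near each point by
  gradients of pulled-back coordinates, made orthogonal by a Gram-Schmidt process.\<close>

lemma Ck_on_subset: "Ck_on k S f \<Longrightarrow> T \<subseteq> S \<Longrightarrow> Ck_on k T f"
  by (induction k arbitrary: f) (auto intro: continuous_on_subset)

lemma frechet_derivative_cong_open:
  assumes "open S" "x \<in> S" "\<And>y. y \<in> S \<Longrightarrow> f y = g y" "f differentiable (at x)"
  shows "g differentiable (at x)" "frechet_derivative g (at x) = frechet_derivative f (at x)"
proof -
  have "(f has_derivative frechet_derivative f (at x)) (at x)"
    using assms(4) frechet_derivative_works by blast
  then have *: "(g has_derivative frechet_derivative f (at x)) (at x)"
    using has_derivative_transform_within_open[OF _ assms(1,2)] assms(3) by blast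
  then show "g differentiable (at x)" by (auto simp: differentiable_def)
  show "frechet_derivative g (at x) = frechet_derivative f (at x)"
    using frechet_derivative_at[OF *] by simp
qed

lemma Ck_on_cong:
  assumes "open S" "\<And>y. y \<in> S \<Longrightarrow> f y = g y" "Ck_on k S f"
  shows "Ck_on k S g"
  using assms(2,3)
proof (induction k arbitrary: f g)
  case 0
  then show ?case using continuous_on_cong[of S S f g] by simp
next
  case (Suc k)
  have d: "x \<in> S \<Longrightarrow> f differentiable (at x)" for x using Suc.prems(2) by simp
  have "Ck_on k S (\<lambda>x. frechet_derivative g (at x) v)" for v
    by (rule Suc.IH[where f="\<lambda>x. frechet_derivative f (at x) v"])
      (use Suc.prems frechet_derivative_cong_open(2)[OF assms(1) _ Suc.prems(1) d] in auto)
  then show ?case using frechet_derivative_cong_open(1)[OF assms(1) _ Suc.prems(1) d] by simp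
qed

text \<open>\<open>Ck_on\<close> takes derivatives \<open>at x\<close> and not within the set, so
  the successor clause is already pointwise; only the continuity clause needs an argument.\<close>

lemma Ck_on_local:
  assumes "\<And>x. x \<in> S \<Longrightarrow> \<exists>T. open T \<and> x \<in> T \<and> Ck_on k T f"
  shows "Ck_on k S f"
  using assms
proof (induction k arbitrary: f)
  case 0
  show ?case
    unfolding Ck_on.simps continuous_on_eq_continuous_within
    using 0 by (meson Ck_on.simps(1) continuous_at_imp_continuous_at_within continuous_on_eq_continuous_at)
next
  case (Suc k)
  have "Ck_on k S (\<lambda>x. frechet_derivative f (at x) v)" for v
  proof (rule Suc.IH)
    show "\<exists>T. open T \<and> x \<in> T \<and> Ck_on k T (\<lambda>x. frechet_derivative f (at x) v)" if "x \<in> S" for x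
      using Suc.prems[OF that] by auto
  qed
  moreover have "f differentiable (at x)" if "x \<in> S" for x
    using Suc.prems[OF that] by auto
  ultimately show ?case by simp
qed

text \<open>\<open>frechet_derivative\<close> is a choice term. This rule replaces it by an explicit
  formula \<open>f'\<close>, so that the inductions below only have to differentiate
  formulas.\<close>

lemma Ck_on_SucI:
  assumes "open S" "\<And>x. x \<in> S \<Longrightarrow> (f has_derivative f' x) (at x)" "\<And>v. Ck_on k S (\<lambda>x. f' x v)"
  shows "Ck_on (Suc k) S f"
proof -
  have "frechet_derivative f (at x) = f' x" if "x \<in> S" for x
    using frechet_derivative_at[OF assms(2)[OF that]] by simp
  then have "Ck_on k S (\<lambda>x. frechet_derivative f (at x) v)" for v
    using Ck_on_cong[OF assms(1) _ assms(3)[of v], of "\<lambda>x. frechet_derivative f (at x) v"] by simp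
  moreover have "f differentiable (at x)" if "x \<in> S" for x
    using assms(2)[OF that] by (rule differentiableI)
  ultimately show ?thesis by simp
qed

lemma Ck_on_SucD:
  assumes "Ck_on (Suc k) S f"
  shows "x \<in> S \<Longrightarrow> (f has_derivative frechet_derivative f (at x)) (at x)"
    and "Ck_on k S (\<lambda>x. frechet_derivative f (at x) v)"
  using assms by (simp_all add: frechet_derivative_works[symmetric])

lemma Ck_on_pred: "Ck_on (Suc k) S f \<Longrightarrow> Ck_on k S f"
proof (induction k arbitrary: f)
  case 0
  then show ?case
    by (auto intro!: continuous_at_imp_continuous_on differentiable_imp_continuous_within)
next
  case (Suc k)
  show ?case
    unfolding Ck_on.simps(2)[of k S f] using Suc.IH Ck_on_SucD(2)[OF Suc.prems] Suc.prems by simp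
qed

lemma Ck_on_const [simp]: "Ck_on k S (\<lambda>x. c)"
  by (induction k arbitrary: c) auto

lemma Ck_on_bounded_linear_comp:
  assumes "open S" "bounded_linear L" "Ck_on k S f"
  shows "Ck_on k S (\<lambda>x. L (f x))"
  using assms(3)
proof (induction k arbitrary: f)
  case 0
  then show ?case using bounded_linear.continuous_on[OF assms(2)] by simp
next
  case (Suc k)
  show ?case
  proof (rule Ck_on_SucI[OF assms(1), where f'="\<lambda>x v. L (frechet_derivative f (at x) v)"])
    show "((\<lambda>x. L (f x)) has_derivative (\<lambda>v. L (frechet_derivative f (at x) v))) (at x)" if "x \<in> S" for x
      by (rule bounded_linear.has_derivative[OF assms(2) Ck_on_SucD(1)[OF Suc.prems that]])
    show "Ck_on k S (\<lambda>x. L (frechet_derivative f (at x) v))" for v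
      by (rule Suc.IH[OF Ck_on_SucD(2)[OF Suc.prems]])
  qed
qed

lemma Ck_on_add:
  assumes "open S" "Ck_on k S f" "Ck_on k S g"
  shows "Ck_on k S (\<lambda>x. f x + g x)"
  using assms(2,3)
proof (induction k arbitrary: f g)
  case 0
  then show ?case by (simp add: continuous_on_add)
next
  case (Suc k)
  show ?case
  proof (rule Ck_on_SucI[OF assms(1), where
          f'="\<lambda>x v. frechet_derivative f (at x) v + frechet_derivative g (at x) v"])
    show "((\<lambda>x. f x + g x) has_derivative
        (\<lambda>v. frechet_derivative f (at x) v + frechet_derivative g (at x) v)) (at x)" if "x \<in> S" for x
      by (rule has_derivative_add[OF Ck_on_SucD(1)[OF Suc.prems(1) that] Ck_on_SucD(1)[OF Suc.prems(2) that]])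
    show "Ck_on k S (\<lambda>x. frechet_derivative f (at x) v + frechet_derivative g (at x) v)" for v
      by (rule Suc.IH[OF Ck_on_SucD(2)[OF Suc.prems(1)] Ck_on_SucD(2)[OF Suc.prems(2)]])
  qed
qed

lemma Ck_on_sum:
  assumes "open S" "\<And>i. i \<in> A \<Longrightarrow> Ck_on k S (f i)"
  shows "Ck_on k S (\<lambda>x. \<Sum>i\<in>A. f i x)"
  using assms(2)
  by (induction A rule: infinite_finite_induct) (auto intro!: Ck_on_add assms(1))

lemma Ck_on_bilinear:
  assumes "open S" "bounded_bilinear B" "Ck_on k S f" "Ck_on k S g"
  shows "Ck_on k S (\<lambda>x. B (f x) (g x))"
  using assms(3,4)
proof (induction k arbitrary: f g)
  case 0
  then show ?case using bounded_bilinear.continuous_on[OF assms(2)] by auto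
next
  case (Suc k)
  show ?case
  proof (rule Ck_on_SucI[OF assms(1), where
          f'="\<lambda>x v. B (f x) (frechet_derivative g (at x) v) + B (frechet_derivative f (at x) v) (g x)"])
    fix x assume "x \<in> S"
    then show "((\<lambda>x. B (f x) (g x)) has_derivative
        (\<lambda>v. B (f x) (frechet_derivative g (at x) v) + B (frechet_derivative f (at x) v) (g x))) (at x)"
      by (intro bounded_bilinear.FDERIV[OF assms(2)] Ck_on_SucD(1)[OF Suc.prems(1)] Ck_on_SucD(1)[OF Suc.prems(2)])
  next
    fix v
    show "Ck_on k S (\<lambda>x. B (f x) (frechet_derivative g (at x) v) + B (frechet_derivative f (at x) v) (g x))"
      by (intro Ck_on_add[OF assms(1)] Suc.IH Ck_on_pred[OF Suc.prems(1)] Ck_on_pred[OF Suc.prems(2)]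
          Ck_on_SucD(2)[OF Suc.prems(1)] Ck_on_SucD(2)[OF Suc.prems(2)])
  qed
qed

lemma Ck_on_inverse:
  fixes f :: "'a::euclidean_space \<Rightarrow> real"
  assumes "open S" "Ck_on k S f" "\<And>x. x \<in> S \<Longrightarrow> f x \<noteq> 0"
  shows "Ck_on k S (\<lambda>x. inverse (f x))"
  using assms(2)
proof (induction k)
  case 0
  then show ?case using assms(3) by (simp add: continuous_on_inverse)
next
  case (Suc k)
  show ?case
  proof (rule Ck_on_SucI[OF assms(1), where
        f'="\<lambda>x v. - (inverse (f x) * frechet_derivative f (at x) v * inverse (f x))"])
    fix x assume "x \<in> S"
    then show "((\<lambda>x. inverse (f x)) has_derivative
        (\<lambda>v. - (inverse (f x) * frechet_derivative f (at x) v * inverse (f x)))) (at x)"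
      using Deriv.has_derivative_inverse[OF assms(3) Ck_on_SucD(1)[OF Suc.prems]] by simp
  next
    fix v
    \<comment> \<open>The derivative contains 1/f again; the induction hypothesis applies to it once
      f is known to be of class k as well.\<close>
    have i: "Ck_on k S (\<lambda>x. inverse (f x))" using Suc Ck_on_pred by blast
    show "Ck_on k S (\<lambda>x. - (inverse (f x) * frechet_derivative f (at x) v * inverse (f x)))"
      by (intro Ck_on_bounded_linear_comp[OF assms(1) bounded_linear_minus[OF bounded_linear_ident]]
          Ck_on_bilinear[OF assms(1) bounded_bilinear_mult] i Ck_on_SucD(2)[OF Suc.prems])
  qed
qed

text \<open>The chain rule differentiates f in the direction \<open>?Dg x v\<close>, which varies
  with x, whereas \<open>Ck_on\<close> speaks only of fixed directions. Expanding that direction in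
  \<open>Basis\<close> leaves fixed directions with variable scalar coefficients.\<close>

lemma Ck_on_compose:
  fixes g :: "'a::euclidean_space \<Rightarrow> 'b::euclidean_space" and f :: "'b \<Rightarrow> 'c::real_normed_vector"
  assumes "open S" "Ck_on k S g" "Ck_on k T f" "g ` S \<subseteq> T"
  shows "Ck_on k S (\<lambda>x. f (g x))"
  using assms(2-)
proof (induction k arbitrary: f)
  case 0
  then show ?case using continuous_on_compose2 by auto
next
  case (Suc k)
  let ?Df = "\<lambda>x. frechet_derivative f (at (g x))"
  let ?Dg = "\<lambda>x. frechet_derivative g (at x)"
  show ?case
  proof (rule Ck_on_SucI[OF assms(1), where f'="\<lambda>x v. \<Sum>b\<in>Basis. (?Dg x v \<bullet> b) *\<^sub>R ?Df x b"])
    fix x assume x: "x \<in> S"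
    have f: "(f has_derivative ?Df x) (at (g x))" using Ck_on_SucD(1)[OF Suc.prems(2)] x Suc.prems by blast
    have g: "(g has_derivative ?Dg x) (at x)" using Ck_on_SucD(1)[OF Suc.prems(1)] x by blast
    have lin: "linear (?Df x)" using f has_derivative_linear by blast
    have "?Df x w = (\<Sum>b\<in>Basis. (w \<bullet> b) *\<^sub>R ?Df x b)" for w
      by (subst euclidean_representation[symmetric, of w])
        (simp only: linear_sum[OF lin] linear_cmul[OF lin])
    then have "?Df x \<circ> ?Dg x = (\<lambda>v. \<Sum>b\<in>Basis. (?Dg x v \<bullet> b) *\<^sub>R ?Df x b)"
      unfolding o_def by (intro ext)
    then show "((\<lambda>x. f (g x)) has_derivative (\<lambda>v. \<Sum>b\<in>Basis. (?Dg x v \<bullet> b) *\<^sub>R ?Df x b)) (at x)"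
      using diff_chain_at[OF g f] by (simp add: o_def)
  next
    fix v
    show "Ck_on k S (\<lambda>x. \<Sum>b\<in>Basis. (?Dg x v \<bullet> b) *\<^sub>R ?Df x b)"
      by (intro Ck_on_sum[OF assms(1)] Ck_on_bilinear[OF assms(1) bounded_bilinear_scaleR]
          Ck_on_bounded_linear_comp[OF assms(1) bounded_linear_inner_left] Suc.IH Suc.prems(3)
          Ck_on_pred[OF Suc.prems(1)] Ck_on_SucD(2)[OF Suc.prems(1)] Ck_on_SucD(2)[OF Suc.prems(2)])
  qed
qed

lemma Ck_on_id [simp]: "open S \<Longrightarrow> Ck_on k S (\<lambda>x. x)"
  by (cases k) (auto intro!: Ck_on_SucI[where f'="\<lambda>x v. v"] continuous_intros)

section \<open>Closure properties of smooth maps\<close>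

lemma smooth_on_subset: "smooth_on S f \<Longrightarrow> T \<subseteq> S \<Longrightarrow> smooth_on T f"
  by (auto simp: smooth_on_def intro: Ck_on_subset)

lemma smooth_on_cong: "open S \<Longrightarrow> (\<And>y. y \<in> S \<Longrightarrow> f y = g y) \<Longrightarrow> smooth_on S f \<Longrightarrow> smooth_on S g"
  unfolding smooth_on_def using Ck_on_cong[of S f g] by simp

lemma smooth_on_local:
  assumes "\<And>x. x \<in> S \<Longrightarrow> \<exists>T. open T \<and> x \<in> T \<and> smooth_on T f"
  shows "smooth_on S f"
  unfolding smooth_on_def
proof
  show "Ck_on k S f" for k
    by (rule Ck_on_local) (use assms in \<open>auto simp: smooth_on_def\<close>)
qed

lemma smooth_on_imp_continuous: "smooth_on S f \<Longrightarrow> continuous_on S f"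
  using Ck_on.simps(1)[of S f] by (simp only: smooth_on_def)

lemma smooth_on_has_derivative:
  "smooth_on S f \<Longrightarrow> x \<in> S \<Longrightarrow> (f has_derivative frechet_derivative f (at x)) (at x)"
  using Ck_on_SucD(1)[of 0 S f x] by (simp only: smooth_on_def)

lemma smooth_on_frechet: "smooth_on S f \<Longrightarrow> smooth_on S (\<lambda>x. frechet_derivative f (at x) v)"
  unfolding smooth_on_def by (metis Ck_on_SucD(2))

lemma smooth_on_const [simp]: "smooth_on S (\<lambda>x. c)"
  by (simp add: smooth_on_def)

lemma smooth_on_id [simp]: "open S \<Longrightarrow> smooth_on S (\<lambda>x. x)"
  by (simp add: smooth_on_def)

lemma smooth_on_bounded_linear:
  "open S \<Longrightarrow> bounded_linear L \<Longrightarrow> smooth_on S f \<Longrightarrow> smooth_on S (\<lambda>x. L (f x))"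
  by (simp add: smooth_on_def Ck_on_bounded_linear_comp)

lemma smooth_on_inner: "open S \<Longrightarrow> smooth_on S f \<Longrightarrow> smooth_on S (\<lambda>x. f x \<bullet> c)"
  using smooth_on_bounded_linear[OF _ bounded_linear_inner_left] .

lemma smooth_on_add: "open S \<Longrightarrow> smooth_on S f \<Longrightarrow> smooth_on S g \<Longrightarrow> smooth_on S (\<lambda>x. f x + g x)"
  by (simp add: smooth_on_def Ck_on_add)

lemma smooth_on_minus: "open S \<Longrightarrow> smooth_on S f \<Longrightarrow> smooth_on S (\<lambda>x. - f x)"
  by (rule smooth_on_bounded_linear[OF _ bounded_linear_minus[OF bounded_linear_ident]])

lemma smooth_on_diff: "open S \<Longrightarrow> smooth_on S f \<Longrightarrow> smooth_on S g \<Longrightarrow> smooth_on S (\<lambda>x. f x - g x)"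
  using smooth_on_add[OF _ _ smooth_on_minus, of S f g] by simp

lemma smooth_on_sum:
  "open S \<Longrightarrow> (\<And>i. i \<in> A \<Longrightarrow> smooth_on S (f i)) \<Longrightarrow> smooth_on S (\<lambda>x. \<Sum>i\<in>A. f i x)"
  by (simp add: smooth_on_def Ck_on_sum)

lemma smooth_on_scaleR:
  "open S \<Longrightarrow> smooth_on S f \<Longrightarrow> smooth_on S g \<Longrightarrow> smooth_on S (\<lambda>x. f x *\<^sub>R g x)"
  by (simp add: smooth_on_def Ck_on_bilinear[OF _ bounded_bilinear_scaleR])

lemma smooth_on_mult:
  fixes f g :: "'a::euclidean_space \<Rightarrow> real"
  shows "open S \<Longrightarrow> smooth_on S f \<Longrightarrow> smooth_on S g \<Longrightarrow> smooth_on S (\<lambda>x. f x * g x)"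
  by (simp add: smooth_on_def Ck_on_bilinear[OF _ bounded_bilinear_mult])

lemma smooth_on_inverse:
  fixes f :: "'a::euclidean_space \<Rightarrow> real"
  shows "open S \<Longrightarrow> smooth_on S f \<Longrightarrow> (\<And>x. x \<in> S \<Longrightarrow> f x \<noteq> 0) \<Longrightarrow> smooth_on S (\<lambda>x. inverse (f x))"
  by (simp add: smooth_on_def Ck_on_inverse)

lemma smooth_on_compose:
  fixes g :: "'a::euclidean_space \<Rightarrow> 'b::euclidean_space" and f :: "'b \<Rightarrow> 'c::real_normed_vector"
  shows "open S \<Longrightarrow> smooth_on S g \<Longrightarrow> smooth_on T f \<Longrightarrow> g ` S \<subseteq> T \<Longrightarrow> smooth_on S (\<lambda>x. f (g x))"
  using Ck_on_compose[of S _ g T f] by (simp add: smooth_on_def)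

lemma smooth_on_Pair:
  fixes f :: "'a::euclidean_space \<Rightarrow> 'b::euclidean_space" and g :: "'a \<Rightarrow> 'c::euclidean_space"
  assumes "open S" "smooth_on S f" "smooth_on S g"
  shows "smooth_on S (\<lambda>x. (f x, g x))"
proof -
  have "bounded_linear (\<lambda>x::'b. (x, 0::'c))" "bounded_linear (\<lambda>x::'c. (0::'b, x))"
    by (auto intro!: bounded_linear_Pair bounded_linear_ident bounded_linear_zero)
  then have "smooth_on S (\<lambda>x. (f x, 0::'c) + (0::'b, g x))"
    using assms by (intro smooth_on_add smooth_on_bounded_linear[where L="\<lambda>x. (x, 0)"]
      smooth_on_bounded_linear[where L="\<lambda>x. (0, x)"]) auto
  then show ?thesis by simp
qed

section \<open>Smooth bump functions\<close>

text \<open>The classical flat function exp(-1/t), multiplied by powers of 1/t so that derivatives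
  of members are linear combinations of members; smoothness then follows by one induction over all n
  at once.\<close>

definition flat_exp :: "nat \<Rightarrow> real \<Rightarrow> real" where
  "flat_exp n t = (if 0 < t then inverse t ^ n * exp (- inverse t) else 0)"

lemma flat_exp_tendsto_0: "(flat_exp n \<longlongrightarrow> 0) (at 0)"
proof (rule filterlim_split_at)
  have "eventually (\<lambda>t. flat_exp n t = 0) (at_left 0)"
    unfolding eventually_at_left_field by (auto simp: flat_exp_def intro!: exI[of _ "-1"])
  then show "(flat_exp n \<longlongrightarrow> 0) (at_left 0)" by (rule tendsto_eventually)
  \<comment> \<open>With s = 1/t the right-hand limit becomes the decay of s^n / exp s at
    infinity.\<close>
  have "((\<lambda>s::real. s ^ n / exp s) \<longlongrightarrow> 0) at_top" by (rule tendsto_power_div_exp_0)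
  then have "((\<lambda>t::real. inverse t ^ n / exp (inverse t)) \<longlongrightarrow> 0) (at_right 0)"
    using filterlim_compose filterlim_inverse_at_top_right by blast
  moreover have "eventually (\<lambda>t. inverse t ^ n / exp (inverse t) = flat_exp n t) (at_right 0)"
    unfolding eventually_at_right_field
    by (auto simp: flat_exp_def exp_minus divide_inverse intro!: exI[of _ 1])
  ultimately show "(flat_exp n \<longlongrightarrow> 0) (at_right 0)"
    by (rule Lim_transform_eventually)
qed

lemma flat_exp_has_derivative:
  "(flat_exp n has_real_derivative (- real n * flat_exp (Suc n) t + flat_exp (Suc (Suc n)) t)) (at t)"
proof (cases "t = 0")
  case True
  \<comment> \<open>At 0 the difference quotient of \<open>flat_exp n\<close> is
    \<open>flat_exp (Suc n)\<close>, whose limit is known.\<close>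
  have "((\<lambda>h. (flat_exp n (0 + h) - flat_exp n 0) / h) \<longlongrightarrow> 0) (at 0)"
  proof (rule Lim_transform_eventually[OF flat_exp_tendsto_0[of "Suc n"]])
    show "eventually (\<lambda>h. flat_exp (Suc n) h = (flat_exp n (0 + h) - flat_exp n 0) / h) (at 0)"
      by (rule always_eventually) (auto simp: flat_exp_def divide_inverse)
  qed
  then show ?thesis using True by (simp add: DERIV_def flat_exp_def)
next
  case False
  show ?thesis
  proof (cases "t > 0")
    case True
    have "((\<lambda>t. inverse t ^ n * exp (- inverse t)) has_real_derivative
        (- real n * flat_exp (Suc n) t + flat_exp (Suc (Suc n)) t)) (at t)"
      using True
      by (auto intro!: derivative_eq_intros simp: flat_exp_def power2_eq_square field_simps)
        (cases n; simp add: field_simps)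
    then show ?thesis
      by (rule has_field_derivative_transform_within_open[where S="{0<..}"])
        (use True in \<open>auto simp: flat_exp_def\<close>)
  next
    case neg: False
    have "((\<lambda>t. 0) has_real_derivative 0) (at t)" by simp
    then have "(flat_exp n has_real_derivative 0) (at t)"
      by (rule has_field_derivative_transform_within_open[where S="{..<0}"])
        (use False neg in \<open>auto simp: flat_exp_def\<close>)
    then show ?thesis using neg by (simp add: flat_exp_def)
  qed
qed

lemma smooth_on_flat_exp: "smooth_on UNIV (flat_exp n)"
proof -
  have "Ck_on k UNIV (flat_exp n)" for k
  proof (induction k arbitrary: n)
    case 0
    then show ?case
      using flat_exp_has_derivative by (auto intro!: continuous_at_imp_continuous_on DERIV_isCont)
  next
    case (Suc k)
    show ?case
    proof (rule Ck_on_SucI)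
      show "(flat_exp n has_derivative
          (\<lambda>v. (- real n * flat_exp (Suc n) t + flat_exp (Suc (Suc n)) t) * v)) (at t)" for t
        using flat_exp_has_derivative[of n t] by (simp add: has_field_derivative_def)
      show "Ck_on k UNIV (\<lambda>t. (- real n * flat_exp (Suc n) t + flat_exp (Suc (Suc n)) t) * v)" for v
        by (intro Ck_on_bilinear[OF _ bounded_bilinear_mult] Ck_on_add Suc.IH Ck_on_const) auto
    qed simp
  qed
  then show ?thesis by (simp add: smooth_on_def)
qed

text \<open>The bump is a/(a + b), with a positive exactly inside the ball of radius 2r and b
  positive exactly outside the closed ball of radius r, so the denominator never vanishes. Squared
  distances keep the arguments smooth at the centre.\<close>

lemma smooth_bump_euclidean:
  fixes x0 :: "'a::euclidean_space"
  assumes "0 < r"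
  obtains \<rho> :: "'a \<Rightarrow> real" where "smooth_on UNIV \<rho>" "\<And>x. x \<in> ball x0 r \<Longrightarrow> \<rho> x = 1"
    "\<And>x. x \<notin> ball x0 (2 * r) \<Longrightarrow> \<rho> x = 0" "\<And>x. 0 \<le> \<rho> x" "\<And>x. \<rho> x \<le> 1"
proof
  let ?q = "\<lambda>x. (x - x0) \<bullet> (x - x0)"
  let ?a = "\<lambda>x. flat_exp 0 (4 * r\<^sup>2 - ?q x)" and ?b = "\<lambda>x. flat_exp 0 (?q x - r\<^sup>2)"
  let ?c = "\<lambda>x. ?a x * inverse (?a x + ?b x)"
  have q: "?q x = (dist x0 x)\<^sup>2" for x
    by (simp add: dist_norm power2_norm_eq_inner inner_diff_left inner_diff_right inner_commute)
  have nn: "?a x \<ge> 0" "?b x \<ge> 0" for x by (auto simp: flat_exp_def)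
  have r2: "r\<^sup>2 < 4 * r\<^sup>2" using assms by simp
  have pos: "?a x + ?b x > 0" for x
  proof (cases "?q x < 4 * r\<^sup>2")
    case True
    then have "?a x > 0" by (simp add: flat_exp_def)
    then show ?thesis using nn[of x] by linarith
  next
    case False
    then have "?q x - r\<^sup>2 > 0" using r2 by linarith
    then have "?b x > 0" by (simp add: flat_exp_def)
    then show ?thesis using nn[of x] by linarith
  qed
  have "smooth_on UNIV ?q"
    unfolding smooth_on_def
    by (intro allI Ck_on_bilinear[OF _ bounded_bilinear_inner])
      (use smooth_on_diff[OF open_UNIV smooth_on_id[OF open_UNIV] smooth_on_const] in \<open>auto simp: smooth_on_def\<close>)
  then have "smooth_on UNIV (\<lambda>x. 4 * r\<^sup>2 - ?q x)" "smooth_on UNIV (\<lambda>x. ?q x - r\<^sup>2)"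
    by (intro smooth_on_diff smooth_on_const; simp)+
  then have "smooth_on UNIV ?a" "smooth_on UNIV ?b"
    using smooth_on_compose[OF open_UNIV _ smooth_on_flat_exp] by auto
  then show "smooth_on UNIV ?c"
    using pos by (intro smooth_on_mult smooth_on_inverse smooth_on_add) (auto simp: less_imp_neq[symmetric])
  show "?c x = 1" if "x \<in> ball x0 r" for x
  proof -
    have "dist x0 x < r" using that by simp
    then have "?q x \<le> r\<^sup>2" unfolding q by (simp add: power_mono less_imp_le)
    then have "?b x = 0" by (simp add: flat_exp_def)
    then show ?thesis using pos[of x] by simp
  qed
  show "?c x = 0" if "x \<notin> ball x0 (2 * r)" for x
  proof -
    have "2 * r \<le> dist x0 x" using that by simp
    then have "(2 * r)\<^sup>2 \<le> ?q x" unfolding q using assms by (intro power_mono) auto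
    then have "?a x = 0" by (simp add: flat_exp_def power_mult_distrib)
    then show ?thesis by simp
  qed
  show "0 \<le> ?c x" for x using nn[of x] pos[of x] by simp
  show "?c x \<le> 1" for x using nn[of x] pos[of x] by (simp add: divide_simps flip: divide_inverse)
qed

section \<open>Hadamard's lemma\<close>

lemma segment_in_ball:
  fixes x0 :: "'a::euclidean_space"
  assumes "x \<in> ball x0 r" "0 \<le> t" "t \<le> 1"
  shows "x0 + t *\<^sub>R (x - x0) \<in> ball x0 r"
proof -
  have "t * norm (x - x0) \<le> 1 * norm (x - x0)" using assms by (intro mult_right_mono) auto
  also have "... < r" using assms by (simp add: dist_norm norm_minus_commute)
  finally show ?thesis using assms by (simp add: dist_norm)
qed

lemma continuous_on_segment_average:
  fixes x0 :: "'a::euclidean_space" and u :: "'a \<Rightarrow> real"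
  assumes "continuous_on (ball x0 r) u" "continuous_on {0..1} \<theta>"
  shows "continuous_on (ball x0 r \<times> cbox 0 1) (\<lambda>(x, t). \<theta> t * u (x0 + t *\<^sub>R (x - x0)))"
proof -
  have "continuous_on (ball x0 r \<times> cbox 0 1) (\<lambda>p. \<theta> (snd p))"
    by (rule continuous_on_compose2[OF assms(2)]) (auto intro!: continuous_intros)
  moreover have "continuous_on (ball x0 r \<times> cbox 0 1) (\<lambda>p. u (x0 + snd p *\<^sub>R (fst p - x0)))"
  proof (rule continuous_on_compose2[OF assms(1)])
    show "continuous_on (ball x0 r \<times> cbox 0 1) (\<lambda>p. x0 + snd p *\<^sub>R (fst p - x0))"
      by (intro continuous_intros)
    show "(\<lambda>p. x0 + snd p *\<^sub>R (fst p - x0)) ` (ball x0 r \<times> cbox 0 1) \<subseteq> ball x0 r"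
    proof (rule image_subsetI)
      fix p assume "p \<in> ball x0 r \<times> cbox (0::real) 1"
      then show "x0 + snd p *\<^sub>R (fst p - x0) \<in> ball x0 r"
        using segment_in_ball[of "fst p" x0 r "snd p"] by (simp only: mem_Times_iff cbox_interval atLeastAtMost_iff)
    qed
  qed
  ultimately show ?thesis unfolding case_prod_beta by (rule continuous_on_mult)
qed

lemma continuous_on_slice:
  assumes "continuous_on (A \<times> C) (\<lambda>(x, t). f x t)" "x \<in> A"
  shows "continuous_on C (f x)"
proof -
  have "continuous_on C (\<lambda>t. (x, t))"
    by (intro continuous_on_Pair continuous_on_const continuous_on_id)
  then have "continuous_on C (\<lambda>t. case (x, t) of (x, t) \<Rightarrow> f x t)"
    by (rule continuous_on_compose2[OF assms(1)]) (use assms(2) in auto)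
  then show ?thesis by simp
qed

lemma integrable_segment_average:
  fixes x0 :: "'a::euclidean_space" and u :: "'a \<Rightarrow> real"
  assumes "continuous_on (ball x0 r) u" "continuous_on {0..1} \<theta>" "x \<in> ball x0 r"
  shows "(\<lambda>t. \<theta> t * u (x0 + t *\<^sub>R (x - x0))) integrable_on cbox 0 1"
  by (rule integrable_continuous[OF continuous_on_slice[OF continuous_on_segment_average[OF assms(1,2)] assms(3)]])

lemma Ck_on_imp_continuous: "Ck_on k S f \<Longrightarrow> continuous_on S f"
  by (induction k) (auto dest: Ck_on_pred simp del: Ck_on.simps(2))

text \<open>Differentiation under the integral sign brings out a factor t. The arbitrary weight
  \<open>\<theta>\<close> absorbs it and makes the statement inductive.\<close>

lemma Ck_on_segment_average:
  fixes x0 :: "'a::euclidean_space" and u :: "'a \<Rightarrow> real"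
  assumes "Ck_on k (ball x0 r) u" "continuous_on {0..1} \<theta>"
  shows "Ck_on k (ball x0 r) (\<lambda>x. integral (cbox 0 1) (\<lambda>t. \<theta> t * u (x0 + t *\<^sub>R (x - x0))))"
  using assms
proof (induction k arbitrary: u \<theta>)
  case 0
  then show ?case
    using integral_continuous_on_param[OF continuous_on_segment_average[of x0 r u \<theta>]] by simp
next
  case (Suc k)
  let ?B = "ball x0 r" and ?\<gamma> = "\<lambda>x t. x0 + t *\<^sub>R (x - x0)"
  let ?d = "\<lambda>b y. frechet_derivative u (at y) b"
  \<comment> \<open>The derivative of the integrand, as the bounded linear function that the Leibniz
    rule wants. Written with coordinate functionals, its joint continuity reduces to that of the
    partial derivatives.\<close>
  let ?fx = "\<lambda>x t. \<Sum>b\<in>Basis. (\<theta> t * t * ?d b (?\<gamma> x t)) *\<^sub>R blinfun_inner_left b"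
  have \<theta>: "continuous_on {0..1} (\<lambda>t. \<theta> t * t)" using Suc.prems(2) by (intro continuous_intros)
  have cd: "continuous_on ?B (?d v)" for v
    using Ck_on_imp_continuous[OF Ck_on_SucD(2)[OF Suc.prems(1)]] .
  have du: "?d v y = (\<Sum>b\<in>Basis. (v \<bullet> b) * ?d b y)" if "y \<in> ?B" for v y
  proof -
    have lin: "linear (frechet_derivative u (at y))"
      using Ck_on_SucD(1)[OF Suc.prems(1) that] has_derivative_linear by blast
    have "?d v y = frechet_derivative u (at y) (\<Sum>b\<in>Basis. (v \<bullet> b) *\<^sub>R b)"
      by (simp add: euclidean_representation)
    then show ?thesis by (simp only: linear_sum[OF lin] linear_cmul[OF lin] real_scaleR_def)
  qed
  have fx: "?fx x t v = \<theta> t * t * ?d v (?\<gamma> x t)" if "x \<in> ?B" "t \<in> cbox 0 1" for x t v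
  proof -
    have "?\<gamma> x t \<in> ?B" using that segment_in_ball[of x x0 r t] by simp
    note du[OF this, of v]
    then show ?thesis
      by (simp add: blinfun.sum_left blinfun.scaleR_left sum_distrib_left mult_ac inner_commute)
  qed
  have cfx: "continuous_on (?B \<times> cbox 0 1) (\<lambda>(x, t). ?fx x t)"
    unfolding case_prod_beta
    using continuous_on_segment_average[OF cd \<theta>, unfolded case_prod_beta]
    by (intro continuous_on_sum continuous_on_scaleR continuous_on_const)
  show ?case
  proof (rule Ck_on_SucI[OF open_ball, where f'="\<lambda>x. blinfun_apply (integral (cbox 0 1) (?fx x))"])
    fix x assume x: "x \<in> ?B"
    have "((\<lambda>x. integral (cbox 0 1) (\<lambda>t. \<theta> t * u (?\<gamma> x t)))
        has_derivative blinfun_apply (integral (cbox 0 1) (?fx x))) (at x within ?B)"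
    proof (rule leibniz_rule[OF _ _ cfx x convex_ball])
      fix y :: 'a and t :: real assume y: "y \<in> ?B" and t: "t \<in> cbox 0 1"
      have g: "?\<gamma> y t \<in> ?B" using y t segment_in_ball[of y x0 r t] by simp
      have "((\<lambda>x. ?\<gamma> x t) has_derivative (\<lambda>v. t *\<^sub>R v)) (at y)"
        by (auto intro!: derivative_eq_intros)
      from diff_chain_at[OF this Ck_on_SucD(1)[OF Suc.prems(1) g]]
      have "((\<lambda>x. \<theta> t * u (?\<gamma> x t)) has_derivative (\<lambda>v. \<theta> t * frechet_derivative u (at (?\<gamma> y t)) (t *\<^sub>R v))) (at y)"
        unfolding o_def by (rule has_derivative_mult_right)
      moreover have "\<theta> t * frechet_derivative u (at (?\<gamma> y t)) (t *\<^sub>R v) = ?fx y t v" for v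
      proof -
        have "linear (frechet_derivative u (at (?\<gamma> y t)))"
          using Ck_on_SucD(1)[OF Suc.prems(1) g] has_derivative_linear by blast
        then show ?thesis unfolding fx[OF y t] by (simp add: linear_cmul)
      qed
      ultimately have "((\<lambda>x. \<theta> t * u (?\<gamma> x t)) has_derivative blinfun_apply (?fx y t)) (at y)"
        by (simp only:)
      then show "((\<lambda>x. \<theta> t * u (?\<gamma> x t)) has_derivative blinfun_apply (?fx y t)) (at y within ?B)"
        by (rule has_derivative_at_withinI)
    next
      fix y assume y: "y \<in> ?B"
      have cu: "continuous_on ?B u"
        using Ck_on_imp_continuous[OF Suc.prems(1)] .
      show "(\<lambda>t. \<theta> t * u (?\<gamma> y t)) integrable_on cbox 0 1"
        by (rule integrable_segment_average[OF cu Suc.prems(2) y])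
    qed
    then show "((\<lambda>x. integral (cbox 0 1) (\<lambda>t. \<theta> t * u (?\<gamma> x t)))
        has_derivative blinfun_apply (integral (cbox 0 1) (?fx x))) (at x)"
      using x by (simp add: at_within_open[OF _ open_ball])
  next
    fix v
    have eq: "blinfun_apply (integral (cbox 0 1) (?fx x)) v
        = integral (cbox 0 1) (\<lambda>t. \<theta> t * t * ?d v (?\<gamma> x t))" if "x \<in> ?B" for x
    proof -
      have "?fx x integrable_on cbox 0 1"
        by (rule integrable_continuous[OF continuous_on_slice[OF cfx that]])
      from blinfun_apply_integral[OF this, of v]
      have "blinfun_apply (integral (cbox 0 1) (?fx x)) v = integral (cbox 0 1) (\<lambda>t. ?fx x t v)" .
      also have "... = integral (cbox 0 1) (\<lambda>t. \<theta> t * t * ?d v (?\<gamma> x t))"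
        by (rule integral_cong) (rule fx[OF that])
      finally show ?thesis .
    qed
    have "Ck_on k ?B (\<lambda>x. integral (cbox 0 1) (\<lambda>t. \<theta> t * t * ?d v (?\<gamma> x t)))"
      by (rule Suc.IH[OF Ck_on_SucD(2)[OF Suc.prems(1)] \<theta>])
    show "Ck_on k ?B (\<lambda>x. blinfun_apply (integral (cbox 0 1) (?fx x)) v)"
      by (rule Ck_on_cong[OF open_ball, rotated]) (fact, simp only: eq)
  qed
qed

text \<open>The fundamental theorem of calculus along the segment from x0 to x; \<open>G b\<close>
  is the average of the b-th partial derivative over that segment.\<close>

lemma hadamard:
  fixes x0 :: "'a::euclidean_space" and u :: "'a \<Rightarrow> real"
  assumes "smooth_on (ball x0 r) u" "0 < r"
  obtains G where "\<And>b. smooth_on (ball x0 r) (G b)"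
    "\<And>x. x \<in> ball x0 r \<Longrightarrow> u x = u x0 + (\<Sum>b\<in>Basis. ((x - x0) \<bullet> b) * G b x)"
    "\<And>b. G b x0 = frechet_derivative u (at x0) b"
proof
  let ?d = "\<lambda>b y. frechet_derivative u (at y) b" and ?\<gamma> = "\<lambda>x t. x0 + t *\<^sub>R (x - x0)"
  let ?G = "\<lambda>b x. integral (cbox 0 1) (\<lambda>t. 1 * ?d b (?\<gamma> x t))"
  have sd: "smooth_on (ball x0 r) (?d b)" for b using smooth_on_frechet[OF assms(1)] .
  show "smooth_on (ball x0 r) (?G b)" for b
    unfolding smooth_on_def using Ck_on_segment_average[OF _ continuous_on_const, of _ x0 r "?d b" 1] sd[of b]
    by (simp add: smooth_on_def)
  show "?G b x0 = ?d b x0" for b by simp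
  fix x assume x: "x \<in> ball x0 r"
  have int: "(\<lambda>t. 1 * ?d b (?\<gamma> x t)) integrable_on cbox 0 1" for b
    by (rule integrable_segment_average[OF smooth_on_imp_continuous[OF sd] continuous_on_const x])
  have "((\<lambda>t. \<Sum>b\<in>Basis. ((x - x0) \<bullet> b) * (1 * ?d b (?\<gamma> x t))) has_integral (u (?\<gamma> x 1) - u (?\<gamma> x 0))) {0..1}"
  proof (rule fundamental_theorem_of_calculus)
    fix t :: real assume t: "t \<in> {0..1}"
    have g: "?\<gamma> x t \<in> ball x0 r" using x t segment_in_ball[of x x0 r t] by simp
    note D = smooth_on_has_derivative[OF assms(1) g]
    have lin: "linear (frechet_derivative u (at (?\<gamma> x t)))"
      using D has_derivative_linear by blast
    have "(?\<gamma> x has_vector_derivative (x - x0)) (at t)"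
      unfolding has_vector_derivative_def by (auto intro!: derivative_eq_intros)
    then have "((u \<circ> ?\<gamma> x) has_vector_derivative ?d (x - x0) (?\<gamma> x t)) (at t)"
      using diff_chain_at[of "?\<gamma> x" "\<lambda>s. s *\<^sub>R (x - x0)" t, OF _ D] unfolding has_vector_derivative_def
      by (simp add: linear_cmul[OF lin] o_def)
    moreover have "?d (x - x0) (?\<gamma> x t) = ?d (\<Sum>b\<in>Basis. ((x - x0) \<bullet> b) *\<^sub>R b) (?\<gamma> x t)"
      by (simp only: euclidean_representation)
    moreover have "... = (\<Sum>b\<in>Basis. ((x - x0) \<bullet> b) * (1 * ?d b (?\<gamma> x t)))"
      by (simp only: linear_sum[OF lin] linear_cmul[OF lin] real_scaleR_def mult_1)
    ultimately show "((\<lambda>t. u (?\<gamma> x t)) has_vector_derivative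
        (\<Sum>b\<in>Basis. ((x - x0) \<bullet> b) * (1 * ?d b (?\<gamma> x t)))) (at t within {0..1})"
      by (simp add: o_def has_vector_derivative_at_within)
  qed simp
  then have "u x - u x0 = integral (cbox 0 1) (\<lambda>t. \<Sum>b\<in>Basis. ((x - x0) \<bullet> b) * (1 * ?d b (?\<gamma> x t)))"
    by (simp add: integral_unique)
  also have "... = (\<Sum>b\<in>Basis. integral (cbox 0 1) (\<lambda>t. ((x - x0) \<bullet> b) * (1 * ?d b (?\<gamma> x t))))"
    using int by (intro integral_sum integrable_on_mult_right) auto
  also have "... = (\<Sum>b\<in>Basis. ((x - x0) \<bullet> b) * ?G b x)"
    by (simp only: integral_mult_right)
  finally show "u x = u x0 + (\<Sum>b\<in>Basis. ((x - x0) \<bullet> b) * ?G b x)" by simp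
qed

section \<open>Smooth functions on a manifold\<close>

lemma smooth_functions_iff:
  "a \<in> smooth_functions M \<longleftrightarrow>
    continuous_on UNIV a \<and> (\<forall>(U, \<kappa>)\<in>M. smooth_on (\<kappa> ` U) (\<lambda>y. a (inv_into U \<kappa> y)))"
  by (simp add: smooth_functions_def smooth_map_on_def euclidean_atlas_def o_def)

locale manifold =
  fixes M :: "('m::{t2_space, second_countable_topology}, 'e::euclidean_space) chart set"
  assumes mfd: "smooth_manifold M"
begin

abbreviation CM where "CM \<equiv> smooth_functions M"
abbreviation XM where "XM \<equiv> smooth_fields M"
abbreviation TM where "TM \<equiv> tangent_space M"

lemma chart_at: obtains U \<kappa> where "(U, \<kappa>) \<in> M" "p \<in> U"
proof -
  have "p \<in> (\<Union>(U, \<kappa>)\<in>M. U)" using mfd unfolding smooth_manifold_def by auto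
  then show ?thesis using that by auto
qed

lemma chart:
  assumes "(U, \<kappa>) \<in> M"
  shows "open U" "open (\<kappa> ` U)" "continuous_on U \<kappa>" "continuous_on (\<kappa> ` U) (inv_into U \<kappa>)"
    "\<And>q. q \<in> U \<Longrightarrow> inv_into U \<kappa> (\<kappa> q) = q"
    "\<And>y. y \<in> \<kappa> ` U \<Longrightarrow> \<kappa> (inv_into U \<kappa> y) = y \<and> inv_into U \<kappa> y \<in> U"
proof -
  have "is_chart (U, \<kappa>)" using mfd assms unfolding smooth_manifold_def by blast
  then have c: "open U" "open (\<kappa> ` U)" "homeomorphism U (\<kappa> ` U) \<kappa> (inv_into U \<kappa>)"
    by (auto simp: is_chart_def)
  then show "open U" "open (\<kappa> ` U)" "continuous_on U \<kappa>" "continuous_on (\<kappa> ` U) (inv_into U \<kappa>)"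
    "\<And>q. q \<in> U \<Longrightarrow> inv_into U \<kappa> (\<kappa> q) = q"
    "\<And>y. y \<in> \<kappa> ` U \<Longrightarrow> \<kappa> (inv_into U \<kappa> y) = y \<and> inv_into U \<kappa> y \<in> U"
    by (auto simp: homeomorphism_def)
qed

lemma transition:
  assumes "(U, \<kappa>) \<in> M" "(V, \<psi>) \<in> M"
  shows "smooth_on (\<kappa> ` (U \<inter> V)) (\<lambda>y. \<psi> (inv_into U \<kappa> y))"
  using mfd assms unfolding smooth_manifold_def by (fastforce simp: o_def)

lemma open_chart_image:
  assumes "(U, \<kappa>) \<in> M" "open W" "W \<subseteq> U"
  shows "open (\<kappa> ` W)"
proof -
  note c = chart[OF assms(1)]
  have "\<kappa> ` W = \<kappa> ` U \<inter> inv_into U \<kappa> -` W"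
    using c(5,6) assms(3) by (auto simp: image_iff)
  then show ?thesis using continuous_open_preimage[OF c(4,2) assms(2)] by simp
qed

lemma open_chart_preimage:
  assumes "(U, \<kappa>) \<in> M" "open O'" "O' \<subseteq> \<kappa> ` U"
  shows "open (inv_into U \<kappa> ` O')" "inv_into U \<kappa> ` O' \<subseteq> U" "\<kappa> ` inv_into U \<kappa> ` O' = O'"
proof -
  note c = chart[OF assms(1)]
  have "inv_into U \<kappa> ` O' = U \<inter> \<kappa> -` O'"
    using c(5,6) assms(3) by (auto simp: image_iff subset_iff) (metis)+
  then show "open (inv_into U \<kappa> ` O')" using continuous_open_preimage[OF c(3,1) assms(2)] by simp
  show "inv_into U \<kappa> ` O' \<subseteq> U" using c(6) assms(3) by auto
  have "\<kappa> (inv_into U \<kappa> y) = y" if "y \<in> O'" for y using c(6) that assms(3) by blast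
  then show "\<kappa> ` inv_into U \<kappa> ` O' = O'" by (auto simp: image_image)
qed

lemma smooth_in_other_chart:
  assumes "(U, \<kappa>) \<in> M" "(V, \<psi>) \<in> M" "open W" "W \<subseteq> U"
    and "smooth_on (\<kappa> ` W) (\<lambda>y. a (inv_into U \<kappa> y))"
  shows "smooth_on (\<psi> ` (V \<inter> W)) (\<lambda>y. (a :: 'm \<Rightarrow> real) (inv_into V \<psi> y))"
proof -
  have o: "open (\<psi> ` (V \<inter> W))" using open_chart_image[OF assms(2)] chart(1)[OF assms(2)] assms(3) by auto
  have t: "smooth_on (\<psi> ` (V \<inter> W)) (\<lambda>y. \<kappa> (inv_into V \<psi> y))"
    using transition[OF assms(2,1)] by (rule smooth_on_subset) (use assms(4) in auto)
  have im: "(\<lambda>y. \<kappa> (inv_into V \<psi> y)) ` (\<psi> ` (V \<inter> W)) \<subseteq> \<kappa> ` W"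
    using chart(5)[OF assms(2)] by auto
  have "smooth_on (\<psi> ` (V \<inter> W)) (\<lambda>y. a (inv_into U \<kappa> (\<kappa> (inv_into V \<psi> y))))"
    by (rule smooth_on_compose[OF o t assms(5) im])
  then show ?thesis
    by (rule smooth_on_cong[OF o, rotated]) (use chart(5)[OF assms(2)] chart(5)[OF assms(1)] assms(4) in auto)
qed

text \<open>Smoothness is demanded in every chart of the atlas. One chart around each point
  suffices, because transition maps are smooth.\<close>

lemma smooth_functionsI_charts:
  fixes a :: "'m \<Rightarrow> real"
  assumes "\<And>p. \<exists>U \<kappa> W. (U, \<kappa>) \<in> M \<and> open W \<and> p \<in> W \<and> W \<subseteq> U \<and>
    smooth_on (\<kappa> ` W) (\<lambda>y. a (inv_into U \<kappa> y))"
  shows "a \<in> CM"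
  unfolding smooth_functions_iff
proof
  show "continuous_on UNIV a"
  proof (rule continuous_at_imp_continuous_on, rule ballI)
    fix p
    obtain U \<kappa> W where W: "(U, \<kappa>) \<in> M" "open W" "p \<in> W" "W \<subseteq> U"
      "smooth_on (\<kappa> ` W) (\<lambda>y. a (inv_into U \<kappa> y))" using assms by blast
    have "continuous_on W (\<lambda>q. a (inv_into U \<kappa> (\<kappa> q)))"
      by (rule continuous_on_compose2[OF smooth_on_imp_continuous[OF W(5)]
            continuous_on_subset[OF chart(3)[OF W(1)] W(4)]]) auto
    then have "continuous_on W a"
      by (rule continuous_on_eq) (use chart(5)[OF W(1)] W(4) in auto)
    then show "isCont a p" using W(2,3) continuous_on_eq_continuous_at by blast
  qed
  show "\<forall>(V, \<psi>)\<in>M. smooth_on (\<psi> ` V) (\<lambda>y. a (inv_into V \<psi> y))"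
  proof (clarify, rule smooth_on_local)
    fix V \<psi> y assume V: "(V, \<psi>) \<in> M" and "y \<in> \<psi> ` V"
    then obtain p where p: "p \<in> V" "y = \<psi> p" by blast
    obtain U \<kappa> W where W: "(U, \<kappa>) \<in> M" "open W" "p \<in> W" "W \<subseteq> U"
      "smooth_on (\<kappa> ` W) (\<lambda>y. a (inv_into U \<kappa> y))" using assms by blast
    have "open (\<psi> ` (V \<inter> W))" using open_chart_image[OF V] chart(1)[OF V] W(2) by auto
    moreover have "y \<in> \<psi> ` (V \<inter> W)" using p W(3) by blast
    ultimately show "\<exists>T. open T \<and> y \<in> T \<and> smooth_on T (\<lambda>y. a (inv_into V \<psi> y))"
      using smooth_in_other_chart[OF W(1) V W(2,4,5)] by blast
  qed
qed

lemma smooth_in_chart: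
  "a \<in> CM \<Longrightarrow> (U, \<kappa>) \<in> M \<Longrightarrow> smooth_on (\<kappa> ` U) (\<lambda>y. a (inv_into U \<kappa> y))"
  by (auto simp: smooth_functions_iff)

lemma smooth_functions_local:
  assumes "\<And>p. \<exists>W b. open W \<and> p \<in> W \<and> b \<in> CM \<and> (\<forall>q\<in>W. a q = b q)"
  shows "a \<in> CM"
proof (rule smooth_functionsI_charts)
  fix p
  obtain W b where W: "open W" "p \<in> W" "b \<in> CM" "\<And>q. q \<in> W \<Longrightarrow> a q = b q"
    using assms[of p] by auto
  obtain U \<kappa> where U: "(U, \<kappa>) \<in> M" "p \<in> U" using chart_at .
  have o: "open (U \<inter> W)" "open (\<kappa> ` (U \<inter> W))" using chart(1)[OF U(1)] W(1) open_chart_image[OF U(1)] by auto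
  have "smooth_on (\<kappa> ` (U \<inter> W)) (\<lambda>y. b (inv_into U \<kappa> y))"
    by (rule smooth_on_subset[OF smooth_in_chart[OF W(3) U(1)]]) auto
  then have "smooth_on (\<kappa> ` (U \<inter> W)) (\<lambda>y. a (inv_into U \<kappa> y))"
    by (rule smooth_on_cong[OF o(2), rotated]) (use W(4) chart(5)[OF U(1)] in auto)
  then show "\<exists>U \<kappa> W. (U, \<kappa>) \<in> M \<and> open W \<and> p \<in> W \<and> W \<subseteq> U \<and>
    smooth_on (\<kappa> ` W) (\<lambda>y. a (inv_into U \<kappa> y))" using U W o by blast
qed

section \<open>The algebra of smooth functions\<close>

lemma smooth_functions_const [simp]: "(\<lambda>_. c) \<in> CM"
  by (simp add: smooth_functions_iff)

lemma smooth_functions_add: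
  "a \<in> CM \<Longrightarrow> b \<in> CM \<Longrightarrow> (\<lambda>q. a q + b q) \<in> CM"
  unfolding smooth_functions_iff using chart(2) by (auto intro!: continuous_on_add smooth_on_add)

lemma smooth_functions_mult:
  "a \<in> CM \<Longrightarrow> b \<in> CM \<Longrightarrow> (\<lambda>q. a q * b q) \<in> CM"
  unfolding smooth_functions_iff using chart(2) by (auto intro!: continuous_on_mult smooth_on_mult)

lemma smooth_functions_inverse:
  "a \<in> CM \<Longrightarrow> (\<And>q. a q \<noteq> 0) \<Longrightarrow> (\<lambda>q. inverse (a q)) \<in> CM"
  unfolding smooth_functions_iff using chart(2) by (auto intro!: continuous_on_inverse smooth_on_inverse)

lemma smooth_functions_cmult: "a \<in> CM \<Longrightarrow> (\<lambda>q. c * a q) \<in> CM"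
  by (rule smooth_functions_mult) simp

lemma smooth_functions_minus: "a \<in> CM \<Longrightarrow> (\<lambda>q. - a q) \<in> CM"
  using smooth_functions_cmult[of a "-1"] by simp

lemma smooth_functions_diff:
  "a \<in> CM \<Longrightarrow> b \<in> CM \<Longrightarrow> (\<lambda>q. a q - b q) \<in> CM"
  using smooth_functions_add[OF _ smooth_functions_minus, of a b] by simp

lemma smooth_functions_sum:
  "(\<And>i. i \<in> A \<Longrightarrow> a i \<in> CM) \<Longrightarrow> (\<lambda>q. \<Sum>i\<in>A. a i q) \<in> CM"
  by (induction A rule: infinite_finite_induct) (auto intro: smooth_functions_add)

text \<open>The preimage of the closed ball is compact, hence closed because the manifold is
  Hausdorff. Its complement is thus an open set on which the extension is 0, and together with the
  part of the chart over \<open>O'\<close> it covers the manifold.\<close>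

lemma smooth_functions_extend:
  assumes U: "(U, \<kappa>) \<in> M" and O: "open O'" "cball x0 s \<subseteq> O'" "O' \<subseteq> \<kappa> ` U" "smooth_on O' u"
    and \<rho>: "smooth_on UNIV \<rho>" "\<And>x. x \<notin> ball x0 s \<Longrightarrow> \<rho> x = 0"
  shows "(\<lambda>q. if q \<in> U then \<rho> (\<kappa> q) * u (\<kappa> q) else 0) \<in> CM" (is "?a \<in> _")
proof (rule smooth_functionsI_charts)
  fix p
  note c = chart[OF U]
  show "\<exists>U \<kappa> W. (U, \<kappa>) \<in> M \<and> open W \<and> p \<in> W \<and> W \<subseteq> U \<and> smooth_on (\<kappa> ` W) (\<lambda>y. ?a (inv_into U \<kappa> y))"
  proof (cases "p \<in> U \<and> \<kappa> p \<in> O'")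
    case True
    let ?W = "inv_into U \<kappa> ` O'"
    note W = open_chart_preimage[OF U O(1,3)]
    have "p \<in> ?W" using True c(5) by (metis imageI)
    moreover have "smooth_on O' (\<lambda>y. \<rho> y * u y)"
      by (rule smooth_on_mult[OF O(1) smooth_on_subset[OF \<rho>(1)] O(4)]) simp
    then have "smooth_on O' (\<lambda>y. ?a (inv_into U \<kappa> y))"
      by (rule smooth_on_cong[OF O(1), rotated]) (use c(6) O(3) in auto)
    ultimately show ?thesis using U W by (intro exI[of _ U] exI[of _ \<kappa>] exI[of _ ?W]) (simp only: simp_thms)
  next
    case False
    let ?C = "inv_into U \<kappa> ` cball x0 s"
    have sub: "cball x0 s \<subseteq> \<kappa> ` U" using O by blast
    have "compact ?C"
      by (rule compact_continuous_image[OF continuous_on_subset[OF c(4) sub] compact_cball])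
    then have o: "open (- ?C)" using compact_imp_closed open_Compl by blast
    have pC: "p \<notin> ?C"
      using False O(2,3) c(6) by (metis (no_types, lifting) imageE subsetD)
    obtain V \<psi> where V: "(V, \<psi>) \<in> M" "p \<in> V" using chart_at .
    have z: "?a q = 0" if "q \<in> V \<inter> - ?C" for q
    proof (cases "q \<in> U")
      case True
      then have "\<kappa> q \<notin> cball x0 s" using that c(5) by (metis ComplD IntD2 imageI)
      then show ?thesis using \<rho>(2)[of "\<kappa> q"] by simp
    qed simp
    have oV: "open (\<psi> ` (V \<inter> - ?C))"
      using open_chart_image[OF V(1)] chart(1)[OF V(1)] o by auto
    have "smooth_on (\<psi> ` (V \<inter> - ?C)) (\<lambda>y. ?a (inv_into V \<psi> y))"
    proof (rule smooth_on_cong[OF oV _ smooth_on_const[of _ 0]])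
      fix y assume "y \<in> \<psi> ` (V \<inter> - ?C)"
      then have "inv_into V \<psi> y \<in> V \<inter> - ?C" using chart(5)[OF V(1)] by auto
      from z[OF this] show "0 = ?a (inv_into V \<psi> y)" by simp
    qed
    then show ?thesis
      using chart(1)[OF V(1)] o V pC by (intro exI[of _ V] exI[of _ \<psi>] exI[of _ "V \<inter> - ?C"]) auto
  qed
qed

lemma chart_ball:
  assumes "(U, \<kappa>) \<in> M" "open W" "p \<in> W" "p \<in> U"
  obtains r where "0 < r" "cball (\<kappa> p) (2 * r) \<subseteq> \<kappa> ` (U \<inter> W)"
proof -
  have "open (\<kappa> ` (U \<inter> W))" "\<kappa> p \<in> \<kappa> ` (U \<inter> W)"
    using open_chart_image[OF assms(1)] chart(1)[OF assms(1)] assms by auto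
  then obtain e where "e > 0" "cball (\<kappa> p) e \<subseteq> \<kappa> ` (U \<inter> W)" using open_contains_cball by metis
  then show ?thesis using that[of "e / 2"] by simp
qed

lemma smooth_bump:
  assumes "open W" "p \<in> W"
  obtains \<rho> V where "\<rho> \<in> CM" "open V" "p \<in> V" "V \<subseteq> W" "\<And>q. q \<in> V \<Longrightarrow> \<rho> q = 1"
    "\<And>q. q \<notin> W \<Longrightarrow> \<rho> q = 0" "\<And>q. 0 \<le> \<rho> q" "\<And>q. \<rho> q \<le> 1"
proof -
  obtain U \<kappa> where U: "(U, \<kappa>) \<in> M" "p \<in> U" using chart_at .
  note c = chart[OF U(1)]
  obtain r where r: "0 < r" "cball (\<kappa> p) (2 * r) \<subseteq> \<kappa> ` (U \<inter> W)" using chart_ball[OF U(1) assms U(2)] .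
  obtain \<rho> :: "'e \<Rightarrow> real" where \<rho>: "smooth_on UNIV \<rho>" "\<And>x. x \<in> ball (\<kappa> p) r \<Longrightarrow> \<rho> x = 1"
    "\<And>x. x \<notin> ball (\<kappa> p) (2 * r) \<Longrightarrow> \<rho> x = 0" "\<And>x. 0 \<le> \<rho> x" "\<And>x. \<rho> x \<le> 1"
    using smooth_bump_euclidean[OF r(1)] by blast
  let ?a = "\<lambda>q. if q \<in> U then \<rho> (\<kappa> q) * 1 else 0" and ?V = "inv_into U \<kappa> ` ball (\<kappa> p) r"
  have b: "ball (\<kappa> p) r \<subseteq> \<kappa> ` (U \<inter> W)"
    by (rule subset_trans[OF _ r(2)]) (use r(1) in auto)
  then have b': "ball (\<kappa> p) r \<subseteq> \<kappa> ` U" by blast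
  note V = open_chart_preimage[OF U(1) open_ball b']
  have sub: "cball (\<kappa> p) (2 * r) \<subseteq> \<kappa> ` U" using r(2) by blast
  have f1: "?a \<in> CM"
    by (rule smooth_functions_extend[OF U(1) c(2) sub subset_refl smooth_on_const \<rho>(1,3)])
  have f2: "p \<in> ?V" using c(5)[OF U(2)] r(1) by (metis centre_in_ball imageI)
  have f3: "?V \<subseteq> W" using b c(5) by auto
  have f4: "?a q = 1" if "q \<in> ?V" for q
  proof -
    have "q \<in> U" "\<kappa> q \<in> ball (\<kappa> p) r" using that V(2,3) by blast+
    then show ?thesis using \<rho>(2) by simp
  qed
  have f5: "?a q = 0" if "q \<notin> W" for q
  proof (cases "q \<in> U")
    case True
    have "\<kappa> q \<notin> ball (\<kappa> p) (2 * r)"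
    proof
      assume "\<kappa> q \<in> ball (\<kappa> p) (2 * r)"
      then have "\<kappa> q \<in> \<kappa> ` (U \<inter> W)" using r(2) ball_subset_cball by blast
      then obtain q' where "q' \<in> U" "q' \<in> W" "\<kappa> q' = \<kappa> q" by auto
      then show False using that c(5) True by metis
    qed
    then show ?thesis using \<rho>(3) by simp
  qed simp
  have "0 \<le> ?a q" "?a q \<le> 1" for q using \<rho>(4,5) by auto
  from that[OF f1 V(1) f2 f3 f4 f5 this] show ?thesis .
qed

text \<open>Smooth functions live on the whole manifold, so 1/a, available only near p, must be
  replaced by a global function that agrees with it there.\<close>

lemma smooth_local_inverse:
  assumes "a \<in> CM" "a p \<noteq> 0"
  obtains b V where "b \<in> CM" "open V" "p \<in> V" "\<And>q. q \<in> V \<Longrightarrow> a q \<noteq> 0 \<and> b q = inverse (a q)"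
proof -
  let ?c = "\<lambda>q. a p * a q"
  have c: "?c \<in> CM" using smooth_functions_cmult[OF assms(1)] .
  have o: "open {q. 0 < ?c q}"
    by (rule open_Collect_less) (use c in \<open>auto simp: smooth_functions_iff\<close>)
  have p: "p \<in> {q. 0 < ?c q}" using assms(2) by (auto simp: zero_less_mult_iff)
  obtain \<rho> V where \<rho>: "\<rho> \<in> CM" "open V" "p \<in> V" "V \<subseteq> {q. 0 < ?c q}"
    "\<And>q. q \<in> V \<Longrightarrow> \<rho> q = 1" "\<And>q. q \<notin> {q. 0 < ?c q} \<Longrightarrow> \<rho> q = 0" "\<And>q. 0 \<le> \<rho> q" "\<And>q. \<rho> q \<le> 1"
    by (rule smooth_bump[OF o p]) (rule that)
  \<comment> \<open>A convex combination of \<open>?c\<close> and 1, positive everywhere because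
    \<open>\<rho>\<close> vanishes where \<open>?c\<close> is not positive. The factor
    \<open>a p\<close> normalises the sign at p and cancels in the final reciprocal.\<close>
  let ?d = "\<lambda>q. \<rho> q * ?c q + (1 - \<rho> q)"
  have "0 < ?d q" for q
  proof (cases "\<rho> q = 0")
    case False
    then have "0 < \<rho> q * ?c q" using \<rho>(6)[of q] \<rho>(7)[of q] by (metis less_eq_real_def mem_Collect_eq mult_pos_pos)
    then show ?thesis using \<rho>(8)[of q] by linarith
  qed simp
  then have "(\<lambda>q. a p * inverse (?d q)) \<in> CM"
    using \<rho>(1) c
    by (intro smooth_functions_cmult smooth_functions_inverse smooth_functions_add smooth_functions_diff
        smooth_functions_mult[OF \<rho>(1) c] smooth_functions_const) (simp_all add: less_imp_neq[symmetric])
  moreover have "a q \<noteq> 0 \<and> a p * inverse (?d q) = inverse (a q)" if "q \<in> V" for q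
    using \<rho>(4,5) that assms(2) by (auto simp: field_simps)
  ultimately show ?thesis using that \<rho>(2,3) by blast
qed

end

section \<open>Tangent vectors\<close>

lemma scaleR_fun_apply [simp]: "(c *\<^sub>R (F :: 'a \<Rightarrow> 'b::real_vector)) x = c *\<^sub>R F x"
  by (simp add: scaleR_fun_def)

lemma sum_fun_apply: "(\<Sum>i\<in>A. (F i :: 'a \<Rightarrow> 'b::comm_monoid_add)) x = (\<Sum>i\<in>A. F i x)"
  by (induction A rule: infinite_finite_induct) auto

context manifold
begin

lemma tangent_add:
  "v \<in> TM p \<Longrightarrow> a \<in> CM \<Longrightarrow> b \<in> CM \<Longrightarrow>
    v (\<lambda>q. a q + b q) = v a + v b"
  unfolding tangent_space_def plus_fun_def by blast

lemma tangent_mult: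
  "v \<in> TM p \<Longrightarrow> a \<in> CM \<Longrightarrow> b \<in> CM \<Longrightarrow>
    v (\<lambda>q. a q * b q) = v a * b p + a p * v b"
  unfolding tangent_space_def times_fun_def by blast

lemma tangent_cmult:
  "v \<in> TM p \<Longrightarrow> a \<in> CM \<Longrightarrow> v (\<lambda>q. c * a q) = c * v a"
  unfolding tangent_space_def scaleR_fun_def real_scaleR_def by blast

lemma tangent_junk: "v \<in> TM p \<Longrightarrow> a \<notin> CM \<Longrightarrow> v a = 0"
  unfolding tangent_space_def by blast

lemma tangent_const: "v \<in> TM p \<Longrightarrow> v (\<lambda>_. c) = 0"
proof -
  assume v: "v \<in> TM p"
  have "v (\<lambda>_. 1) = v (\<lambda>_. 1) * 1 + 1 * v (\<lambda>_. 1)"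
    using tangent_mult[OF v, of "\<lambda>_. 1" "\<lambda>_. 1"] by simp
  then have "v (\<lambda>_. 1) = 0" by simp
  then show "v (\<lambda>_. c) = 0" using tangent_cmult[OF v, of "\<lambda>_. 1" c] by simp
qed

lemma tangent_diff:
  "v \<in> TM p \<Longrightarrow> a \<in> CM \<Longrightarrow> b \<in> CM \<Longrightarrow>
    v (\<lambda>q. a q - b q) = v a - v b"
  using tangent_add[of v p a "\<lambda>q. -1 * b q"] tangent_cmult[of v p b "-1"] smooth_functions_minus by simp

lemma tangent_sum:
  assumes "v \<in> TM p" "\<And>i. i \<in> A \<Longrightarrow> a i \<in> CM"
  shows "v (\<lambda>q. \<Sum>i\<in>A. a i q) = (\<Sum>i\<in>A. v (a i))"
  using assms(2)
  by (induction A rule: infinite_finite_induct)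
    (simp_all add: tangent_const[OF assms(1)] tangent_add[OF assms(1)] smooth_functions_sum)

lemma tangentI:
  assumes "\<And>a b. a \<in> CM \<Longrightarrow> b \<in> CM \<Longrightarrow> v (\<lambda>q. a q + b q) = v a + v b"
    and "\<And>a b. a \<in> CM \<Longrightarrow> b \<in> CM \<Longrightarrow>
      v (\<lambda>q. a q * b q) = v a * b p + a p * v b"
    and "\<And>a c. a \<in> CM \<Longrightarrow> v (\<lambda>q. c * a q) = c * v a"
    and "\<And>a. a \<notin> CM \<Longrightarrow> v a = 0"
  shows "v \<in> TM p"
  using assms unfolding tangent_space_def plus_fun_def times_fun_def scaleR_fun_def real_scaleR_def
  by simp

text \<open>Multiplying a - b by a bump supported in W gives the zero function. The Leibniz rule
  then yields v a - v b = 0, since the bump is 1 and a - b is 0 at p.\<close>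

lemma tangent_local:
  assumes v: "v \<in> TM p" and a: "a \<in> CM" "b \<in> CM"
    and W: "open W" "p \<in> W" "\<And>q. q \<in> W \<Longrightarrow> a q = b q"
  shows "v a = v b"
proof -
  obtain \<rho> V where \<rho>: "\<rho> \<in> CM" "open V" "p \<in> V" "V \<subseteq> W" "\<And>q. q \<in> V \<Longrightarrow> \<rho> q = 1"
    "\<And>q. q \<notin> W \<Longrightarrow> \<rho> q = 0" "\<And>q. 0 \<le> \<rho> q" "\<And>q. \<rho> q \<le> 1"
    by (rule smooth_bump[OF W(1,2)]) (rule that)
  have d: "(\<lambda>q. a q - b q) \<in> CM" using a by (rule smooth_functions_diff)
  have "(\<lambda>q. \<rho> q * (a q - b q)) = (\<lambda>_. 0)" using \<rho>(6) W(3) by fastforce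
  then have "v (\<lambda>q. \<rho> q * (a q - b q)) = 0" using tangent_const[OF v] by simp
  then show ?thesis
    unfolding tangent_mult[OF v \<rho>(1) d] tangent_diff[OF v a] using \<rho>(3,5) W(2,3) by simp
qed

lemma tangent_subspace: "subspace (TM p)"
  unfolding subspace_def
proof (intro conjI ballI allI)
  show "0 \<in> TM p" by (rule tangentI) auto
next
  fix v w assume v: "v \<in> TM p" and w: "w \<in> TM p"
  show "v + w \<in> TM p"
    by (rule tangentI) (simp_all add: tangent_add[OF v] tangent_add[OF w] tangent_mult[OF v]
        tangent_mult[OF w] tangent_const[OF v] tangent_const[OF w] tangent_cmult[OF v] tangent_cmult[OF w] tangent_junk[OF v] tangent_junk[OF w]
        algebra_simps)
next
  fix c :: real and v assume v: "v \<in> TM p"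
  show "c *\<^sub>R v \<in> TM p"
    by (rule tangentI) (simp_all add: tangent_add[OF v] tangent_mult[OF v] tangent_const[OF v]
        tangent_cmult[OF v] tangent_junk[OF v] algebra_simps)
qed

lemmas tangent_closed = subspace_0[OF tangent_subspace] subspace_add[OF tangent_subspace]
  subspace_scale[OF tangent_subspace] subspace_diff[OF tangent_subspace] subspace_neg[OF tangent_subspace]
  subspace_sum[OF tangent_subspace]

subsection \<open>Smooth vector fields\<close>

lemma smooth_fieldsD:
  "E \<in> XM \<Longrightarrow> E p \<in> TM p"
  "E \<in> XM \<Longrightarrow> a \<in> CM \<Longrightarrow> (\<lambda>p. E p a) \<in> CM"
  by (auto simp: smooth_fields_def)

lemma smooth_fields_zero [simp]: "0 \<in> XM"
  by (auto simp: smooth_fields_def tangent_closed(1))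

lemma smooth_fields_add:
  "E \<in> XM \<Longrightarrow> F \<in> XM \<Longrightarrow> E + F \<in> XM"
  by (auto simp: smooth_fields_def intro: tangent_closed(2) smooth_functions_add)

lemma smooth_fields_fscale:
  "a \<in> CM \<Longrightarrow> E \<in> XM \<Longrightarrow> fscale a E \<in> XM"
  by (auto simp: smooth_fields_def fscale_def intro: tangent_closed(3) smooth_functions_mult)

lemma smooth_fields_scaleR: "E \<in> XM \<Longrightarrow> c *\<^sub>R E \<in> XM"
  by (auto simp: smooth_fields_def intro: tangent_closed(3) smooth_functions_cmult)

lemma smooth_fields_uminus: "E \<in> XM \<Longrightarrow> - E \<in> XM"
  using smooth_fields_scaleR[of E "-1"] by simp

lemma smooth_fields_diff:
  "E \<in> XM \<Longrightarrow> F \<in> XM \<Longrightarrow> E - F \<in> XM"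
  using smooth_fields_add[OF _ smooth_fields_uminus, of E F] by simp

lemma smooth_fields_sum:
  "(\<And>i. i \<in> A \<Longrightarrow> E i \<in> XM) \<Longrightarrow> (\<Sum>i\<in>A. E i) \<in> XM"
  by (induction A rule: infinite_finite_induct) (auto intro: smooth_fields_add)

lemma smooth_fields_local:
  assumes "\<And>p. \<exists>W F. open W \<and> p \<in> W \<and> F \<in> XM \<and> (\<forall>q\<in>W. E q = F q)"
  shows "E \<in> XM"
  unfolding smooth_fields_def
proof (intro CollectI conjI allI ballI)
  fix p
  obtain W F where "p \<in> W" "F \<in> XM" "\<forall>q\<in>W. E q = F q" using assms[of p] by auto
  then show "E p \<in> TM p" using smooth_fieldsD(1) by metis
next
  fix a assume a: "a \<in> CM"
  show "(\<lambda>p. E p a) \<in> CM"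
  proof (rule smooth_functions_local)
    fix p
    obtain W F where W: "open W" "p \<in> W" "F \<in> XM" "\<forall>q\<in>W. E q = F q" using assms[of p] by auto
    show "\<exists>W b. open W \<and> p \<in> W \<and> b \<in> CM \<and> (\<forall>q\<in>W. E q a = b q)"
      using W smooth_fieldsD(2)[OF W(3) a] by (intro exI[of _ W] exI[of _ "\<lambda>q. F q a"]) simp
  qed
qed

subsection \<open>Coordinate frames\<close>

text \<open>The coordinate field in direction b. The zero branch follows the convention of
  \<open>tangent_space\<close>, by which derivations vanish on functions that are not
  smooth.\<close>

definition coord_vector :: "('m, 'e) chart \<Rightarrow> 'e \<Rightarrow> 'm vfield" where
  "coord_vector c b q = (\<lambda>a. if a \<in> CM
     then frechet_derivative (\<lambda>y. a (inv_into (fst c) (snd c) y)) (at (snd c q)) b else 0)"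

lemma coord_vector_tangent:
  assumes U: "(U, \<kappa>) \<in> M" "q \<in> U"
  shows "coord_vector (U, \<kappa>) b q \<in> TM q"
proof -
  have y: "\<kappa> q \<in> \<kappa> ` U" using U(2) by blast
  have D: "((\<lambda>y. a (inv_into U \<kappa> y)) has_derivative
      frechet_derivative (\<lambda>y. a (inv_into U \<kappa> y)) (at (\<kappa> q))) (at (\<kappa> q))"
    if "a \<in> CM" for a
    using smooth_on_has_derivative[OF smooth_in_chart[OF that U(1)] y] .
  have q: "inv_into U \<kappa> (\<kappa> q) = q" using chart(5)[OF U] .
  show ?thesis
  proof (rule tangentI)
    fix a c assume a: "a \<in> CM" "c \<in> CM"
    show "coord_vector (U, \<kappa>) b q (\<lambda>q. a q + c q) =
        coord_vector (U, \<kappa>) b q a + coord_vector (U, \<kappa>) b q c"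
      using frechet_derivative_at[OF has_derivative_add[OF D[OF a(1)] D[OF a(2)]], symmetric]
      by (simp add: coord_vector_def a smooth_functions_add)
    show "coord_vector (U, \<kappa>) b q (\<lambda>q. a q * c q) =
        coord_vector (U, \<kappa>) b q a * c q + a q * coord_vector (U, \<kappa>) b q c"
      using frechet_derivative_at[OF has_derivative_mult[OF D[OF a(1)] D[OF a(2)]], symmetric]
      by (simp add: coord_vector_def a smooth_functions_mult q)
  next
    fix a and c :: real assume a: "a \<in> CM"
    show "coord_vector (U, \<kappa>) b q (\<lambda>q. c * a q) = c * coord_vector (U, \<kappa>) b q a"
      using frechet_derivative_at[OF has_derivative_mult_right[OF D[OF a], of c], symmetric]
      by (simp add: coord_vector_def a smooth_functions_cmult)
  next
    fix a assume "a \<notin> CM"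
    then show "coord_vector (U, \<kappa>) b q a = 0" by (simp add: coord_vector_def)
  qed
qed

text \<open>Hadamard's lemma: modulo products of two functions vanishing at \<open>q\<close>, every smooth function
  is affine in the coordinates.\<close>

lemma tangent_coord_expansion:
  assumes U: "(U, \<kappa>) \<in> M" and v: "v \<in> TM q"
    and x: "\<And>b. (\<lambda>q. x q \<bullet> b) \<in> CM"
    and W: "open W" "q \<in> W" "W \<subseteq> U" "\<And>q. q \<in> W \<Longrightarrow> x q = \<kappa> q"
  shows "v = (\<Sum>b\<in>Basis. v (\<lambda>q. x q \<bullet> b) *\<^sub>R coord_vector (U, \<kappa>) b q)"
proof
  fix a
  have qU: "q \<in> U" using W by blast
  note c = chart[OF U]
  show "v a = (\<Sum>b\<in>Basis. v (\<lambda>q. x q \<bullet> b) *\<^sub>R coord_vector (U, \<kappa>) b q) a"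
  proof (cases "a \<in> CM")
    case False
    then show ?thesis by (simp add: tangent_junk[OF v] sum_fun_apply coord_vector_def)
  next
    case True
    let ?u = "\<lambda>y. a (inv_into U \<kappa> y)"
    obtain r where r: "0 < r" "cball (\<kappa> q) (2 * r) \<subseteq> \<kappa> ` (U \<inter> W)" using chart_ball[OF U W(1,2) qU] .
    have r': "cball (\<kappa> q) (2 * r) \<subseteq> \<kappa> ` U" using r(2) by blast
    then have sub: "ball (\<kappa> q) (2 * r) \<subseteq> \<kappa> ` U" using ball_subset_cball by blast
    have sm: "smooth_on (ball (\<kappa> q) (2 * r)) ?u"
      by (rule smooth_on_subset[OF smooth_in_chart[OF True U] sub])
    have r2: "0 < 2 * r" using r(1) by simp
    obtain G where G: "\<And>b. smooth_on (ball (\<kappa> q) (2 * r)) (G b)"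
      "\<And>y. y \<in> ball (\<kappa> q) (2 * r) \<Longrightarrow> ?u y = ?u (\<kappa> q) + (\<Sum>b\<in>Basis. ((y - \<kappa> q) \<bullet> b) * G b y)"
      "\<And>b. G b (\<kappa> q) = frechet_derivative ?u (at (\<kappa> q)) b"
      by (rule hadamard[OF sm r2]) (rule that)
    \<comment> \<open>The Hadamard coefficients exist only on the open ball of radius 2r. The bump
      lives on the ball of radius 2s = r, whose closure lies inside, so their products extend by
      0.\<close>
    define s where "s = r / 2"
    have s: "0 < s" "2 * s = r" using r(1) by (auto simp: s_def)
    obtain \<rho> :: "'e \<Rightarrow> real" where \<rho>: "smooth_on UNIV \<rho>" "\<And>y. y \<in> ball (\<kappa> q) s \<Longrightarrow> \<rho> y = 1"
      "\<And>y. y \<notin> ball (\<kappa> q) (2 * s) \<Longrightarrow> \<rho> y = 0" "\<And>y. 0 \<le> \<rho> y" "\<And>y. \<rho> y \<le> 1"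
      by (rule smooth_bump_euclidean[OF s(1)]) (rule that)
    let ?G = "\<lambda>b p. if p \<in> U then \<rho> (\<kappa> p) * G b (\<kappa> p) else 0"
    have cb: "cball (\<kappa> q) (2 * s) \<subseteq> ball (\<kappa> q) (2 * r)" using s r(1) by auto
    have G': "?G b \<in> CM" for b
      by (rule smooth_functions_extend[OF U open_ball cb sub G(1) \<rho>(1,3)])
    have x': "(\<lambda>p. x p \<bullet> b - x q \<bullet> b) \<in> CM" for b
      by (rule smooth_functions_diff[OF x smooth_functions_const])
    \<comment> \<open>A globally smooth function that equals \<open>a\<close> near q, so that v may
      be applied to it term by term.\<close>
    let ?R = "\<lambda>p. a q + (\<Sum>b\<in>Basis. (x p \<bullet> b - x q \<bullet> b) * ?G b p)"
    have R: "?R \<in> CM"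
      by (intro smooth_functions_add smooth_functions_const smooth_functions_sum smooth_functions_mult[OF x' G'])
    have bs: "ball (\<kappa> q) s \<subseteq> \<kappa> ` U"
      by (rule subset_trans[OF _ sub]) (use s r(1) in auto)
    let ?V = "W \<inter> inv_into U \<kappa> ` ball (\<kappa> q) s"
    note V = open_chart_preimage[OF U open_ball bs]
    have oV: "open ?V" using W(1) V(1) by blast
    have qV: "q \<in> ?V" using W(2) c(5)[OF qU] s(1) by (metis IntI centre_in_ball imageI)
    have eq: "a p = ?R p" if "p \<in> ?V" for p
    proof -
      have p: "p \<in> U" "p \<in> W" "\<kappa> p \<in> ball (\<kappa> q) s" using that V(2,3) by blast+
      then have "\<kappa> p \<in> ball (\<kappa> q) (2 * r)" using s r(1) by auto
      from G(2)[OF this] show ?thesis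
        using p \<rho>(2)[OF p(3)] by (simp add: c(5)[OF p(1)] c(5)[OF qU] W(2,4) inner_diff_left)
    qed
    have Gq: "?G b q = coord_vector (U, \<kappa>) b q a" for b
      using \<rho>(2)[of "\<kappa> q"] s(1) G(3)[of b] qU True by (simp add: coord_vector_def)
    have "v a = v ?R" by (rule tangent_local[OF v True R oV qV eq])
    also have "... = v (\<lambda>p. a q) + v (\<lambda>p. \<Sum>b\<in>Basis. (x p \<bullet> b - x q \<bullet> b) * ?G b p)"
      by (rule tangent_add[OF v smooth_functions_const]) (rule smooth_functions_sum[OF smooth_functions_mult[OF x' G']])
    also have "... = v (\<lambda>p. \<Sum>b\<in>Basis. (x p \<bullet> b - x q \<bullet> b) * ?G b p)"
      by (simp only: tangent_const[OF v] add_0_left)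
    also have "... = (\<Sum>b\<in>Basis. v (\<lambda>p. (x p \<bullet> b - x q \<bullet> b) * ?G b p))"
      by (rule tangent_sum[OF v smooth_functions_mult[OF x' G']])
    also have "... = (\<Sum>b\<in>Basis. v (\<lambda>q. x q \<bullet> b) * coord_vector (U, \<kappa>) b q a)"
    proof (rule sum.cong[OF refl])
      fix b :: 'e
      show "v (\<lambda>p. (x p \<bullet> b - x q \<bullet> b) * ?G b p) = v (\<lambda>q. x q \<bullet> b) * coord_vector (U, \<kappa>) b q a"
        unfolding tangent_mult[OF v x' G'] tangent_diff[OF v x smooth_functions_const] tangent_const[OF v] Gq
        by simp
    qed
    also have "... = (\<Sum>b\<in>Basis. v (\<lambda>q. x q \<bullet> b) *\<^sub>R coord_vector (U, \<kappa>) b q) a"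
      by (simp add: sum_fun_apply)
    finally show ?thesis .
  qed
qed

text \<open>\<open>x\<close> is a coordinate map on \<open>W\<close> with inverse \<open>K\<close>, cut off outside \<open>W\<close> so that its components are
  smooth functions on all of \<open>M\<close>; likewise the fields \<open>E b\<close> are global and restrict to the coordinate
  fields on \<open>W\<close>.\<close>

definition coord_frame :: "'m set \<Rightarrow> ('m \<Rightarrow> 'e) \<Rightarrow> ('e \<Rightarrow> 'm) \<Rightarrow> ('e \<Rightarrow> 'm vfield) \<Rightarrow> bool" where
  "coord_frame W x K E \<longleftrightarrow> open W \<and> open (x ` W) \<and> continuous_on W x \<and>
    continuous_on (x ` W) K \<and> (\<forall>q. q \<in> W \<longrightarrow> K (x q) = q) \<and>
    (\<forall>b. (\<lambda>q. x q \<bullet> b) \<in> CM) \<and>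
    (\<forall>a. a \<in> CM \<longrightarrow> smooth_on (x ` W) (\<lambda>y. a (K y))) \<and>
    (\<forall>V \<psi>. (V, \<psi>) \<in> M \<longrightarrow> smooth_on (x ` (V \<inter> W)) (\<lambda>y. \<psi> (K y))) \<and>
    (\<forall>b. E b \<in> XM) \<and>
    (\<forall>q a b. q \<in> W \<longrightarrow> a \<in> CM \<longrightarrow>
      E b q a = frechet_derivative (\<lambda>y. a (K y)) (at (x q)) b) \<and>
    (\<forall>q b c. q \<in> W \<longrightarrow> E b q (\<lambda>q. x q \<bullet> c) = b \<bullet> c) \<and>
    (\<forall>q v. q \<in> W \<longrightarrow> v \<in> TM q \<longrightarrow> v = (\<Sum>b\<in>Basis. v (\<lambda>q. x q \<bullet> b) *\<^sub>R E b q))"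

lemma coord_frameD:
  assumes "coord_frame W x K E"
  shows "open W" "open (x ` W)" "continuous_on W x" "continuous_on (x ` W) K"
    "\<And>q. q \<in> W \<Longrightarrow> K (x q) = q"
    "\<And>b. (\<lambda>q. x q \<bullet> b) \<in> CM"
    "\<And>a. a \<in> CM \<Longrightarrow> smooth_on (x ` W) (\<lambda>y. a (K y))"
    "\<And>V \<psi>. (V, \<psi>) \<in> M \<Longrightarrow> smooth_on (x ` (V \<inter> W)) (\<lambda>y. \<psi> (K y))"
    "\<And>b. E b \<in> XM"
    "\<And>q a b. q \<in> W \<Longrightarrow> a \<in> CM \<Longrightarrow>
      E b q a = frechet_derivative (\<lambda>y. a (K y)) (at (x q)) b"
    "\<And>q b c. q \<in> W \<Longrightarrow> E b q (\<lambda>q. x q \<bullet> c) = b \<bullet> c"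
    "\<And>q v. q \<in> W \<Longrightarrow> v \<in> TM q \<Longrightarrow> v = (\<Sum>b\<in>Basis. v (\<lambda>q. x q \<bullet> b) *\<^sub>R E b q)"
  using assms unfolding coord_frame_def by blast+

lemma coord_frame_exists: obtains W x K E where "p \<in> W" "coord_frame W x K E"
proof -
  obtain U \<kappa> where U: "(U, \<kappa>) \<in> M" "p \<in> U" using chart_at .
  note c = chart[OF U(1)]
  obtain r where r: "0 < r" "cball (\<kappa> p) (2 * r) \<subseteq> \<kappa> ` (U \<inter> UNIV)"
    using chart_ball[OF U(1) open_UNIV UNIV_I U(2)] .
  have sub: "cball (\<kappa> p) (2 * r) \<subseteq> \<kappa> ` U" using r(2) by blast
  obtain \<rho> :: "'e \<Rightarrow> real" where \<rho>: "smooth_on UNIV \<rho>" "\<And>y. y \<in> ball (\<kappa> p) r \<Longrightarrow> \<rho> y = 1"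
    "\<And>y. y \<notin> ball (\<kappa> p) (2 * r) \<Longrightarrow> \<rho> y = 0" "\<And>y. 0 \<le> \<rho> y" "\<And>y. \<rho> y \<le> 1"
    by (rule smooth_bump_euclidean[OF r(1)]) (rule that)
  define K where "K = inv_into U \<kappa>"
  define W where "W = K ` ball (\<kappa> p) r"
  define x where "x = (\<lambda>q. if q \<in> U then \<rho> (\<kappa> q) *\<^sub>R \<kappa> q else 0)"
  define E where "E = (\<lambda>b q. if q \<in> U then \<rho> (\<kappa> q) *\<^sub>R coord_vector (U, \<kappa>) b q else 0)"
  have bs: "ball (\<kappa> p) r \<subseteq> \<kappa> ` U"
    by (rule subset_trans[OF _ sub]) (use r(1) in auto)
  note V = open_chart_preimage[OF U(1) open_ball bs, folded K_def, folded W_def]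
  have WU: "W \<subseteq> U" by (rule V(2))
  have \<rho>1: "\<rho> (\<kappa> q) = 1" if "q \<in> W" for q using \<rho>(2) V(3) that by blast
  have xk: "x q = \<kappa> q" if "q \<in> W" for q using \<rho>1[OF that] WU that by (auto simp: x_def)
  have xW: "x ` S = \<kappa> ` S" if "S \<subseteq> W" for S using xk that by (intro image_cong) auto
  have xs: "(\<lambda>q. x q \<bullet> b) \<in> CM" for b
  proof -
    have "smooth_on (\<kappa> ` U) (\<lambda>y. y \<bullet> b)" by (rule smooth_on_inner[OF c(2) smooth_on_id[OF c(2)]])
    from smooth_functions_extend[OF U(1) c(2) sub subset_refl this \<rho>(1,3)]
    have "(\<lambda>q. if q \<in> U then \<rho> (\<kappa> q) * (\<kappa> q \<bullet> b) else 0) \<in> CM" .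
    also have "(\<lambda>q. if q \<in> U then \<rho> (\<kappa> q) * (\<kappa> q \<bullet> b) else 0) = (\<lambda>q. x q \<bullet> b)"
      by (auto simp: x_def)
    finally show ?thesis .
  qed
  have Es: "E b \<in> XM" for b
    unfolding smooth_fields_def
  proof (intro CollectI conjI allI ballI)
    show "E b q \<in> TM q" for q
      using coord_vector_tangent[OF U(1)] by (simp add: E_def tangent_closed)
  next
    fix a assume a: "a \<in> CM"
    have "smooth_on (\<kappa> ` U) (\<lambda>y. frechet_derivative (\<lambda>y. a (inv_into U \<kappa> y)) (at y) b)"
      by (rule smooth_on_frechet[OF smooth_in_chart[OF a U(1)]])
    from smooth_functions_extend[OF U(1) c(2) sub subset_refl this \<rho>(1,3)]
    have "(\<lambda>q. if q \<in> U then \<rho> (\<kappa> q) * frechet_derivative (\<lambda>y. a (inv_into U \<kappa> y)) (at (\<kappa> q)) b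
      else 0) \<in> CM" .
    also have "(\<lambda>q. if q \<in> U then \<rho> (\<kappa> q) * frechet_derivative (\<lambda>y. a (inv_into U \<kappa> y)) (at (\<kappa> q)) b
      else 0) = (\<lambda>q. E b q a)"
      using a by (auto simp: E_def coord_vector_def)
    finally show "(\<lambda>q. E b q a) \<in> CM" .
  qed
  have Ec: "E b q = coord_vector (U, \<kappa>) b q" if "q \<in> W" for q b
    using \<rho>1[OF that] WU that by (auto simp: E_def)
  have EK: "E b q a = frechet_derivative (\<lambda>y. a (K y)) (at (x q)) b"
    if "q \<in> W" "a \<in> CM" for a b q
    using that by (simp add: Ec coord_vector_def xk K_def)
  have Kx: "K (x q) = q" if "q \<in> W" for q using xk[OF that] c(5) WU that by (auto simp: K_def)
  have oxW: "open (x ` W)" unfolding xW[OF subset_refl] V(3) by (rule open_ball)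
  show ?thesis
  proof (rule that)
    show "p \<in> W" unfolding W_def K_def using c(5)[OF U(2)] r(1) by (metis centre_in_ball imageI)
    show "coord_frame W x K E"
      unfolding coord_frame_def
    proof (intro conjI allI impI)
      show "open W" by (rule V(1))
      show "open (x ` W)" by (rule oxW)
      show "continuous_on W x"
        by (rule continuous_on_eq[OF continuous_on_subset[OF c(3) WU]]) (simp add: xk)
      show "continuous_on (x ` W) K"
        unfolding K_def xW[OF subset_refl] by (rule continuous_on_subset[OF c(4)]) (use WU in blast)
      show "smooth_on (x ` W) (\<lambda>y. a (K y))" if "a \<in> CM" for a
        unfolding K_def xW[OF subset_refl]
        by (rule smooth_on_subset[OF smooth_in_chart[OF that U(1)]]) (use WU in blast)
      show "smooth_on (x ` (V \<inter> W)) (\<lambda>y. \<psi> (K y))" if "(V, \<psi>) \<in> M" for V \<psi>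
        unfolding K_def xW[OF Int_lower2]
        by (rule smooth_on_subset[OF transition[OF U(1) that]]) (use WU in blast)
      show "E b q (\<lambda>q. x q \<bullet> c) = b \<bullet> c" if "q \<in> W" for b c q
      proof -
        have "((\<lambda>y. y \<bullet> c) has_derivative (\<lambda>b. b \<bullet> c)) (at (x q))"
          by (auto intro!: derivative_eq_intros)
        then have "((\<lambda>y. x (K y) \<bullet> c) has_derivative (\<lambda>b. b \<bullet> c)) (at (x q))"
          by (rule has_derivative_transform_within_open[OF _ oxW]) (use that Kx in auto)
        from frechet_derivative_at[OF this] show ?thesis using EK[OF that xs[of c], of b] by metis
      qed
      show "v = (\<Sum>b\<in>Basis. v (\<lambda>q. x q \<bullet> b) *\<^sub>R E b q)" if "q \<in> W" "v \<in> TM q" for q v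
        using tangent_coord_expansion[OF U(1) that(2) xs V(1) that(1) WU xk] Ec[OF that(1)] by simp
    qed (rule Kx xs Es EK; assumption)+
  qed
qed

end

section \<open>Local existence for ordinary differential equations\<close>

text \<open>The partial derivatives are bounded on a compact ball, and the operator norm is at most
  the sum of their norms; convexity gives the mean value inequality.\<close>

lemma smooth_on_lipschitz_cball:
  fixes F :: "'a::euclidean_space \<Rightarrow> 'b::euclidean_space"
  assumes "open O'" "smooth_on O' F" "x0 \<in> O'"
  obtains r L where "0 < r" "cball x0 r \<subseteq> O'" "0 \<le> L"
    "\<And>x y. x \<in> cball x0 r \<Longrightarrow> y \<in> cball x0 r \<Longrightarrow> norm (F x - F y) \<le> L * norm (x - y)"
proof -
  obtain r where r: "0 < r" "cball x0 r \<subseteq> O'" using assms(1,3) open_contains_cball by blast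
  have "\<exists>B. \<forall>x\<in>cball x0 r. norm (frechet_derivative F (at x) u) \<le> B" for u
  proof -
    have "continuous_on (cball x0 r) (\<lambda>x. frechet_derivative F (at x) u)"
      using smooth_on_imp_continuous[OF smooth_on_frechet[OF assms(2)]] r(2) continuous_on_subset by blast
    then have "bounded ((\<lambda>x. frechet_derivative F (at x) u) ` cball x0 r)"
      using compact_continuous_image compact_imp_bounded compact_cball by blast
    then show ?thesis unfolding bounded_iff by auto
  qed
  then obtain B where B: "\<And>u x. x \<in> cball x0 r \<Longrightarrow> norm (frechet_derivative F (at x) u) \<le> B u"
    by metis
  let ?L = "\<Sum>u\<in>Basis. \<bar>B u\<bar>"
  have "norm (F x - F y) \<le> ?L * norm (x - y)" if "x \<in> cball x0 r" "y \<in> cball x0 r" for x y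
  proof (rule differentiable_bound[OF convex_cball _ _ that])
    fix z assume z: "z \<in> cball x0 r"
    have D: "(F has_derivative frechet_derivative F (at z)) (at z)"
      using smooth_on_has_derivative[OF assms(2)] z r(2) by blast
    then show "(F has_derivative frechet_derivative F (at z)) (at z within cball x0 r)"
      by (rule has_derivative_at_withinI)
    have "onorm (frechet_derivative F (at z)) \<le> (\<Sum>u\<in>Basis. norm (frechet_derivative F (at z) u))"
      using onorm_componentwise[OF has_derivative_bounded_linear[OF D]] .
    also have "... \<le> ?L" by (rule sum_mono) (use B[OF z] in \<open>meson abs_ge_self order_trans\<close>)
    finally show "onorm (frechet_derivative F (at z)) \<le> ?L" .
  qed
  then show ?thesis using that[of r ?L] r by (simp add: sum_nonneg)
qed

text \<open>With G globally Lipschitz and bounded, the integral operator is a contraction of the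
  whole space of bounded continuous functions, so no invariant ball has to be tracked.\<close>

lemma picard_lipschitz:
  fixes G :: "'a::euclidean_space \<Rightarrow> 'a"
  assumes L: "0 \<le> L" "\<And>x y. norm (G x - G y) \<le> L * norm (x - y)"
    and B: "0 \<le> B" "\<And>x. norm (G x) \<le> B"
    and e: "0 < e" "3 * e * L \<le> 1 / 2"
  obtains y where "y 0 = x0" "\<And>t. norm (y t - x0) \<le> 3 * e * B"
    "\<And>t. t \<in> {-e<..<e} \<Longrightarrow> (y has_vector_derivative G (y t)) (at t)"
proof -
  have cG: "continuous_on UNIV G"
  proof (rule continuous_on_iff[THEN iffD2], intro ballI allI impI)
    fix x and \<epsilon> :: real assume "0 < \<epsilon>"
    then show "\<exists>d>0. \<forall>x'\<in>UNIV. dist x' x < d \<longrightarrow> dist (G x') (G x) < \<epsilon>"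
    proof (intro exI[of _ "\<epsilon> / (L + 1)"] conjI ballI impI)
      fix x' assume d: "dist x' x < \<epsilon> / (L + 1)"
      have "dist (G x') (G x) \<le> L * dist x' x" using L(2) by (simp add: dist_norm)
      also have "... \<le> (L + 1) * dist x' x" by (simp add: mult_right_mono)
      also have "... < \<epsilon>" using d L(1) by (simp add: field_simps)
      finally show "dist (G x') (G x) < \<epsilon>" .
    qed (use L(1) in simp)
  qed
  \<comment> \<open>Clamping time to [-e, e] turns functions on that interval into bounded
    continuous functions on the line, the type to which the fixed point theorem is applied.\<close>
  define c where "c t = max (- e) (min e t)" for t
  have c: "c t \<in> {-e..e}" "continuous_on S c" for t S
    using e(1) unfolding c_def by (auto intro!: continuous_intros)
  \<comment> \<open>The integral from 0 to s, written as a difference of integrals from -e because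
    the integral over an interval with reversed ends is 0 and not the negative.\<close>
  define J where "J \<phi> s = x0 + (integral {-e..s} (\<lambda>t. G (\<phi> t)) - integral {-e..0} (\<lambda>t. G (\<phi> t)))"
    for \<phi> :: "real \<Rightarrow> 'a" and s
  have cont: "continuous_on S (\<lambda>t. G (apply_bcontfun \<phi> t))" for \<phi> :: "real \<Rightarrow>\<^sub>C 'a" and S
    by (rule continuous_on_compose2[OF cG]) auto
  have cJ: "continuous_on {-e..e} (J (apply_bcontfun \<phi>))" for \<phi> :: "real \<Rightarrow>\<^sub>C 'a"
    unfolding J_def
    by (intro continuous_intros indefinite_integral_continuous_1 integrable_continuous_real cont)
  have bJ: "(\<lambda>t. J (apply_bcontfun \<phi>) (c t)) \<in> bcontfun" for \<phi> :: "real \<Rightarrow>\<^sub>C 'a"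
    unfolding bcontfun_def
  proof (intro CollectI conjI)
    show "continuous_on UNIV (\<lambda>t. J (apply_bcontfun \<phi>) (c t))"
      by (rule continuous_on_compose2[OF cJ c(2)]) (use c(1) in blast)
    have "bounded (J (apply_bcontfun \<phi>) ` {-e..e})"
      using compact_continuous_image[OF cJ] compact_Icc compact_imp_bounded by blast
    then show "bounded (range (\<lambda>t. J (apply_bcontfun \<phi>) (c t)))"
      by (rule bounded_subset) (use c(1) in blast)
  qed
  define T where "T \<phi> = Bcontfun (\<lambda>t. J (apply_bcontfun \<phi>) (c t))" for \<phi> :: "real \<Rightarrow>\<^sub>C 'a"
  have T: "apply_bcontfun (T \<phi>) t = J (apply_bcontfun \<phi>) (c t)" for \<phi> t
    unfolding T_def using Bcontfun_inverse[OF bJ] by simp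
  \<comment> \<open>The two integrals run over lengths at most 2e and e; this is the origin of the
    factor 3e in the statement.\<close>
  have int_bound: "norm (integral {-e..s} f - integral {-e..0} f) \<le> 3 * e * C"
    if "s \<in> {-e..e}" "continuous_on UNIV f" "\<And>t. norm (f t) \<le> C" for s C and f :: "real \<Rightarrow> 'a"
  proof -
    have C: "0 \<le> C" using that(3)[of 0] norm_ge_zero order_trans by blast
    have b: "norm (integral {-e..u} f) \<le> C * (u - (- e))" if "-e \<le> u" for u
      using that \<open>continuous_on UNIV f\<close> \<open>\<And>t. norm (f t) \<le> C\<close>
      by (intro integral_bound) (auto intro: continuous_on_subset)
    have "norm (integral {-e..s} f - integral {-e..0} f) \<le> C * (s + e) + C * (0 + e)"
      using norm_triangle_ineq4[of "integral {-e..s} f" "integral {-e..0} f"] b[of s] b[of 0] that(1) e(1)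
      by auto
    also have "... \<le> C * (2 * e) + C * e" using that(1) C by (intro add_mono mult_left_mono) auto
    finally show ?thesis by (simp add: algebra_simps)
  qed
  have "dist (T \<phi>) (T \<psi>) \<le> 1 / 2 * dist \<phi> \<psi>" for \<phi> \<psi>
  proof (rule dist_bound)
    fix t
    let ?f = "\<lambda>t. G (apply_bcontfun \<phi> t)" and ?g = "\<lambda>t. G (apply_bcontfun \<psi> t)"
    have i: "?f integrable_on {-e..u}" "?g integrable_on {-e..u}" for u
      by (intro integrable_continuous_real cont)+
    have "dist (apply_bcontfun (T \<phi>) t) (apply_bcontfun (T \<psi>) t) =
        norm (integral {-e..c t} (\<lambda>t. ?f t - ?g t) - integral {-e..0} (\<lambda>t. ?f t - ?g t))"
      unfolding T J_def dist_norm integral_diff[OF i] by (simp add: algebra_simps)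
    also have "... \<le> 3 * e * (L * dist \<phi> \<psi>)"
    proof (rule int_bound[OF c(1)])
      show "continuous_on UNIV (\<lambda>t. ?f t - ?g t)" by (intro continuous_on_diff cont)
      fix t
      have "norm (?f t - ?g t) \<le> L * norm (apply_bcontfun \<phi> t - apply_bcontfun \<psi> t)" by (rule L(2))
      also have "... \<le> L * dist \<phi> \<psi>"
        using dist_bounded[of \<phi> t \<psi>] L(1) by (intro mult_left_mono) (auto simp: dist_norm)
      finally show "norm (?f t - ?g t) \<le> L * dist \<phi> \<psi>" .
    qed
    also have "... = (3 * e * L) * dist \<phi> \<psi>" by simp
    also have "... \<le> 1 / 2 * dist \<phi> \<psi>" by (rule mult_right_mono[OF e(2)]) simp
    finally show "dist (apply_bcontfun (T \<phi>) t) (apply_bcontfun (T \<psi>) t) \<le> 1 / 2 * dist \<phi> \<psi>" .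
  qed
  then obtain \<phi> where \<phi>: "T \<phi> = \<phi>" using banach_fix_type[of "1/2" T] by auto
  let ?y = "apply_bcontfun \<phi>"
  have y: "?y t = J ?y (c t)" for t using T[of \<phi> t] \<phi> by simp
  show ?thesis
  proof (rule that[of ?y])
    show "?y 0 = x0" using y[of 0] e(1) by (simp add: J_def c_def)
    show "norm (?y t - x0) \<le> 3 * e * B" for t
      unfolding y[of t] J_def using int_bound[OF c(1) cont B(2)] by simp
    fix t assume t: "t \<in> {-e<..<e}"
    have "((\<lambda>s. integral {-e..s} (\<lambda>t. G (?y t))) has_vector_derivative G (?y t)) (at t within {-e..e})"
      by (rule integral_has_vector_derivative[OF cont]) (use t in auto)
    then have "((\<lambda>s. integral {-e..s} (\<lambda>t. G (?y t))) has_vector_derivative G (?y t)) (at t)"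
      using t at_within_Icc_at[of "-e" t e] by simp
    then have "(J ?y has_vector_derivative G (?y t)) (at t)"
      unfolding J_def by (auto intro!: derivative_eq_intros)
    then show "(?y has_vector_derivative G (?y t)) (at t)"
      by (rule has_vector_derivative_transform_within_open[where S="{-e<..<e}"])
        (use t in \<open>auto simp: y[of _] c_def\<close>)
  qed
qed

text \<open>Composing F with the nearest-point retraction onto a small closed ball makes it globally
  Lipschitz and bounded. The solution stays in that ball, where the retraction is the identity, so
  it solves the original equation.\<close>

lemma picard_smooth:
  fixes F :: "'a::euclidean_space \<Rightarrow> 'a"
  assumes "open O'" "smooth_on O' F" "x0 \<in> O'"
  obtains e y where "0 < e" "y 0 = x0" "\<And>t. t \<in> {-e<..<e} \<Longrightarrow> y t \<in> O'"
    "\<And>t. t \<in> {-e<..<e} \<Longrightarrow> (y has_vector_derivative F (y t)) (at t)" "smooth_on {-e<..<e} y"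
proof -
  obtain r L where r: "0 < r" "cball x0 r \<subseteq> O'" "0 \<le> L"
    "\<And>x y. x \<in> cball x0 r \<Longrightarrow> y \<in> cball x0 r \<Longrightarrow> norm (F x - F y) \<le> L * norm (x - y)"
    by (rule smooth_on_lipschitz_cball[OF assms]) (rule that)
  let ?c = "closest_point (cball x0 r)"
  have ne: "cball x0 r \<noteq> {}" using r(1) by simp
  have cc: "?c x \<in> cball x0 r" for x by (rule closest_point_in_set[OF closed_cball ne])
  have "bounded (F ` cball x0 r)"
    using compact_continuous_image[OF continuous_on_subset[OF smooth_on_imp_continuous[OF assms(2)] r(2)]]
      compact_imp_bounded compact_cball by blast
  then obtain B where B: "0 < B" "\<And>x. x \<in> cball x0 r \<Longrightarrow> norm (F x) \<le> B"
    unfolding bounded_pos by auto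
  \<comment> \<open>The first bound gives the contraction factor 1/2, with L + 1 in place of L to
    allow L = 0; the second keeps the solution within distance r of x0.\<close>
  define e where "e = min (1 / (6 * (L + 1))) (r / (3 * B))"
  have e: "0 < e" using r(1,3) B(1) by (simp add: e_def)
  have "3 * e * L \<le> 3 * (1 / (6 * (L + 1))) * (L + 1)"
    using r(1,3) B(1) by (intro mult_mono) (auto simp: e_def)
  also have "... = 1 / 2" using r(3) by (simp add: field_simps)
  finally have eL: "3 * e * L \<le> 1 / 2" .
  have "3 * e * B \<le> 3 * (r / (3 * B)) * B" using r(1,3) B(1) by (intro mult_mono) (auto simp: e_def)
  then have eB: "3 * e * B \<le> r" using B(1) by simp
  have lip: "norm (F (?c x) - F (?c y)) \<le> L * norm (x - y)" for x y
  proof -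
    have "norm (F (?c x) - F (?c y)) \<le> L * norm (?c x - ?c y)" by (rule r(4)[OF cc cc])
    also have "... \<le> L * norm (x - y)"
      using closest_point_lipschitz[OF convex_cball closed_cball ne, of x y] r(3)
      by (intro mult_left_mono) (auto simp: dist_norm)
    finally show ?thesis .
  qed
  obtain y where y: "y 0 = x0" "\<And>t. norm (y t - x0) \<le> 3 * e * B"
    "\<And>t. t \<in> {-e<..<e} \<Longrightarrow> (y has_vector_derivative F (?c (y t))) (at t)"
    by (rule picard_lipschitz[where G="\<lambda>x. F (?c x)" and ?x0.0=x0, OF r(3) lip less_imp_le[OF B(1)] B(2)[OF cc] e eL]) (rule that)
  have yc: "y t \<in> cball x0 r" for t
    using y(2)[of t] eB by (simp add: dist_norm norm_minus_commute)
  have yO: "y t \<in> O'" for t using yc r(2) by blast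
  have yd: "(y has_vector_derivative F (y t)) (at t)" if "t \<in> {-e<..<e}" for t
    using y(3)[OF that] closest_point_self[OF yc] by simp
  \<comment> \<open>Bootstrapping: y' = F(y) is of class k whenever y is.\<close>
  have "Ck_on k {-e<..<e} y" for k
  proof (induction k)
    case 0
    have "continuous_on {-e<..<e} y"
      using yd by (intro continuous_at_imp_continuous_on ballI has_vector_derivative_continuous) auto
    then show ?case by simp
  next
    case (Suc k)
    show ?case
    proof (rule Ck_on_SucI[where f'="\<lambda>t v. v *\<^sub>R F (y t)"])
      show "(y has_derivative (\<lambda>v. v *\<^sub>R F (y t))) (at t)" if "t \<in> {-e<..<e}" for t
        using yd[OF that] by (simp add: has_vector_derivative_def)
      have "Ck_on k O' F" using assms(2) by (simp add: smooth_on_def)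
      then have "Ck_on k {-e<..<e} (\<lambda>t. F (y t))"
        using Ck_on_compose[OF _ Suc.IH, of O' F] yO by auto
      then show "Ck_on k {-e<..<e} (\<lambda>t. v *\<^sub>R F (y t))" for v
        by (rule Ck_on_bounded_linear_comp[OF _ bounded_linear_scaleR_right, rotated]) simp
    qed simp
  qed
  then show ?thesis using that[of e y] e y(1) yO yd by (simp add: smooth_on_def)
qed

section \<open>Affine connections\<close>

locale affine_manifold = manifold M
  for M :: "('m::{t2_space, second_countable_topology}, 'e::euclidean_space) chart set" +
  fixes nabla :: "'m conn"
  assumes connection: "affine_connection M nabla"
begin

lemma nabla_smooth: "E \<in> XM \<Longrightarrow> F \<in> XM \<Longrightarrow> nabla E F \<in> XM"
  using connection unfolding affine_connection_def by blast

lemma nabla_tangent: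
  "E \<in> XM \<Longrightarrow> F \<in> XM \<Longrightarrow> nabla E F p \<in> TM p"
  by (rule smooth_fieldsD(1)[OF nabla_smooth])

lemma nabla_add:
  assumes "E \<in> XM" "E' \<in> XM" "F \<in> XM"
  shows nabla_add_left: "nabla (E + E') F = nabla E F + nabla E' F"
    and nabla_add_right: "nabla F (E + E') = nabla F E + nabla F E'"
  using connection assms unfolding affine_connection_def by blast+

lemma nabla_fscale:
  assumes "a \<in> CM" "E \<in> XM" "F \<in> XM"
  shows nabla_fscale_left: "nabla (fscale a E) F = fscale a (nabla E F)"
    and nabla_fscale_right: "nabla E (fscale a F) = fscale (\<lambda>p. E p a) F + fscale a (nabla E F)"
  using connection assms unfolding affine_connection_def by blast+

lemma scaleR_conv_fscale: "c *\<^sub>R E = fscale (\<lambda>_. c) E"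
  by (simp add: fscale_def scaleR_fun_def)

lemma nabla_scaleR:
  assumes "E \<in> XM" "F \<in> XM"
  shows nabla_scaleR_left: "nabla (c *\<^sub>R E) F = c *\<^sub>R nabla E F"
    and nabla_scaleR_right: "nabla E (c *\<^sub>R F) = c *\<^sub>R nabla E F"
proof -
  have "fscale (\<lambda>p. E p (\<lambda>_. c)) F = 0"
    using tangent_const[OF smooth_fieldsD(1)[OF assms(1)]] by (simp add: fscale_def fun_eq_iff)
  then show "nabla (c *\<^sub>R E) F = c *\<^sub>R nabla E F" "nabla E (c *\<^sub>R F) = c *\<^sub>R nabla E F"
    unfolding scaleR_conv_fscale using nabla_fscale[OF smooth_functions_const assms] by simp_all
qed

lemma nabla_zero:
  assumes "F \<in> XM"
  shows nabla_zero_left: "nabla 0 F = 0" and nabla_zero_right: "nabla F 0 = 0"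
  using nabla_scaleR[OF assms assms, of 0] by simp_all

lemma nabla_diff:
  assumes "E \<in> XM" "E' \<in> XM" "F \<in> XM"
  shows nabla_diff_left: "nabla (E - E') F = nabla E F - nabla E' F"
    and nabla_diff_right: "nabla F (E - E') = nabla F E - nabla F E'"
proof -
  have "E' + (E - E') = E" by simp
  note nabla_add[OF assms(2) smooth_fields_diff[OF assms(1,2)] assms(3), unfolded this]
  then show "nabla (E - E') F = nabla E F - nabla E' F" "nabla F (E - E') = nabla F E - nabla F E'"
    by simp_all
qed

lemma nabla_sum:
  assumes "\<And>i. i \<in> A \<Longrightarrow> E i \<in> XM" "F \<in> XM"
  shows nabla_sum_left: "nabla (\<Sum>i\<in>A. E i) F = (\<Sum>i\<in>A. nabla (E i) F)"
    and nabla_sum_right: "nabla F (\<Sum>i\<in>A. E i) = (\<Sum>i\<in>A. nabla F (E i))"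
  using assms(1)
  by (induction A rule: infinite_finite_induct)
    (simp_all add: nabla_zero[OF assms(2)] nabla_add[OF _ _ assms(2)] smooth_fields_sum)

text \<open>A bump times E is the zero field, and the connection is evaluated on it by the product
  rules. In the second slot the extra term carries the factor E p = 0.\<close>

lemma nabla_eq_0_if_local:
  assumes E: "E \<in> XM" and F: "F \<in> XM"
    and W: "open W" "p \<in> W" "\<And>q. q \<in> W \<Longrightarrow> E q = 0"
  shows "nabla E F p = 0" "nabla F E p = 0"
proof -
  obtain \<rho> V where \<rho>: "\<rho> \<in> CM" "open V" "p \<in> V" "V \<subseteq> W" "\<And>q. q \<in> V \<Longrightarrow> \<rho> q = 1"
    "\<And>q. q \<notin> W \<Longrightarrow> \<rho> q = 0" "\<And>q. 0 \<le> \<rho> q" "\<And>q. \<rho> q \<le> 1"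
    by (rule smooth_bump[OF W(1,2)]) (rule that)
  have z: "fscale \<rho> E = 0"
  proof
    fix q show "fscale \<rho> E q = 0 q"
      using W(3)[of q] \<rho>(6)[of q] by (cases "q \<in> W") (simp_all add: fscale_def)
  qed
  have "0 = fscale \<rho> (nabla E F) p"
    using nabla_fscale_left[OF \<rho>(1) E F] nabla_zero_left[OF F] z by simp
  then show "nabla E F p = 0" using \<rho>(3,5) by (simp add: fscale_def)
  have "0 = (fscale (\<lambda>p. F p \<rho>) E + fscale \<rho> (nabla F E)) p"
    using nabla_fscale_right[OF \<rho>(1) F E] nabla_zero_right[OF F] z by simp
  then show "nabla F E p = 0" using \<rho>(3,5) W(2,3) by (simp add: fscale_def)
qed

lemma nabla_local:
  assumes "E \<in> XM" "E' \<in> XM" "F \<in> XM"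
    and "open W" "p \<in> W" "\<And>q. q \<in> W \<Longrightarrow> E q = E' q"
  shows nabla_local_left: "nabla E F p = nabla E' F p" and nabla_local_right: "nabla F E p = nabla F E' p"
  using nabla_eq_0_if_local[OF smooth_fields_diff[OF assms(1,2)] assms(3-5)] assms(6)
  unfolding nabla_diff[OF assms(1-3)] by simp_all

text \<open>Near p the difference of the two fields is a combination of frame fields with
  coefficients that vanish at p, and the connection is linear over smooth functions in its first
  slot.\<close>

lemma nabla_pointwise:
  assumes E: "E \<in> XM" "E' \<in> XM" "F \<in> XM" and eq: "E p = E' p"
  shows "nabla E F p = nabla E' F p"
proof -
  define H where "H = E - E'"
  have H: "H \<in> XM" "H p = 0" using E eq by (simp_all add: H_def smooth_fields_diff)
  obtain W x K C where p: "p \<in> W" and fr: "coord_frame W x K C" by (rule coord_frame_exists)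
  note fr = coord_frameD[OF fr]
  let ?S = "\<lambda>b. fscale (\<lambda>q. H q (\<lambda>q. x q \<bullet> b)) (C b)"
  have S: "?S b \<in> XM" for b
    by (rule smooth_fields_fscale[OF smooth_fieldsD(2)[OF H(1) fr(6)] fr(9)])
  have Hq: "H q = (\<Sum>b\<in>Basis. ?S b) q" if "q \<in> W" for q
    using fr(12)[OF that smooth_fieldsD(1)[OF H(1)]] by (simp add: sum_fun_apply fscale_def)
  have "nabla H F p = nabla (\<Sum>b\<in>Basis. ?S b) F p"
    by (rule nabla_local_left[OF H(1) smooth_fields_sum[OF S] E(3) fr(1) p Hq])
  also have "... = (\<Sum>b\<in>Basis. nabla (?S b) F) p" by (simp only: nabla_sum_left[OF S E(3)])
  also have "... = 0"
  proof -
    have "nabla (?S b) F p = 0" for b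
      unfolding nabla_fscale_left[OF smooth_fieldsD(2)[OF H(1) fr(6)] fr(9) E(3)] by (simp add: fscale_def H(2))
    then show ?thesis by (simp only: sum_fun_apply sum.neutral_const)
  qed
  finally show ?thesis unfolding H_def nabla_diff_left[OF E] by simp
qed

end

section \<open>Symmetric bilinear forms\<close>

text \<open>A metric without positivity. The weaker notion also covers the degenerate form that
  measures vertical parts, so both can be differentiated along geodesics by one lemma.\<close>

definition symmetric_form ::
    "('m::topological_space, 'e::euclidean_space) chart set \<Rightarrow> 'm metric \<Rightarrow> bool" where
  "symmetric_form M B \<longleftrightarrow>
     (\<forall>p. (\<forall>v\<in>tangent_space M p. linear_between (tangent_space M p) UNIV (B p v)) \<and>
          (\<forall>v\<in>tangent_space M p. \<forall>w\<in>tangent_space M p. B p v w = B p w v)) \<and>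
     (\<forall>E\<in>smooth_fields M. \<forall>F\<in>smooth_fields M. (\<lambda>p. B p (E p) (F p)) \<in> smooth_functions M)"

context manifold
begin

lemma form_commute:
  "symmetric_form M B \<Longrightarrow> v \<in> TM p \<Longrightarrow> w \<in> TM p \<Longrightarrow> B p v w = B p w v"
  unfolding symmetric_form_def by blast

lemma form_comb_right:
  "symmetric_form M B \<Longrightarrow> u \<in> TM p \<Longrightarrow> v \<in> TM p \<Longrightarrow> w \<in> TM p \<Longrightarrow>
    B p u (a *\<^sub>R v + b *\<^sub>R w) = a * B p u v + b * B p u w"
  unfolding symmetric_form_def linear_between_def by simp

lemma form_smooth:
  "symmetric_form M B \<Longrightarrow> E \<in> XM \<Longrightarrow> F \<in> XM \<Longrightarrow>
    (\<lambda>p. B p (E p) (F p)) \<in> CM"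
  unfolding symmetric_form_def by blast

lemma form_add_right:
  "symmetric_form M B \<Longrightarrow> u \<in> TM p \<Longrightarrow> v \<in> TM p \<Longrightarrow> w \<in> TM p \<Longrightarrow>
    B p u (v + w) = B p u v + B p u w"
  using form_comb_right[of B u p v w 1 1] by simp

lemma form_scaleR_right:
  "symmetric_form M B \<Longrightarrow> u \<in> TM p \<Longrightarrow> v \<in> TM p \<Longrightarrow>
    B p u (c *\<^sub>R v) = c * B p u v"
  using form_comb_right[of B u p v v c 0] by simp

lemma form_add_left:
  "symmetric_form M B \<Longrightarrow> u \<in> TM p \<Longrightarrow> v \<in> TM p \<Longrightarrow> w \<in> TM p \<Longrightarrow>
    B p (v + w) u = B p v u + B p w u"
  using form_add_right[of B u p v w] form_commute[of B u p] tangent_closed(2) by metis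

lemma form_scaleR_left:
  "symmetric_form M B \<Longrightarrow> u \<in> TM p \<Longrightarrow> v \<in> TM p \<Longrightarrow>
    B p (c *\<^sub>R v) u = c * B p v u"
  using form_scaleR_right[of B u p v c] form_commute[of B u p] tangent_closed(3) by metis

lemma form_zero_right: "symmetric_form M B \<Longrightarrow> u \<in> TM p \<Longrightarrow> B p u 0 = 0"
  using form_scaleR_right[of B u p u 0] by simp

lemma form_zero_left: "symmetric_form M B \<Longrightarrow> u \<in> TM p \<Longrightarrow> B p 0 u = 0"
  using form_scaleR_left[of B u p u 0] by simp

lemma form_sum_right:
  assumes "symmetric_form M B" "u \<in> TM p" "\<And>i. i \<in> A \<Longrightarrow> v i \<in> TM p"
  shows "B p u (\<Sum>i\<in>A. c i *\<^sub>R v i) = (\<Sum>i\<in>A. c i * B p u (v i))"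
  using assms(3)
  by (induction A rule: infinite_finite_induct)
    (simp_all add: form_zero_right[OF assms(1,2)] form_add_right[OF assms(1,2)] tangent_closed
      form_scaleR_right[OF assms(1,2)])

lemma form_sum_left:
  assumes "symmetric_form M B" "u \<in> TM p" "\<And>i. i \<in> A \<Longrightarrow> v i \<in> TM p"
  shows "B p (\<Sum>i\<in>A. c i *\<^sub>R v i) u = (\<Sum>i\<in>A. c i * B p (v i) u)"
proof -
  have "(\<Sum>i\<in>A. c i *\<^sub>R v i) \<in> TM p" by (intro tangent_closed assms)
  from form_commute[OF assms(1) this assms(2)] show ?thesis
    by (simp add: form_sum_right[OF assms] form_commute[OF assms(1) assms(2) assms(3)])
qed

end

section \<open>Geodesics\<close>

context affine_manifold
begin

lemma frame_eqI:
  assumes "coord_frame W x K E" "q \<in> W" "v \<in> TM q" "w \<in> TM q"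
    and "\<And>b. b \<in> Basis \<Longrightarrow> v (\<lambda>q. x q \<bullet> b) = w (\<lambda>q. x q \<bullet> b)"
  shows "v = w"
proof -
  note * = coord_frameD(12)[OF assms(1,2)]
  have "v = (\<Sum>b\<in>Basis. v (\<lambda>q. x q \<bullet> b) *\<^sub>R E b q)" by (rule *[OF assms(3)])
  also have "... = (\<Sum>b\<in>Basis. w (\<lambda>q. x q \<bullet> b) *\<^sub>R E b q)" by (rule sum.cong) (simp_all add: assms(5))
  also have "... = w" by (rule *[OF assms(4), symmetric])
  finally show ?thesis .
qed

lemma frame_comb:
  assumes "coord_frame W x K E" "q \<in> W" "b \<in> Basis"
  shows "(\<Sum>c\<in>Basis. u c *\<^sub>R E c q) (\<lambda>q. x q \<bullet> b) = u b"
proof -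
  have "(\<Sum>c\<in>Basis. u c *\<^sub>R E c q) (\<lambda>q. x q \<bullet> b) = (\<Sum>c\<in>Basis. u c * (c \<bullet> b))"
    by (simp add: sum_fun_apply coord_frameD(11)[OF assms(1,2)])
  also have "... = (\<Sum>c\<in>Basis. if c = b then u c else 0)"
    by (rule sum.cong[OF refl]) (auto simp: inner_Basis assms(3))
  also have "... = u b" using assms(3) by simp
  finally show ?thesis .
qed

text \<open>The coordinate formula of a connection; the components of the fields
  \<open>nabla (E c) (E b)\<close> are the Christoffel symbols.\<close>

lemma nabla_frame:
  assumes fr: "coord_frame W x K E" and q: "q \<in> W" and X: "X \<in> XM" "F \<in> XM"
  shows "nabla X F q = (\<Sum>b\<in>Basis. X q (\<lambda>q. F q (\<lambda>q. x q \<bullet> b)) *\<^sub>R E b q)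
    + (\<Sum>b\<in>Basis. \<Sum>c\<in>Basis. (F q (\<lambda>q. x q \<bullet> b) * X q (\<lambda>q. x q \<bullet> c)) *\<^sub>R nabla (E c) (E b) q)"
proof -
  note frD = coord_frameD[OF fr]
  have a: "(\<lambda>q. F q (\<lambda>q. x q \<bullet> b)) \<in> CM" for b
    by (rule smooth_fieldsD(2)[OF X(2) frD(6)])
  let ?S = "\<lambda>b. fscale (\<lambda>q. F q (\<lambda>q. x q \<bullet> b)) (E b)"
  have S: "?S b \<in> XM" for b by (rule smooth_fields_fscale[OF a frD(9)])
  have F: "F q' = (\<Sum>b\<in>Basis. ?S b) q'" if "q' \<in> W" for q'
    using frD(12)[OF that smooth_fieldsD(1)[OF X(2)]] by (simp add: sum_fun_apply fscale_def)
  let ?X = "\<Sum>c\<in>Basis. X q (\<lambda>q. x q \<bullet> c) *\<^sub>R E c"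
  have sX: "?X \<in> XM" by (intro smooth_fields_sum smooth_fields_scaleR frD(9))
  have Xq: "X q = ?X q"
    using frD(12)[OF q smooth_fieldsD(1)[OF X(1)]] by (simp add: sum_fun_apply)
  have XE: "nabla X (E b) q = (\<Sum>c\<in>Basis. X q (\<lambda>q. x q \<bullet> c) *\<^sub>R nabla (E c) (E b) q)" for b
  proof -
    have "nabla X (E b) q = nabla ?X (E b) q" by (rule nabla_pointwise[OF X(1) sX frD(9) Xq])
    also have "... = (\<Sum>c\<in>Basis. nabla (X q (\<lambda>q. x q \<bullet> c) *\<^sub>R E c) (E b)) q"
      by (simp only: nabla_sum_left[OF smooth_fields_scaleR[OF frD(9)] frD(9)])
    finally show ?thesis by (simp add: sum_fun_apply nabla_scaleR_left[OF frD(9) frD(9)])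
  qed
  have "nabla X F q = nabla X (\<Sum>b\<in>Basis. ?S b) q"
    by (rule nabla_local_right[OF X(2) smooth_fields_sum[OF S] X(1) frD(1) q F])
  also have "... = (\<Sum>b\<in>Basis. nabla X (?S b)) q" by (simp only: nabla_sum_right[OF S X(1)])
  also have "... = (\<Sum>b\<in>Basis. X q (\<lambda>q. F q (\<lambda>q. x q \<bullet> b)) *\<^sub>R E b q + F q (\<lambda>q. x q \<bullet> b) *\<^sub>R nabla X (E b) q)"
    by (simp only: sum_fun_apply nabla_fscale_right[OF a X(1) frD(9)]) (simp add: fscale_def)
  finally show ?thesis unfolding XE by (simp add: sum.distrib scaleR_sum_right)
qed

lemma geodesic_coordinates:
  assumes fr: "coord_frame W x K E" and p: "p \<in> W"
  obtains e h w where "0 < (e::real)" "h 0 = p" "w 0 = w0" "smooth_on {-e<..<e} w"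
    "\<And>t. t \<in> {-e<..<e} \<Longrightarrow> h t \<in> W" "smooth_map_on euclidean_atlas M {-e<..<e} h"
    "\<And>a. a \<in> CM \<Longrightarrow> smooth_on {-e<..<e} (\<lambda>t. a (h t))"
    "\<And>a t. t \<in> {-e<..<e} \<Longrightarrow> a \<in> CM \<Longrightarrow>
      ((\<lambda>t. a (h t)) has_real_derivative (\<Sum>b\<in>Basis. (w t \<bullet> b) *\<^sub>R E b (h t)) a) (at t)"
    "\<And>k t. t \<in> {-e<..<e} \<Longrightarrow> k \<in> Basis \<Longrightarrow> ((\<lambda>t. w t \<bullet> k) has_real_derivative
      - (\<Sum>b\<in>Basis. \<Sum>c\<in>Basis. (w t \<bullet> b) * (w t \<bullet> c) * nabla (E c) (E b) (h t) (\<lambda>q. x q \<bullet> k))) (at t)"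
proof -
  note frD = coord_frameD[OF fr]
  let ?\<Gamma> = "\<lambda>b c k q. nabla (E c) (E b) q (\<lambda>q. x q \<bullet> k)"
  let ?F2 = "\<lambda>z::'e\<times>'e. \<Sum>k\<in>Basis. (- (\<Sum>b\<in>Basis. \<Sum>c\<in>Basis. (snd z \<bullet> b) * (snd z \<bullet> c) * ?\<Gamma> b c k (K (fst z)))) *\<^sub>R k"
  let ?F = "\<lambda>z. (snd z, ?F2 z)"
  let ?O = "(x ` W) \<times> (UNIV :: 'e set)"
  have oO: "open ?O" by (intro open_Times frD(2) open_UNIV)
  have sF: "smooth_on ?O ?F"
  proof (rule smooth_on_Pair[OF oO])
    have f: "smooth_on ?O fst" and s: "smooth_on ?O snd"
      by (rule smooth_on_bounded_linear[OF oO _ smooth_on_id[OF oO]],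
          simp add: bounded_linear_fst bounded_linear_snd)+
    show "smooth_on ?O (\<lambda>z. snd z)" by (rule s)
    have "smooth_on ?O (\<lambda>z. ?\<Gamma> b c k (K (fst z)))" for b c k
      by (rule smooth_on_compose[OF oO f frD(7)[OF smooth_fieldsD(2)[OF nabla_smooth[OF frD(9) frD(9)] frD(6)]]]) auto
    then show "smooth_on ?O ?F2"
      by (intro smooth_on_sum smooth_on_scaleR smooth_on_minus smooth_on_mult smooth_on_inner oO s smooth_on_const)
  qed
  have z0: "(x p, w0) \<in> ?O" using p by simp
  obtain e z where z: "0 < e" "z 0 = (x p, w0)" "\<And>t. t \<in> {-e<..<e} \<Longrightarrow> z t \<in> ?O"
    "\<And>t. t \<in> {-e<..<e} \<Longrightarrow> (z has_vector_derivative ?F (z t)) (at t)" "smooth_on {-e<..<e} z"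
    by (rule picard_smooth[OF oO sF z0]) (rule that)
  let ?I = "{-e<..<e}"
  define w where "w t = snd (z t)" for t
  define y where "y t = fst (z t)" for t
  define h where "h t = K (y t)" for t
  have oI: "open ?I" by simp
  have sy: "smooth_on ?I y" and sw: "smooth_on ?I w"
    unfolding y_def w_def
    by (rule smooth_on_bounded_linear[OF oI _ z(5)], simp add: bounded_linear_fst bounded_linear_snd)+
  have yW: "y t \<in> x ` W" if "t \<in> ?I" for t using z(3)[OF that] by (auto simp: y_def)
  then have hW: "h t \<in> W" and xh: "x (h t) = y t" if "t \<in> ?I" for t
    using that frD(5) by (force simp: h_def)+
  have dy: "(y has_vector_derivative w t) (at t)" if "t \<in> ?I" for t
    using bounded_linear.has_vector_derivative[OF bounded_linear_fst z(4)[OF that]]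
    by (simp add: y_def[abs_def] w_def)
  have dw: "(w has_vector_derivative ?F2 (z t)) (at t)" if "t \<in> ?I" for t
    using bounded_linear.has_vector_derivative[OF bounded_linear_snd z(4)[OF that]]
    by (simp add: w_def[abs_def])
  show ?thesis
  proof (rule that[of e h w])
    show "h 0 = p" "w 0 = w0" using z(2) frD(5)[OF p] by (simp_all add: h_def y_def w_def)
    show "smooth_on ?I (\<lambda>t. a (h t))" if a: "a \<in> CM" for a
      unfolding h_def by (rule smooth_on_compose[OF oI sy frD(7)[OF a]]) (use yW in auto)
    have ch: "continuous_on ?I h"
      unfolding h_def
      by (rule continuous_on_compose2[OF frD(4) smooth_on_imp_continuous[OF sy]]) (use yW in auto)
    show "smooth_map_on euclidean_atlas M ?I h"
      unfolding smooth_map_on_def euclidean_atlas_def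
    proof (intro conjI ch ballI, clarsimp simp: o_def)
      fix V \<psi> assume V: "(V, \<psi>) \<in> M"
      have o: "open (?I \<inter> h -` V)" using continuous_open_preimage[OF ch oI chart(1)[OF V]] .
      have "smooth_on (?I \<inter> h -` V) (\<lambda>t. \<psi> (K (y t)))"
      proof (rule smooth_on_compose[OF o smooth_on_subset[OF sy Int_lower1] frD(8)[OF V]])
        show "y ` (?I \<inter> h -` V) \<subseteq> x ` (V \<inter> W)"
        proof clarify
          fix t assume "t \<in> ?I" "h t \<in> V"
          then show "y t \<in> x ` (V \<inter> W)" using hW[of t] xh[of t] by (metis IntI imageI)
        qed
      qed
      then show "smooth_on (?I \<inter> h -` V) (\<lambda>t. \<psi> (h t))" by (simp only: h_def)
    qed
    show "((\<lambda>t. a (h t)) has_real_derivative (\<Sum>b\<in>Basis. (w t \<bullet> b) *\<^sub>R E b (h t)) a) (at t)"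
      if t: "t \<in> ?I" and a: "a \<in> CM" for a t
    proof -
      let ?D = "frechet_derivative (\<lambda>y. a (K y)) (at (y t))"
      have D: "((\<lambda>y. a (K y)) has_derivative ?D) (at (y t))"
        by (rule smooth_on_has_derivative[OF frD(7)[OF a] yW[OF t]])
      have lin: "linear ?D" by (rule has_derivative_linear[OF D])
      have "(y has_derivative (\<lambda>s. s *\<^sub>R w t)) (at t)" using dy[OF t] by (simp add: has_vector_derivative_def)
      from diff_chain_at[OF this D]
      have "((\<lambda>t. a (h t)) has_derivative (\<lambda>s. s * ?D (w t))) (at t)"
        by (simp add: o_def h_def[abs_def] linear_cmul[OF lin])
      moreover have "?D (w t) = (\<Sum>b\<in>Basis. (w t \<bullet> b) *\<^sub>R E b (h t)) a"
      proof -
        have "?D (w t) = ?D (\<Sum>b\<in>Basis. (w t \<bullet> b) *\<^sub>R b)" by (simp only: euclidean_representation)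
        also have "... = (\<Sum>b\<in>Basis. (w t \<bullet> b) * ?D b)"
          by (simp only: linear_sum[OF lin] linear_cmul[OF lin] real_scaleR_def)
        finally show ?thesis by (simp add: sum_fun_apply frD(10)[OF hW[OF t] a] xh[OF t])
      qed
      ultimately show ?thesis by (simp add: has_field_derivative_def mult.commute[of _ "?D (w t)"] mult_commute_abs)
    qed
    show "((\<lambda>t. w t \<bullet> k) has_real_derivative
      - (\<Sum>b\<in>Basis. \<Sum>c\<in>Basis. (w t \<bullet> b) * (w t \<bullet> c) * ?\<Gamma> b c k (h t))) (at t)"
      if t: "t \<in> ?I" and k: "k \<in> Basis" for k t
    proof -
      have "((\<lambda>t. w t \<bullet> k) has_vector_derivative ?F2 (z t) \<bullet> k) (at t)"
        by (rule bounded_linear.has_vector_derivative[OF bounded_linear_inner_left dw[OF t]])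
      moreover have "?F2 (z t) \<bullet> k = - (\<Sum>b\<in>Basis. \<Sum>c\<in>Basis. (w t \<bullet> b) * (w t \<bullet> c) * ?\<Gamma> b c k (h t))"
        using k by (simp only: inner_sum_left_Basis w_def h_def y_def)
      ultimately show ?thesis by (simp add: has_real_derivative_iff_has_vector_derivative)
    qed
  qed (use z(1) sw hW in auto)
qed

end

lemma smooth_on_deriv:
  fixes f :: "real \<Rightarrow> real"
  assumes "open I" "smooth_on I f"
  shows "smooth_on I (deriv f)" and "t \<in> I \<Longrightarrow> (f has_real_derivative deriv f t) (at t)"
proof -
  have d: "(f has_real_derivative frechet_derivative f (at t) 1) (at t)" if "t \<in> I" for t
  proof -
    have D: "(f has_derivative frechet_derivative f (at t)) (at t)"
      by (rule smooth_on_has_derivative[OF assms(2) that])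
    have "frechet_derivative f (at t) s = frechet_derivative f (at t) 1 * s" for s
      using linear_cmul[OF has_derivative_linear[OF D], of s 1] by simp
    then have "frechet_derivative f (at t) = (*) (frechet_derivative f (at t) 1)" by blast
    then show ?thesis using D by (simp only: has_field_derivative_def)
  qed
  then show "t \<in> I \<Longrightarrow> (f has_real_derivative deriv f t) (at t)" using DERIV_imp_deriv by metis
  show "smooth_on I (deriv f)"
    by (rule smooth_on_cong[OF assms(1) _ smooth_on_frechet[OF assms(2), of 1]])
      (rule DERIV_imp_deriv[OF d, symmetric])
qed

context affine_manifold
begin

text \<open>\<open>geodesic_on\<close> asks for some operator satisfying the axioms of a covariant
  derivative along the curve. The usual coordinate expression is the witness, and is globally valid
  along h because h stays in W.\<close>

lemma cov_deriv_along_coordinates: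
  assumes fr: "coord_frame W x K E" and I: "open I" "\<And>t. t \<in> I \<Longrightarrow> h t \<in> W" and w: "smooth_on I w"
    and sh: "\<And>a. a \<in> CM \<Longrightarrow> smooth_on I (\<lambda>t. a (h t))"
    and dh: "\<And>a t. t \<in> I \<Longrightarrow> a \<in> CM \<Longrightarrow>
      ((\<lambda>t. a (h t)) has_real_derivative velocity M h t a) (at t)"
    and vel: "\<And>t. t \<in> I \<Longrightarrow> velocity M h t = (\<Sum>b\<in>Basis. (w t \<bullet> b) *\<^sub>R E b (h t))"
  shows "cov_deriv_along M nabla I h (\<lambda>Y s. (\<Sum>b\<in>Basis. deriv (\<lambda>t. Y t (\<lambda>q. x q \<bullet> b)) s *\<^sub>R E b (h s))
    + (\<Sum>b\<in>Basis. \<Sum>c\<in>Basis. (Y s (\<lambda>q. x q \<bullet> b) * (w s \<bullet> c)) *\<^sub>R nabla (E c) (E b) (h s)))"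
    (is "cov_deriv_along M nabla I h ?D")
  unfolding cov_deriv_along_def
proof (intro conjI ballI allI impI)
  note frD = coord_frameD[OF fr]
  have dY: "((\<lambda>t. Y t (\<lambda>q. x q \<bullet> b)) has_real_derivative deriv (\<lambda>t. Y t (\<lambda>q. x q \<bullet> b)) s) (at s)"
    if "Y \<in> fields_along M I h" "s \<in> I" for Y s b
    using smooth_on_deriv(2)[OF I(1) _ that(2)] that(1) frD(6)[of b] by (auto simp: fields_along_def)
  have Et: "E b q \<in> TM q" "nabla (E c) (E b) q \<in> TM q" for b c q
    by (rule smooth_fieldsD(1)[OF frD(9)], rule nabla_tangent[OF frD(9) frD(9)])
  fix Y assume Y: "Y \<in> fields_along M I h"
  show "?D Y \<in> fields_along M I h"
    unfolding fields_along_def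
  proof (intro CollectI conjI ballI)
    show "?D Y s \<in> TM (h s)" for s
      by (intro tangent_closed Et)
    fix a assume a: "a \<in> CM"
    have "smooth_on I (\<lambda>t. Y t (\<lambda>q. x q \<bullet> b))" for b
      using Y frD(6)[of b] by (auto simp: fields_along_def)
    then have "smooth_on I (\<lambda>s. (\<Sum>b\<in>Basis. deriv (\<lambda>t. Y t (\<lambda>q. x q \<bullet> b)) s * E b (h s) a)
      + (\<Sum>b\<in>Basis. \<Sum>c\<in>Basis. (Y s (\<lambda>q. x q \<bullet> b) * (w s \<bullet> c)) * nabla (E c) (E b) (h s) a))"
      by (intro smooth_on_add smooth_on_sum smooth_on_mult smooth_on_inner I(1) w smooth_on_deriv(1)
          sh[OF smooth_fieldsD(2)[OF frD(9) a]] sh[OF smooth_fieldsD(2)[OF nabla_smooth[OF frD(9) frD(9)] a]])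
    then show "smooth_on I (\<lambda>s. ?D Y s a)" by (simp add: sum_fun_apply)
  qed
  show "?D (Y + Z) s = ?D Y s + ?D Z s" if Z: "Z \<in> fields_along M I h" and s: "s \<in> I" for Z s
  proof -
    have "deriv (\<lambda>t. (Y + Z) t (\<lambda>q. x q \<bullet> b)) s
        = deriv (\<lambda>t. Y t (\<lambda>q. x q \<bullet> b)) s + deriv (\<lambda>t. Z t (\<lambda>q. x q \<bullet> b)) s" for b
      using DERIV_imp_deriv[OF DERIV_add[OF dY[OF Y s, of b] dY[OF Z s, of b]]] by simp
    then show ?thesis by (simp add: scaleR_add_left sum.distrib distrib_right)
  qed
next
  note frD = coord_frameD[OF fr]
  fix u :: "real \<Rightarrow> real" and Y s
  assume u: "smooth_on I u" and Y: "Y \<in> fields_along M I h" and s: "s \<in> I"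
  have dY: "((\<lambda>t. Y t (\<lambda>q. x q \<bullet> b)) has_real_derivative deriv (\<lambda>t. Y t (\<lambda>q. x q \<bullet> b)) s) (at s)" for b
    using smooth_on_deriv(2)[OF I(1) _ s] Y frD(6)[of b] by (auto simp: fields_along_def)
  have Yt: "Y s \<in> TM (h s)" using Y s by (auto simp: fields_along_def)
  have "deriv (\<lambda>t. (u t *\<^sub>R Y t) (\<lambda>q. x q \<bullet> b)) s
      = deriv u s * Y s (\<lambda>q. x q \<bullet> b) + u s * deriv (\<lambda>t. Y t (\<lambda>q. x q \<bullet> b)) s" for b
    using DERIV_imp_deriv[OF DERIV_mult[OF smooth_on_deriv(2)[OF I(1) u s] dY[of b]]] by (simp add: mult.commute)
  then have "?D (\<lambda>t. u t *\<^sub>R Y t) s = deriv u s *\<^sub>R (\<Sum>b\<in>Basis. Y s (\<lambda>q. x q \<bullet> b) *\<^sub>R E b (h s)) + u s *\<^sub>R ?D Y s"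
    by (simp add: scaleR_add_left sum.distrib scaleR_sum_right scaleR_add_right mult.assoc)
  then show "?D (\<lambda>t. u t *\<^sub>R Y t) s = deriv u s *\<^sub>R Y s + u s *\<^sub>R ?D Y s"
    unfolding frD(12)[OF I(2)[OF s] Yt, symmetric] .
next
  note frD = coord_frameD[OF fr]
  fix F X s assume F: "F \<in> XM" and X: "X \<in> XM" and s: "s \<in> I"
    and Xs: "X (h s) = velocity M h s"
  have "deriv (\<lambda>t. F (h t) (\<lambda>q. x q \<bullet> b)) s = X (h s) (\<lambda>q. F q (\<lambda>q. x q \<bullet> b))" for b
    using DERIV_imp_deriv[OF dh[OF s smooth_fieldsD(2)[OF F frD(6)]]] Xs by simp
  moreover have "X (h s) (\<lambda>q. x q \<bullet> c) = w s \<bullet> c" if "c \<in> Basis" for c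
    unfolding Xs vel[OF s] by (rule frame_comb[OF fr I(2)[OF s] that])
  ultimately show "?D (\<lambda>t. F (h t)) s = nabla X F (h s)"
    unfolding nabla_frame[OF fr I(2)[OF s] X F] by simp
qed

text \<open>For the last conclusion, B(h', h') is written as a quadratic expression in the velocity
  components w. Differentiating its coefficients gives X(B(X, X)), and differentiating w gives twice
  B(w', w), where w' = - nabla X X at p by the geodesic equation.\<close>

lemma geodesic_exists:
  assumes v: "v \<in> TM p"
  obtains X h e where "X \<in> XM" "X p = v" "0 < (e::real)" "h 0 = p"
    "geodesic_on M nabla {-e<..<e} h" "velocity M h 0 = v"
    "\<And>t. t \<in> {-e<..<e} \<Longrightarrow> velocity M h t \<in> TM (h t)"
    "\<And>a. a \<in> CM \<Longrightarrow> ((\<lambda>t. a (h t)) has_real_derivative v a) (at 0)"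
    "\<And>B. symmetric_form M B \<Longrightarrow> ((\<lambda>t. B (h t) (velocity M h t) (velocity M h t)) has_real_derivative
       X p (\<lambda>q. B q (X q) (X q)) - 2 * B p (nabla X X p) v) (at 0)"
proof -
  obtain W x K E where p: "p \<in> W" and fr: "coord_frame W x K E" by (rule coord_frame_exists)
  note frD = coord_frameD[OF fr]
  define w0 where "w0 = (\<Sum>b\<in>Basis. v (\<lambda>q. x q \<bullet> b) *\<^sub>R b)"
  have w0: "w0 \<bullet> b = v (\<lambda>q. x q \<bullet> b)" if "b \<in> Basis" for b
    using that by (simp only: w0_def inner_sum_left_Basis)
  obtain e h w where e: "0 < (e::real)" and h0: "h 0 = p" "w 0 = w0" and sw: "smooth_on {-e<..<e} w"
    and hW: "\<And>t. t \<in> {-e<..<e} \<Longrightarrow> h t \<in> W" and smh: "smooth_map_on euclidean_atlas M {-e<..<e} h"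
    and sh: "\<And>a. a \<in> CM \<Longrightarrow> smooth_on {-e<..<e} (\<lambda>t. a (h t))"
    and dh: "\<And>a t. t \<in> {-e<..<e} \<Longrightarrow> a \<in> CM \<Longrightarrow>
      ((\<lambda>t. a (h t)) has_real_derivative (\<Sum>b\<in>Basis. (w t \<bullet> b) *\<^sub>R E b (h t)) a) (at t)"
    and dw: "\<And>k t. t \<in> {-e<..<e} \<Longrightarrow> k \<in> Basis \<Longrightarrow> ((\<lambda>t. w t \<bullet> k) has_real_derivative
      - (\<Sum>b\<in>Basis. \<Sum>c\<in>Basis. (w t \<bullet> b) * (w t \<bullet> c) * nabla (E c) (E b) (h t) (\<lambda>q. x q \<bullet> k))) (at t)"
    by (rule geodesic_coordinates[OF fr p, of w0]) (rule that)
  let ?I = "{-e<..<e}"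
  have z: "0 \<in> ?I" using e by simp
  have Et: "E b q \<in> TM q" "nabla (E c) (E b) q \<in> TM q" for b c q
    by (rule smooth_fieldsD(1)[OF frD(9)], rule nabla_tangent[OF frD(9) frD(9)])
  have Vt: "(\<Sum>b\<in>Basis. u b *\<^sub>R E b q) \<in> TM q" for u q
    by (intro tangent_closed Et)
  have vel: "velocity M h t = (\<Sum>b\<in>Basis. (w t \<bullet> b) *\<^sub>R E b (h t))" if "t \<in> ?I" for t
  proof
    fix a
    show "velocity M h t a = (\<Sum>b\<in>Basis. (w t \<bullet> b) *\<^sub>R E b (h t)) a"
      using DERIV_imp_deriv[OF dh[OF that, of a]] tangent_junk[OF Vt, of a]
      by (cases "a \<in> CM") (simp_all add: velocity_def o_def)
  qed
  have dh': "((\<lambda>t. a (h t)) has_real_derivative velocity M h t a) (at t)"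
    if "t \<in> ?I" "a \<in> CM" for a t
    using dh[OF that] vel[OF that(1)] by simp
  have velx: "velocity M h t (\<lambda>q. x q \<bullet> b) = w t \<bullet> b" if "t \<in> ?I" "b \<in> Basis" for t b
    unfolding vel[OF that(1)] by (rule frame_comb[OF fr hW[OF that(1)] that(2)])
  define w' where "w' t k = - (\<Sum>b\<in>Basis. \<Sum>c\<in>Basis. (w t \<bullet> b) * (w t \<bullet> c) * nabla (E c) (E b) (h t) (\<lambda>q. x q \<bullet> k))"
    for t k
  note dw = dw[folded w'_def]
  let ?D = "\<lambda>Y s. (\<Sum>b\<in>Basis. deriv (\<lambda>t. Y t (\<lambda>q. x q \<bullet> b)) s *\<^sub>R E b (h s))
    + (\<Sum>b\<in>Basis. \<Sum>c\<in>Basis. (Y s (\<lambda>q. x q \<bullet> b) * (w s \<bullet> c)) *\<^sub>R nabla (E c) (E b) (h s))"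
  have D: "cov_deriv_along M nabla ?I h ?D"
    by (rule cov_deriv_along_coordinates[OF fr _ hW sw sh dh' vel]) auto
  \<comment> \<open>In each frame component the derivative of w cancels against the Christoffel sum;
    this is the differential equation solved above.\<close>
  have D0: "?D (velocity M h) s = 0" if s: "s \<in> ?I" for s
  proof (rule frame_eqI[OF fr hW[OF s]])
    show "?D (velocity M h) s \<in> TM (h s)" by (intro tangent_closed Et)
    show "0 \<in> TM (h s)" by (rule tangent_closed)
    fix k :: 'e assume k: "k \<in> Basis"
    have "((\<lambda>t. velocity M h t (\<lambda>q. x q \<bullet> k)) has_real_derivative w' s k) (at s)"
      by (rule has_field_derivative_transform_within_open[OF dw[OF s k] _ s]) (use velx k in auto)
    then have "deriv (\<lambda>t. velocity M h t (\<lambda>q. x q \<bullet> k)) s = w' s k" by (rule DERIV_imp_deriv)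
    moreover have "(\<Sum>b\<in>Basis. \<Sum>c\<in>Basis. (velocity M h s (\<lambda>q. x q \<bullet> b) * (w s \<bullet> c)) *\<^sub>R nabla (E c) (E b) (h s))
        (\<lambda>q. x q \<bullet> k) = - w' s k"
      unfolding w'_def using velx[OF s] by (simp add: sum_fun_apply)
    ultimately show "?D (velocity M h) s (\<lambda>q. x q \<bullet> k) = 0 (\<lambda>q. x q \<bullet> k)"
      using frame_comb[OF fr hW[OF s] k, of "\<lambda>b. deriv (\<lambda>t. velocity M h t (\<lambda>q. x q \<bullet> b)) s"] by simp
  qed
  have geo: "geodesic_on M nabla ?I h"
    unfolding geodesic_on_def using smh D D0 by (auto simp: is_interval_1)
  have v0: "v = (\<Sum>b\<in>Basis. (w 0 \<bullet> b) *\<^sub>R E b p)"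
    using frD(12)[OF p v] w0 h0 by simp
  \<comment> \<open>Constant coefficients in the frame, so that \<open>nabla X X\<close> at p
    consists of the Christoffel terms only and equals minus the derivative of w.\<close>
  define X where "X = (\<Sum>b\<in>Basis. (w 0 \<bullet> b) *\<^sub>R E b)"
  have X: "X \<in> XM" unfolding X_def by (intro smooth_fields_sum smooth_fields_scaleR frD(9))
  have Xq: "X q = (\<Sum>b\<in>Basis. (w 0 \<bullet> b) *\<^sub>R E b q)" for q by (simp add: X_def sum_fun_apply)
  have NX: "nabla X X p = (\<Sum>k\<in>Basis. (- w' 0 k) *\<^sub>R E k p)"
  proof -
    have "nabla X X p (\<lambda>q. x q \<bullet> k) = - w' 0 k" for k
    proof -
      have "nabla X X = (\<Sum>b\<in>Basis. \<Sum>c\<in>Basis. ((w 0 \<bullet> b) * (w 0 \<bullet> c)) *\<^sub>R nabla (E c) (E b))"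
        unfolding X_def nabla_sum_right[OF smooth_fields_scaleR[OF frD(9)] X[unfolded X_def]]
          nabla_scaleR_right[OF X[unfolded X_def] frD(9)]
          nabla_sum_left[OF smooth_fields_scaleR[OF frD(9)] frD(9)] nabla_scaleR_left[OF frD(9) frD(9)]
        by (simp add: scaleR_sum_right)
      then show ?thesis unfolding w'_def h0(1) by (simp add: sum_fun_apply)
    qed
    then show ?thesis using frD(12)[OF p nabla_tangent[OF X X, of p]] by simp
  qed
  show ?thesis
  proof (rule that[of X e h])
    show "X p = v" unfolding Xq v0[symmetric] ..
    show "velocity M h 0 = v" using vel[OF z] v0 h0 by simp
    then show "((\<lambda>t. a (h t)) has_real_derivative v a) (at 0)" if "a \<in> CM" for a
      using dh'[OF z that] by simp
    show "velocity M h t \<in> TM (h t)" if "t \<in> ?I" for t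
      unfolding vel[OF that] by (rule Vt)
    fix B assume B: "symmetric_form M B"
    let ?B = "\<lambda>b c q. B q (E b q) (E c q)"
    have sB: "?B b c \<in> CM" for b c by (rule form_smooth[OF B frD(9) frD(9)])
    have BB: "B q (\<Sum>b\<in>Basis. u b *\<^sub>R E b q) (\<Sum>b\<in>Basis. u' b *\<^sub>R E b q)
        = (\<Sum>b\<in>Basis. \<Sum>c\<in>Basis. u b * u' c * ?B b c q)" for u u' q
      unfolding form_sum_left[OF B Vt Et(1)] form_sum_right[OF B Et(1) Et(1)]
      by (simp add: sum_distrib_left mult.assoc)
    let ?g = "\<lambda>t. \<Sum>b\<in>Basis. \<Sum>c\<in>Basis. (w t \<bullet> b) * (w t \<bullet> c) * ?B b c (h t)"
    have "(?g has_real_derivative (\<Sum>b\<in>Basis. \<Sum>c\<in>Basis.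
        (w' 0 b * (w 0 \<bullet> c) + w' 0 c * (w 0 \<bullet> b)) * ?B b c (h 0) + velocity M h 0 (?B b c) * ((w 0 \<bullet> b) * (w 0 \<bullet> c)))) (at 0)"
      by (intro DERIV_sum DERIV_mult dw[OF z] dh'[OF z sB])
    then have "((\<lambda>t. B (h t) (velocity M h t) (velocity M h t)) has_real_derivative (\<Sum>b\<in>Basis. \<Sum>c\<in>Basis.
        (w' 0 b * (w 0 \<bullet> c) + w' 0 c * (w 0 \<bullet> b)) * ?B b c (h 0) + velocity M h 0 (?B b c) * ((w 0 \<bullet> b) * (w 0 \<bullet> c)))) (at 0)"
      by (rule has_field_derivative_transform_within_open[OF _ _ z]) (simp_all add: vel BB)
    moreover have "X p (\<lambda>q. B q (X q) (X q)) = (\<Sum>b\<in>Basis. \<Sum>c\<in>Basis. (w 0 \<bullet> b) * (w 0 \<bullet> c) * v (?B b c))"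
    proof -
      have "(\<lambda>q. B q (X q) (X q)) = (\<lambda>q. \<Sum>b\<in>Basis. \<Sum>c\<in>Basis. (w 0 \<bullet> b) * (w 0 \<bullet> c) * ?B b c q)"
        unfolding Xq BB ..
      moreover have "v (\<lambda>q. \<Sum>b\<in>Basis. \<Sum>c\<in>Basis. (w 0 \<bullet> b) * (w 0 \<bullet> c) * ?B b c q)
          = (\<Sum>b\<in>Basis. v (\<lambda>q. \<Sum>c\<in>Basis. (w 0 \<bullet> b) * (w 0 \<bullet> c) * ?B b c q))"
        by (rule tangent_sum[OF v]) (intro smooth_functions_sum smooth_functions_cmult sB)
      moreover have "... = (\<Sum>b\<in>Basis. \<Sum>c\<in>Basis. v (\<lambda>q. (w 0 \<bullet> b) * (w 0 \<bullet> c) * ?B b c q))"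
        by (intro sum.cong refl tangent_sum[OF v] smooth_functions_cmult sB)
      moreover have "... = (\<Sum>b\<in>Basis. \<Sum>c\<in>Basis. (w 0 \<bullet> b) * (w 0 \<bullet> c) * v (?B b c))"
        by (intro sum.cong refl tangent_cmult[OF v sB])
      ultimately show ?thesis using \<open>X p = v\<close> by simp
    qed
    moreover have "B p (nabla X X p) v = - (\<Sum>b\<in>Basis. \<Sum>c\<in>Basis. w' 0 b * (w 0 \<bullet> c) * ?B b c p)"
      unfolding NX by (subst v0, subst BB) (simp add: sum_negf)
    \<comment> \<open>The product rule differentiates either velocity factor; symmetry of B makes
      the two contributions equal, whence the coefficient 2.\<close>
    moreover have "(\<Sum>b\<in>Basis. \<Sum>c\<in>Basis. w' 0 c * (w 0 \<bullet> b) * ?B b c p)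
        = (\<Sum>b\<in>Basis. \<Sum>c\<in>Basis. w' 0 b * (w 0 \<bullet> c) * ?B b c p)"
      by (subst sum.swap) (simp only: form_commute[OF B Et(1) Et(1)])
    ultimately show "((\<lambda>t. B (h t) (velocity M h t) (velocity M h t)) has_real_derivative
       X p (\<lambda>q. B q (X q) (X q)) - 2 * B p (nabla X X p) v) (at 0)"
      using h0 \<open>velocity M h 0 = v\<close>
      by (simp add: distrib_right distrib_left sum.distrib mult.commute mult.left_commute add.commute)
  qed (use X e h0 geo in auto)
qed

end

section \<open>Gradients and orthogonal projections\<close>

lemma (in manifold) smooth_field_through:
  assumes "v \<in> TM p"
  obtains E where "E \<in> XM" "E p = v"
proof -
  obtain W x K E where p: "p \<in> W" and fr: "coord_frame W x K E" by (rule coord_frame_exists)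
  note frD = coord_frameD[OF fr]
  have "(\<Sum>b\<in>Basis. v (\<lambda>q. x q \<bullet> b) *\<^sub>R E b) \<in> XM"
    by (intro smooth_fields_sum smooth_fields_scaleR frD(9))
  then show ?thesis
    by (rule that) (use frD(12)[OF p assms] in \<open>simp add: sum_fun_apply\<close>)
qed

locale riemannian_manifold = manifold M
  for M :: "('m::{t2_space, second_countable_topology}, 'e::euclidean_space) chart set" +
  fixes g :: "'m metric"
  assumes metric: "riemannian_metric M g"
begin

lemma g_form: "symmetric_form M g"
  using metric by (simp add: riemannian_metric_def symmetric_form_def)

lemma g_pos: "v \<in> TM p \<Longrightarrow> v \<noteq> 0 \<Longrightarrow> 0 < g p v v"
  using metric by (simp add: riemannian_metric_def)

lemmas g_commute = form_commute[OF g_form]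
  and g_add_right = form_add_right[OF g_form] and g_add_left = form_add_left[OF g_form]
  and g_scaleR_right = form_scaleR_right[OF g_form] and g_scaleR_left = form_scaleR_left[OF g_form]
  and g_zero_right = form_zero_right[OF g_form] and g_zero_left = form_zero_left[OF g_form]
  and g_sum_right = form_sum_right[OF g_form] and g_sum_left = form_sum_left[OF g_form]
  and g_smooth = form_smooth[OF g_form]

lemma g_diff_right:
  "u \<in> TM p \<Longrightarrow> v \<in> TM p \<Longrightarrow> w \<in> TM p \<Longrightarrow>
    g p u (v - w) = g p u v - g p u w"
  using form_comb_right[OF g_form, of u p v w 1 "-1"] by simp

lemma g_diff_left:
  "u \<in> TM p \<Longrightarrow> v \<in> TM p \<Longrightarrow> w \<in> TM p \<Longrightarrow>
    g p (v - w) u = g p v u - g p w u"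
  using g_diff_right[of u p v w] g_commute[of u p] tangent_closed(4) by metis

lemma g_minus_right:
  "u \<in> TM p \<Longrightarrow> v \<in> TM p \<Longrightarrow> g p u (- v) = - g p u v"
  using g_scaleR_right[of u p v "-1"] by simp

lemma g_minus_left:
  "u \<in> TM p \<Longrightarrow> v \<in> TM p \<Longrightarrow> g p (- v) u = - g p v u"
  using g_scaleR_left[of u p v "-1"] by simp

lemma g_nonneg: "v \<in> TM p \<Longrightarrow> 0 \<le> g p v v"
  using g_pos[of v p] g_zero_right[of v p] by (cases "v = 0") (auto simp: less_imp_le)

lemma g_eq_0_iff: "v \<in> TM p \<Longrightarrow> g p v v = 0 \<longleftrightarrow> v = 0"
  using g_pos[of v p] g_zero_right[of v p] by (cases "v = 0") auto

lemma g_nondegenerate: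
  "v \<in> TM p \<Longrightarrow> w \<in> TM p \<Longrightarrow>
    (\<And>u. u \<in> TM p \<Longrightarrow> g p v u = g p w u) \<Longrightarrow> v = w"
  using g_eq_0_iff[of "v - w" p] g_diff_left[of "v - w" p v w] tangent_closed(4)[of v p w] by simp

lemma subspace_orth: "u \<in> TM p \<Longrightarrow> subspace {w \<in> TM p. g p u w = 0}"
  unfolding subspace_def by (simp add: tangent_closed g_zero_right g_add_right g_scaleR_right)

lemma orth_span:
  assumes "u \<in> TM p" "S \<subseteq> TM p" "\<And>w. w \<in> S \<Longrightarrow> g p u w = 0" "w \<in> span S"
  shows "g p u w = 0"
  using span_minimal[OF _ subspace_orth[OF assms(1)], of S] assms by blast

text \<open>The functions \<open>\<nu> i\<close> are the reciprocals of the squared lengths, so that no square roots occur.\<close>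

definition orthogonal_fields ::
    "'i set \<Rightarrow> 'm set \<Rightarrow> ('i \<Rightarrow> 'm vfield) \<Rightarrow> ('i \<Rightarrow> 'm \<Rightarrow> real) \<Rightarrow> bool" where
  "orthogonal_fields A U G \<nu> \<longleftrightarrow> finite A \<and> open U \<and>
    (\<forall>i\<in>A. G i \<in> XM \<and> \<nu> i \<in> CM) \<and>
    (\<forall>q\<in>U. \<forall>i\<in>A. \<nu> i q * g q (G i q) (G i q) = 1 \<and> (\<forall>j\<in>A. i \<noteq> j \<longrightarrow> g q (G i q) (G j q) = 0))"

definition orth_proj :: "'i set \<Rightarrow> ('i \<Rightarrow> 'm vfield) \<Rightarrow> ('i \<Rightarrow> 'm \<Rightarrow> real) \<Rightarrow> 'm vfield \<Rightarrow> 'm vfield" where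
  "orth_proj A G \<nu> E = (\<Sum>i\<in>A. fscale (\<lambda>q. \<nu> i q * g q (G i q) (E q)) (G i))"

lemma orth_proj_apply:
  "orth_proj A G \<nu> E q = (\<Sum>i\<in>A. (\<nu> i q * g q (G i q) (E q)) *\<^sub>R G i q)"
  by (simp add: orth_proj_def sum_fun_apply fscale_def)

lemma orth_proj:
  assumes G: "orthogonal_fields A U G \<nu>"
  shows "E \<in> XM \<Longrightarrow> orth_proj A G \<nu> E \<in> XM"
    and "orth_proj A G \<nu> E q \<in> span ((\<lambda>i. G i q) ` A)"
    and "E q \<in> TM q \<Longrightarrow> q \<in> U \<Longrightarrow> i \<in> A \<Longrightarrow> g q (G i q) (E q - orth_proj A G \<nu> E q) = 0"
proof -
  have s: "G i \<in> XM" "\<nu> i \<in> CM" if "i \<in> A" for i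
    using G that unfolding orthogonal_fields_def by blast+
  have t: "G i q \<in> TM q" if "i \<in> A" for i q using smooth_fieldsD(1)[OF s(1)[OF that]] .
  show "orth_proj A G \<nu> E \<in> XM" if E: "E \<in> XM"
    unfolding orth_proj_def
    by (rule smooth_fields_sum) (intro smooth_fields_fscale smooth_functions_mult s g_smooth E)
  show "orth_proj A G \<nu> E q \<in> span ((\<lambda>i. G i q) ` A)"
    unfolding orth_proj_apply by (intro span_sum span_scale span_base imageI)
  assume E: "E q \<in> TM q" and q: "q \<in> U" and i: "i \<in> A"
  have fin: "finite A" using G unfolding orthogonal_fields_def by blast
  have o: "\<nu> i q * g q (G i q) (G i q) = 1" "\<And>j. j \<in> A \<Longrightarrow> i \<noteq> j \<Longrightarrow> g q (G i q) (G j q) = 0"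
    using G q i unfolding orthogonal_fields_def by blast+
  have pt: "orth_proj A G \<nu> E q \<in> TM q"
    unfolding orth_proj_apply by (intro tangent_closed t)
  have "g q (G i q) (orth_proj A G \<nu> E q) = (\<Sum>j\<in>A. (\<nu> j q * g q (G j q) (E q)) * g q (G i q) (G j q))"
    unfolding orth_proj_apply by (rule g_sum_right[OF t[OF i] t])
  also have "... = (\<Sum>j\<in>A. if i = j then g q (G i q) (E q) else 0)"
  proof (rule sum.cong[OF refl])
    fix j assume j: "j \<in> A"
    have "(\<nu> i q * g q (G i q) (E q)) * g q (G i q) (G i q) = (\<nu> i q * g q (G i q) (G i q)) * g q (G i q) (E q)"
      by simp
    then show "(\<nu> j q * g q (G j q) (E q)) * g q (G i q) (G j q) = (if i = j then g q (G i q) (E q) else 0)"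
      using o j by auto
  qed
  also have "... = g q (G i q) (E q)" using fin i by simp
  finally show "g q (G i q) (E q - orth_proj A G \<nu> E q) = 0"
    by (simp add: g_diff_right[OF t[OF i] E pt])
qed

text \<open>Independence is required at p only. The span relations hold at every point because each
  step subtracts a combination of earlier fields; orthogonality and the reciprocal lengths are
  obtained on a neighbourhood of p.\<close>

lemma gram_schmidt:
  assumes "finite A" "\<And>i. i \<in> A \<Longrightarrow> F i \<in> XM"
    and "\<And>i. i \<in> A \<Longrightarrow> F i p \<notin> span ((\<lambda>j. F j p) ` (A - {i}))"
  shows "\<exists>U G \<nu>. p \<in> U \<and> orthogonal_fields A U G \<nu> \<and>
    (\<forall>q. \<forall>i\<in>A. G i q \<in> span ((\<lambda>j. F j q) ` A) \<and> F i q \<in> span ((\<lambda>j. G j q) ` A))"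
  using assms
proof (induction A rule: finite_induct)
  case empty
  show ?case
    by (intro exI[of _ UNIV]) (simp add: orthogonal_fields_def)
next
  case (insert x A)
  have "\<exists>U G \<nu>. p \<in> U \<and> orthogonal_fields A U G \<nu> \<and>
    (\<forall>q. \<forall>i\<in>A. G i q \<in> span ((\<lambda>j. F j q) ` A) \<and> F i q \<in> span ((\<lambda>j. G j q) ` A))"
  proof (rule insert.IH)
    fix i assume i: "i \<in> A"
    have "(\<lambda>j. F j p) ` (A - {i}) \<subseteq> (\<lambda>j. F j p) ` (insert x A - {i})" by blast
    from span_mono[OF this] show "F i p \<notin> span ((\<lambda>j. F j p) ` (A - {i}))"
      using insert.prems(2)[of i] i by blast
  qed (use insert.prems(1) in simp)
  then obtain U G \<nu> where p: "p \<in> U" and G: "orthogonal_fields A U G \<nu>"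
    and GF: "\<And>q i. i \<in> A \<Longrightarrow> G i q \<in> span ((\<lambda>j. F j q) ` A)"
    and FG: "\<And>q i. i \<in> A \<Longrightarrow> F i q \<in> span ((\<lambda>j. G j q) ` A)" by blast
  have Fx: "F x \<in> XM" using insert.prems(1) by simp
  define H where "H = F x - orth_proj A G \<nu> (F x)"
  have H: "H \<in> XM"
    unfolding H_def by (intro smooth_fields_diff Fx orth_proj(1)[OF G])
  have FH: "F x q = H q + orth_proj A G \<nu> (F x) q" for q by (simp add: H_def)
  have sub: "span ((\<lambda>j. G j q) ` A) \<subseteq> span ((\<lambda>j. F j q) ` A)" for q
    by (rule span_minimal) (use GF in auto)
  have "H p \<noteq> 0"
  proof
    assume "H p = 0"
    then have "F x p \<in> span ((\<lambda>j. F j p) ` A)"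
      using orth_proj(2)[OF G, of "F x" p] sub[of p] FH[of p] by auto
    moreover have "insert x A - {x} = A" using insert.hyps(2) by blast
    ultimately show False using insert.prems(2)[of x] by simp
  qed
  then have "g p (H p) (H p) \<noteq> 0" using g_pos[OF smooth_fieldsD(1)[OF H]] by (metis less_irrefl)
  \<comment> \<open>The new field is nonzero at p, so a reciprocal of its squared length exists near
    p; this is why the neighbourhood shrinks at each step.\<close>
  then obtain n V where n: "n \<in> CM" "open V" "p \<in> V"
    "\<And>q. q \<in> V \<Longrightarrow> g q (H q) (H q) \<noteq> 0 \<and> n q = inverse (g q (H q) (H q))"
    by (rule smooth_local_inverse[OF g_smooth[OF H H]]) (rule that)
  let ?G = "G(x := H)" and ?\<nu> = "\<nu>(x := n)"
  have x: "i \<noteq> x" if "i \<in> A" for i using that insert.hyps(2) by blast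
  have im: "(\<lambda>j. ?G j q) ` insert x A = insert (H q) ((\<lambda>j. G j q) ` A)" for q
    using x by (auto simp: image_iff)
  show ?case
  proof (intro exI[of _ "U \<inter> V"] exI[of _ ?G] exI[of _ ?\<nu>] conjI allI ballI)
    show "p \<in> U \<inter> V" using p n(3) by blast
    have o: "g q (G i q) (H q) = 0" "g q (H q) (G i q) = 0" if "q \<in> U" "i \<in> A" for q i
    proof -
      show "g q (G i q) (H q) = 0"
        using orth_proj(3)[where E="F x", OF G smooth_fieldsD(1)[OF Fx] that] by (simp add: H_def)
      moreover have "G i \<in> XM" using G that(2) unfolding orthogonal_fields_def by blast
      ultimately show "g q (H q) (G i q) = 0"
        using g_commute[OF smooth_fieldsD(1)[OF H] smooth_fieldsD(1)] by metis
    qed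
    show "orthogonal_fields (insert x A) (U \<inter> V) ?G ?\<nu>"
      using G n H x o insert.hyps unfolding orthogonal_fields_def by auto
    fix q i assume i: "i \<in> insert x A"
    have Fm: "span ((\<lambda>j. F j q) ` A) \<subseteq> span ((\<lambda>j. F j q) ` insert x A)" by (rule span_mono) blast
    have Gm: "span ((\<lambda>j. G j q) ` A) \<subseteq> span ((\<lambda>j. ?G j q) ` insert x A)"
      unfolding im by (rule span_mono) blast
    have pr: "orth_proj A G \<nu> (F x) q \<in> span ((\<lambda>j. G j q) ` A)" by (rule orth_proj(2)[OF G])
    have "F x q \<in> span ((\<lambda>j. F j q) ` insert x A)" by (rule span_base) simp
    moreover have "orth_proj A G \<nu> (F x) q \<in> span ((\<lambda>j. F j q) ` insert x A)" using pr sub Fm by blast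
    ultimately have "H q \<in> span ((\<lambda>j. F j q) ` insert x A)"
      unfolding H_def by (simp add: span_diff)
    then show "?G i q \<in> span ((\<lambda>j. F j q) ` insert x A)"
    proof (cases "i = x")
      case False
      then have "G i q \<in> span ((\<lambda>j. F j q) ` A)" using i GF by simp
      then show ?thesis using Fm False by (simp add: subsetD)
    qed simp
    have "H q \<in> span ((\<lambda>j. ?G j q) ` insert x A)" unfolding im by (rule span_base) simp
    moreover have "orth_proj A G \<nu> (F x) q \<in> span ((\<lambda>j. ?G j q) ` insert x A)" using pr Gm by blast
    ultimately have "F x q \<in> span ((\<lambda>j. ?G j q) ` insert x A)"
      unfolding FH[of q] by (rule span_add)
    then show "F i q \<in> span ((\<lambda>j. ?G j q) ` insert x A)"
    proof (cases "i = x")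
      case False
      then have "F i q \<in> span ((\<lambda>j. G j q) ` A)" using i FG by simp
      then show ?thesis using Gm by (rule subsetD[rotated])
    qed simp
  qed
qed

text \<open>In an orthogonal frame the gradient has the explicit form: sum of \<open>\<nu> i\<close>
  times G_i(a) times G_i, visibly smooth.\<close>

lemma local_gradient:
  assumes a: "a \<in> CM"
  shows "\<exists>W Y. open W \<and> p \<in> W \<and> Y \<in> XM \<and>
    (\<forall>q\<in>W. \<forall>w\<in>TM q. g q (Y q) w = w a)"
proof -
  obtain W x K E where p: "p \<in> W" and fr: "coord_frame W x K E" by (rule coord_frame_exists)
  note frD = coord_frameD[OF fr]
  have Et: "E b q \<in> TM q" for b q by (rule smooth_fieldsD(1)[OF frD(9)])
  have ind: "E b p \<notin> span ((\<lambda>c. E c p) ` (Basis - {b}))" if b: "b \<in> Basis" for b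
  proof
    \<comment> \<open>The b-th coordinate function separates \<open>E b\<close> from the other frame
      vectors: it is killed by those and not by \<open>E b\<close>.\<close>
    have sp: "subspace {w :: 'm tvec. w (\<lambda>q. x q \<bullet> b) = 0}" by (simp add: subspace_def)
    have "span ((\<lambda>c. E c p) ` (Basis - {b})) \<subseteq> {w. w (\<lambda>q. x q \<bullet> b) = 0}"
      by (rule span_minimal[OF _ sp]) (use b in \<open>auto simp: frD(11)[OF p] inner_Basis\<close>)
    moreover assume "E b p \<in> span ((\<lambda>c. E c p) ` (Basis - {b}))"
    ultimately have "E b p (\<lambda>q. x q \<bullet> b) = 0" by blast
    then show False using b by (simp add: frD(11)[OF p])
  qed
  obtain U and G :: "'e \<Rightarrow> 'm vfield" and \<nu> where U: "p \<in> U" and G: "orthogonal_fields Basis U G \<nu>"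
    and EG: "\<And>q i. i \<in> Basis \<Longrightarrow> E i q \<in> span ((\<lambda>j. G j q) ` Basis)"
    using gram_schmidt[OF finite_Basis frD(9) ind] by blast
  have Gs: "G i \<in> XM" "\<nu> i \<in> CM" if "i \<in> Basis" for i
    using G that unfolding orthogonal_fields_def by blast+
  have Gt: "G i q \<in> TM q" if "i \<in> Basis" for i q using smooth_fieldsD(1)[OF Gs(1)[OF that]] .
  let ?Y = "\<Sum>i\<in>Basis. fscale (\<lambda>q. \<nu> i q * G i q a) (G i)"
  have "?Y \<in> XM"
    by (rule smooth_fields_sum, rule smooth_fields_fscale)
      (simp_all add: smooth_functions_mult smooth_fieldsD(2)[OF Gs(1) a] Gs)
  moreover have "g q (?Y q) w = w a" if q: "q \<in> U \<inter> W" and w: "w \<in> TM q" for q w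
  proof -
    obtain Z where Z: "Z \<in> XM" "Z q = w" by (rule smooth_field_through[OF w])
    let ?d = "w - orth_proj Basis G \<nu> Z q"
    have d: "?d \<in> TM q"
      by (intro tangent_closed w smooth_fieldsD(1)[OF orth_proj(1)[OF G Z(1)]])
    have dG: "g q ?d (G i q) = 0" if "i \<in> Basis" for i
      using orth_proj(3)[OF G _ _ that, of Z q] Z w q g_commute[OF d Gt[OF that]] by simp
    have dE: "g q ?d (E i q) = 0" if "i \<in> Basis" for i
      by (rule orth_span[OF d _ _ EG[OF that]]) (use dG Gt in auto)
    have qW: "q \<in> W" using q by blast
    \<comment> \<open>The remainder of the projection is orthogonal to every coordinate field, and
      expanding one argument in these fields shows that it is orthogonal to itself.\<close>
    have "g q ?d ?d = (\<Sum>b\<in>Basis. ?d (\<lambda>q. x q \<bullet> b) * g q ?d (E b q))"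
      by (subst (2) frD(12)[OF qW d]) (rule g_sum_right[OF d Et])
    then have "?d = 0" using dE g_eq_0_iff[OF d] by simp
    then have "w a = orth_proj Basis G \<nu> Z q a" by simp
    also have "... = (\<Sum>i\<in>Basis. (\<nu> i q * G i q a) * g q (G i q) w)"
      by (simp add: orth_proj_apply sum_fun_apply Z(2) mult_ac)
    also have "... = g q (?Y q) w"
      by (simp add: sum_fun_apply fscale_def g_sum_left[OF w Gt])
    finally show ?thesis by simp
  qed
  moreover have "open (U \<inter> W)" using G frD(1) unfolding orthogonal_fields_def by blast
  ultimately show ?thesis using p U by blast
qed

text \<open>\<open>grad\<close> is a definite description at each point: nondegeneracy gives
  uniqueness, the local gradients give existence, and agreement with them gives smoothness.\<close>

lemma grad:
  assumes "a \<in> CM"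
  shows "grad M g a \<in> XM" and "w \<in> TM p \<Longrightarrow> g p (grad M g a p) w = w a"
proof -
  have eq: "grad M g a q = v" if v: "v \<in> TM q" "\<forall>w\<in>TM q. g q v w = w a" for q v
    unfolding grad_def
  proof (rule the_equality)
    fix u assume "u \<in> TM q \<and> (\<forall>w\<in>TM q. g q u w = w a)"
    then show "u = v" using v by (intro g_nondegenerate[of u q v]) auto
  qed (use v in simp)
  have loc: "\<exists>W F. open W \<and> p \<in> W \<and> F \<in> XM \<and> (\<forall>q\<in>W. grad M g a q = F q \<and>
    (\<forall>w\<in>TM q. g q (F q) w = w a))" for p
  proof -
    obtain W Y where W: "open W" "p \<in> W" "Y \<in> XM"
      "\<forall>q\<in>W. \<forall>w\<in>TM q. g q (Y q) w = w a" using local_gradient[OF assms] by blast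
    have "grad M g a q = Y q" if "q \<in> W" for q
      by (rule eq[OF smooth_fieldsD(1)[OF W(3)]]) (use W(4) that in blast)
    then show ?thesis using W by (intro exI[of _ W] exI[of _ Y]) simp
  qed
  show "grad M g a \<in> XM"
  proof (rule smooth_fields_local)
    fix p
    obtain W F where "open W" "p \<in> W" "F \<in> XM" "\<forall>q\<in>W. grad M g a q = F q"
      using loc[of p] by auto
    then show "\<exists>W F. open W \<and> p \<in> W \<and> F \<in> XM \<and> (\<forall>q\<in>W. grad M g a q = F q)"
      by (intro exI[of _ W] exI[of _ F]) simp
  qed
  show "g p (grad M g a p) w = w a" if "w \<in> TM p"
    using loc[of p] that by auto
qed

end

section \<open>Vertical and horizontal projections\<close>

locale submersion = riemannian_manifold M g + N: manifold N
  for M :: "('m::{t2_space, second_countable_topology}, 'e::euclidean_space) chart set"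
    and g :: "'m metric"
    and N :: "('n::{t2_space, second_countable_topology}, 'f::euclidean_space) chart set" +
  fixes \<pi> :: "'m \<Rightarrow> 'n"
  assumes smooth_proj: "smooth_map_on M N UNIV \<pi>"
    and differential_onto: "\<And>p. differential N \<pi> ` TM p = tangent_space N (\<pi> p)"
begin

abbreviation Ver :: "'m \<Rightarrow> 'm tvec set" where "Ver \<equiv> ker_space M N \<pi>"
abbreviation Hor :: "'m \<Rightarrow> 'm tvec set" where "Hor \<equiv> hor_space M g N \<pi>"
abbreviation vproj :: "'m endo" where "vproj \<equiv> ver M g N \<pi>"
abbreviation hproj :: "'m endo" where "hproj \<equiv> hor M g N \<pi>"

lemma continuous_proj: "continuous_on UNIV \<pi>"
  using smooth_proj by (simp add: smooth_map_on_def)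

lemma open_proj_vimage: "open S \<Longrightarrow> open (\<pi> -` S)"
  by (rule open_vimage[OF _ continuous_proj])

lemma pullback_smooth:
  assumes a: "a \<in> smooth_functions N"
  shows "(\<lambda>q. a (\<pi> q)) \<in> CM"
proof (rule smooth_functionsI_charts)
  fix p
  obtain U \<kappa> where U: "(U, \<kappa>) \<in> M" "p \<in> U" by (rule chart_at)
  obtain V \<psi> where V: "(V, \<psi>) \<in> N" "\<pi> p \<in> V" by (rule N.chart_at)
  let ?W = "U \<inter> \<pi> -` V"
  have o: "open ?W" using chart(1)[OF U(1)] open_proj_vimage[OF N.chart(1)[OF V(1)]] by blast
  have ok: "open (\<kappa> ` ?W)" by (rule open_chart_image[OF U(1) o]) simp
  have "smooth_on (\<kappa> ` ?W) (\<lambda>y. \<psi> (\<pi> (inv_into U \<kappa> y)))"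
    using smooth_proj U(1) V(1) by (fastforce simp: smooth_map_on_def o_def)
  moreover have "(\<lambda>y. \<psi> (\<pi> (inv_into U \<kappa> y))) ` \<kappa> ` ?W \<subseteq> \<psi> ` V"
    using chart(5)[OF U(1)] by auto
  ultimately have "smooth_on (\<kappa> ` ?W) (\<lambda>y. a (inv_into V \<psi> (\<psi> (\<pi> (inv_into U \<kappa> y)))))"
    by (rule smooth_on_compose[OF ok _ N.smooth_in_chart[OF a V(1)]])
  then have "smooth_on (\<kappa> ` ?W) (\<lambda>y. a (\<pi> (inv_into U \<kappa> y)))"
    by (rule smooth_on_cong[OF ok, rotated]) (use chart(5)[OF U(1)] N.chart(5)[OF V(1)] in auto)
  then show "\<exists>U \<kappa> W. (U, \<kappa>) \<in> M \<and> open W \<and> p \<in> W \<and> W \<subseteq> U \<and>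
      smooth_on (\<kappa> ` W) (\<lambda>y. a (\<pi> (inv_into U \<kappa> y)))"
    using U V(2) o by (intro exI[of _ U] exI[of _ \<kappa>] exI[of _ ?W]) simp
qed

lemma differential_apply: "a \<in> smooth_functions N \<Longrightarrow> differential N \<pi> v a = v (\<lambda>q. a (\<pi> q))"
  by (simp add: differential_def o_def)

section \<open>Pointwise algebra of vertical and horizontal vectors\<close>

lemma Ver_iff:
  "v \<in> Ver p \<longleftrightarrow> v \<in> TM p \<and> (\<forall>a\<in>smooth_functions N. v (\<lambda>q. a (\<pi> q)) = 0)"
  by (auto simp: ker_space_def differential_def fun_eq_iff o_def)

lemma Hor_iff: "v \<in> Hor p \<longleftrightarrow> v \<in> TM p \<and> (\<forall>w\<in>Ver p. g p v w = 0)"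
  by (simp add: orth_compl_def)

lemma Ver_tangent: "v \<in> Ver p \<Longrightarrow> v \<in> TM p"
  by (simp add: Ver_iff)

lemma Hor_tangent: "v \<in> Hor p \<Longrightarrow> v \<in> TM p"
  by (simp add: Hor_iff)

lemma Hor_Ver: "v \<in> Hor p \<Longrightarrow> w \<in> Ver p \<Longrightarrow> g p v w = 0"
  by (simp add: Hor_iff)

lemma Ver_Hor: "v \<in> Hor p \<Longrightarrow> w \<in> Ver p \<Longrightarrow> g p w v = 0"
  using Hor_Ver[of v p w] g_commute[of v p w] by (simp add: Ver_tangent Hor_tangent)

lemma Ver_subspace: "subspace (Ver p)"
  unfolding subspace_def by (simp add: Ver_iff tangent_closed)

lemma Hor_subspace: "subspace (Hor p)"
  unfolding subspace_def
  by (simp add: Hor_iff tangent_closed g_zero_left g_add_left g_scaleR_left Ver_tangent)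

lemma Ver_Hor_0: "v \<in> Ver p \<Longrightarrow> v \<in> Hor p \<Longrightarrow> v = 0"
  using Hor_Ver[of v p v] g_eq_0_iff[of v p] by (simp add: Ver_tangent)

text \<open>Near \<open>p\<close> the horizontal spaces are spanned by the gradients of the functions \<open>x \<bullet> b \<circ> \<pi>\<close>, where
  \<open>x\<close> are coordinates near \<open>\<pi> p\<close>; they stay independent because \<open>\<pi>\<close> has maximal rank.\<close>

lemma local_horizontal_part:
  assumes E: "E \<in> XM"
  shows "\<exists>W Y. open W \<and> p \<in> W \<and> Y \<in> XM \<and> (\<forall>q\<in>W. Y q \<in> Hor q \<and> E q - Y q \<in> Ver q)"
proof -
  obtain W' x K C where p: "\<pi> p \<in> W'" and fr: "N.coord_frame W' x K C" by (rule N.coord_frame_exists)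
  note frD = N.coord_frameD[OF fr]
  let ?a = "\<lambda>b q. x (\<pi> q) \<bullet> b"
  let ?F = "\<lambda>b. grad M g (?a b)"
  have a: "?a b \<in> CM" for b using pullback_smooth[OF frD(6)] .
  have F: "?F b \<in> XM" for b by (rule grad(1)[OF a])
  have Ft: "?F b q \<in> TM q" for b q by (rule smooth_fieldsD(1)[OF F])
  have Fg: "g q (?F b q) w = w (?a b)" if "w \<in> TM q" for b q w by (rule grad(2)[OF a that])
  have FH: "?F b q \<in> Hor q" for b q
    unfolding Hor_iff
  proof (intro conjI ballI Ft)
    fix w assume w: "w \<in> Ver q"
    then have "\<forall>a\<in>smooth_functions N. w (\<lambda>q. a (\<pi> q)) = 0" by (simp add: Ver_iff)
    from bspec[OF this frD(6)[of b]] show "g q (?F b q) w = 0" by (simp add: Fg[OF Ver_tangent[OF w]])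
  qed
  have ind: "?F b p \<notin> span ((\<lambda>c. ?F c p) ` (Basis - {b}))" if b: "b \<in> Basis" for b
  proof
    have "C b (\<pi> p) \<in> tangent_space N (\<pi> p)" by (rule N.smooth_fieldsD(1)[OF frD(9)])
    then obtain w where w: "w \<in> TM p" "differential N \<pi> w = C b (\<pi> p)"
      using differential_onto[of p] by (metis imageE)
    \<comment> \<open>A lift w of the coordinate vector \<open>C b\<close> pairs with the gradients
      like b with the basis, which separates the b-th gradient from the others.\<close>
    have wa: "g p w (?F c p) = b \<bullet> c" for c
      using Fg[OF w(1), of c] w(2) differential_apply[OF frD(6), of w c] frD(11)[OF p, of b c]
        g_commute[OF w(1) Ft] by simp
    assume "?F b p \<in> span ((\<lambda>c. ?F c p) ` (Basis - {b}))"
    then have "g p w (?F b p) = 0"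
      by (rule orth_span[OF w(1), rotated 2]) (use Ft b in \<open>auto simp: wa inner_Basis split: if_splits\<close>)
    then show False using b by (simp add: wa)
  qed
  obtain U and G :: "'f \<Rightarrow> 'm vfield" and \<nu> where U: "p \<in> U" and G: "orthogonal_fields Basis U G \<nu>"
    and GF: "\<And>q i. i \<in> Basis \<Longrightarrow> G i q \<in> span ((\<lambda>j. ?F j q) ` Basis)"
    and FG: "\<And>q i. i \<in> Basis \<Longrightarrow> ?F i q \<in> span ((\<lambda>j. G j q) ` Basis)"
    using gram_schmidt[OF finite_Basis F ind] by blast
  have Gt: "G i q \<in> TM q" if "i \<in> Basis" for i q
    using G that unfolding orthogonal_fields_def by (blast intro: smooth_fieldsD(1))
  let ?Y = "orth_proj Basis G \<nu> E"
  have Y: "?Y \<in> XM" by (rule orth_proj(1)[OF G E])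
  have YH: "?Y q \<in> Hor q" for q
  proof -
    have "span ((\<lambda>j. ?F j q) ` Basis) \<subseteq> Hor q"
      by (rule span_minimal[OF _ Hor_subspace]) (use FH in blast)
    then have "(\<lambda>i. G i q) ` Basis \<subseteq> Hor q" using GF by blast
    then have "span ((\<lambda>i. G i q) ` Basis) \<subseteq> Hor q" by (rule span_minimal[OF _ Hor_subspace])
    then show ?thesis using orth_proj(2)[OF G, of E q] by blast
  qed
  have "E q - ?Y q \<in> Ver q" if q: "q \<in> U \<inter> \<pi> -` W'" for q
  proof -
    let ?d = "E q - ?Y q"
    have d: "?d \<in> TM q"
      using smooth_fieldsD(1)[OF E] smooth_fieldsD(1)[OF Y] by (rule tangent_closed(4))
    have dG: "g q ?d (G i q) = 0" if "i \<in> Basis" for i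
      using orth_proj(3)[where E=E, OF G smooth_fieldsD(1)[OF E] _ that] q
        g_commute[OF d Gt[OF that]] by simp
    \<comment> \<open>The remainder annihilates all pulled-back coordinates; the frame expansion on
      the base then shows that its differential is 0, that is, that it is vertical.\<close>
    have dF: "?d (?a b) = 0" if "b \<in> Basis" for b
    proof -
      have "g q ?d (?F b q) = 0"
        by (rule orth_span[OF d _ _ FG[OF that]]) (use dG Gt in auto)
      then show ?thesis using Fg[OF d] g_commute[OF d Ft] by simp
    qed
    have u: "differential N \<pi> ?d \<in> tangent_space N (\<pi> q)" using differential_onto[of q] d by blast
    have qW: "\<pi> q \<in> W'" using q by simp
    have "differential N \<pi> ?d (\<lambda>q. x q \<bullet> b) *\<^sub>R C b (\<pi> q) = 0" if "b \<in> Basis" for b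
      unfolding differential_apply[OF frD(6)] dF[OF that] by simp
    with frD(12)[OF qW u] have "differential N \<pi> ?d = 0" by simp
    then show ?thesis using d by (simp add: ker_space_def)
  qed
  moreover have "open (U \<inter> \<pi> -` W')"
    using G open_proj_vimage[OF frD(1)] by (auto simp: orthogonal_fields_def)
  ultimately show ?thesis using U p Y YH by (intro exI[of _ "U \<inter> \<pi> -` W'"] exI[of _ ?Y]) simp
qed

text \<open>Vertical and horizontal spaces meet only in 0, so any decomposition that has been found
  evaluates both definite descriptions.\<close>

lemma proj_eqI:
  assumes "h \<in> Hor p" "u \<in> Ver p" "v = u + h"
  shows "vproj p v = u" "hproj p v = h"
proof -
  show "vproj p v = u"
    unfolding ver_def
  proof (rule the_equality)
    show "u \<in> Ver p \<and> v - u \<in> Hor p" using assms by simp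
    fix w assume w: "w \<in> Ver p \<and> v - w \<in> Hor p"
    have "w - u \<in> Ver p" using w assms(2) subspace_diff[OF Ver_subspace] by blast
    moreover have "w - u = h - (v - w)" using assms(3) by simp
    then have "w - u \<in> Hor p" using w assms(1) subspace_diff[OF Hor_subspace] by metis
    ultimately show "w = u" using Ver_Hor_0[of "w - u" p] by simp
  qed
  show "hproj p v = h"
    unfolding hor_def
  proof (rule the_equality)
    show "h \<in> Hor p \<and> v - h \<in> Ver p" using assms by simp
    fix w assume w: "w \<in> Hor p \<and> v - w \<in> Ver p"
    have "w - h \<in> Hor p" using w assms(1) subspace_diff[OF Hor_subspace] by blast
    moreover have "w - h = u - (v - w)" using assms(3) by simp
    then have "w - h \<in> Ver p" using w assms(2) subspace_diff[OF Ver_subspace] by metis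
    ultimately show "w = h" using Ver_Hor_0[of "w - h" p] by simp
  qed
qed

lemma decomposition:
  assumes v: "v \<in> TM p"
  shows "vproj p v \<in> Ver p" "hproj p v \<in> Hor p" "v = vproj p v + hproj p v"
proof -
  obtain E where E: "E \<in> XM" "E p = v" by (rule smooth_field_through[OF v])
  obtain Y where Y: "Y p \<in> Hor p" "E p - Y p \<in> Ver p" using local_horizontal_part[OF E(1)] by blast
  have "v = (E p - Y p) + Y p" using E(2) by simp
  note * = proj_eqI[OF Y this]
  show "vproj p v \<in> Ver p" "hproj p v \<in> Hor p" "v = vproj p v + hproj p v"
    using * Y E(2) by simp_all
qed

lemma proj_Ver: "v \<in> Ver p \<Longrightarrow> vproj p v = v" "v \<in> Ver p \<Longrightarrow> hproj p v = 0"
  using proj_eqI[OF subspace_0[OF Hor_subspace], of v p v] by simp_all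

lemma proj_Hor: "v \<in> Hor p \<Longrightarrow> vproj p v = 0" "v \<in> Hor p \<Longrightarrow> hproj p v = v"
  using proj_eqI[OF _ subspace_0[OF Ver_subspace], of v p v] by simp_all

lemma vproj_comb:
  assumes "v \<in> TM p" "w \<in> TM p"
  shows "vproj p (a *\<^sub>R v + b *\<^sub>R w) = a *\<^sub>R vproj p v + b *\<^sub>R vproj p w"
proof (rule proj_eqI(1))
  note d = decomposition[OF assms(1)] decomposition[OF assms(2)]
  show "a *\<^sub>R hproj p v + b *\<^sub>R hproj p w \<in> Hor p"
    by (intro subspace_add[OF Hor_subspace] subspace_scale[OF Hor_subspace] d)
  show "a *\<^sub>R vproj p v + b *\<^sub>R vproj p w \<in> Ver p"
    by (intro subspace_add[OF Ver_subspace] subspace_scale[OF Ver_subspace] d)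
  show "a *\<^sub>R v + b *\<^sub>R w = a *\<^sub>R vproj p v + b *\<^sub>R vproj p w + (a *\<^sub>R hproj p v + b *\<^sub>R hproj p w)"
    by (subst d(3), subst d(6)) (simp add: scaleR_add_right)
qed

text \<open>By uniqueness the pointwise horizontal part agrees locally with the smooth field of
  \<open>local_horizontal_part\<close>; the vertical part is the difference.\<close>

lemma proj_smooth:
  assumes E: "E \<in> XM"
  shows "apply_endo hproj E \<in> sections M Hor" "apply_endo vproj E \<in> sections M Ver"
proof -
  have h: "apply_endo hproj E \<in> XM"
  proof (rule smooth_fields_local)
    fix p
    obtain W Y where W: "open W" "p \<in> W" "Y \<in> XM"
      "\<forall>q\<in>W. Y q \<in> Hor q \<and> E q - Y q \<in> Ver q" using local_horizontal_part[OF E] by blast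
    have "apply_endo hproj E q = Y q" if "q \<in> W" for q
      unfolding apply_endo_def by (rule proj_eqI(2)[of _ _ "E q - Y q"]) (use W(4) that in auto)
    then show "\<exists>W F. open W \<and> p \<in> W \<and> F \<in> XM \<and> (\<forall>q\<in>W. apply_endo hproj E q = F q)"
      using W(1-3) by (intro exI[of _ W] exI[of _ Y]) simp
  qed
  note d = decomposition[OF smooth_fieldsD(1)[OF E]]
  show "apply_endo hproj E \<in> sections M Hor"
    using h d(2) by (simp add: sections_def apply_endo_def)
  have "E p - hproj p (E p) = vproj p (E p)" for p using d(3)[of p] by (simp add: diff_eq_eq)
  then have "apply_endo vproj E = E - apply_endo hproj E"
    by (intro ext) (simp add: apply_endo_def)
  with smooth_fields_diff[OF E h] have "apply_endo vproj E \<in> XM" by simp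
  then show "apply_endo vproj E \<in> sections M Ver"
    using d(1) by (simp add: sections_def apply_endo_def)
qed

lemma section_through:
  "v \<in> Ver p \<Longrightarrow> \<exists>V\<in>sections M Ver. V p = v" "v \<in> Hor p \<Longrightarrow> \<exists>Z\<in>sections M Hor. Z p = v"
proof -
  assume v: "v \<in> Ver p"
  obtain E where E: "E \<in> XM" "E p = v" by (rule smooth_field_through[OF Ver_tangent[OF v]])
  then show "\<exists>V\<in>sections M Ver. V p = v"
    using proj_smooth(2)[OF E(1)] proj_Ver(1)[OF v] by (intro bexI[of _ "apply_endo vproj E"]) (simp_all add: apply_endo_def)
next
  assume v: "v \<in> Hor p"
  obtain E where E: "E \<in> XM" "E p = v" by (rule smooth_field_through[OF Hor_tangent[OF v]])
  then show "\<exists>Z\<in>sections M Hor. Z p = v"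
    using proj_smooth(1)[OF E(1)] proj_Hor(2)[OF v] by (intro bexI[of _ "apply_endo hproj E"]) (simp_all add: apply_endo_def)
qed

text \<open>On a velocity this form is the squared speed times the squared sine of the angle, the
  quantity governed by the Clairaut relation.\<close>

lemma vertical_form: "symmetric_form M (\<lambda>p v w. g p (vproj p v) (vproj p w))"
  unfolding symmetric_form_def linear_between_def
proof (intro conjI allI ballI)
  note dt = Ver_tangent[OF decomposition(1)]
  show "g p (vproj p v) (vproj p (a *\<^sub>R w + b *\<^sub>R u))
      = a *\<^sub>R g p (vproj p v) (vproj p w) + b *\<^sub>R g p (vproj p v) (vproj p u)"
    if "v \<in> TM p" "w \<in> TM p" "u \<in> TM p" for p v w u a b
    using that by (simp add: vproj_comb form_comb_right[OF g_form] dt)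
  show "g p (vproj p v) (vproj p w) = g p (vproj p w) (vproj p v)"
    if "v \<in> TM p" "w \<in> TM p" for p v w
    using that by (intro g_commute dt)
  fix E F assume "E \<in> XM" "F \<in> XM"
  then have "apply_endo vproj E \<in> XM" "apply_endo vproj F \<in> XM"
    using proj_smooth(2) by (auto simp: sections_def)
  from g_smooth[OF this] show "(\<lambda>p. g p (vproj p (E p)) (vproj p (F p))) \<in> CM"
    by (simp add: apply_endo_def)
qed auto

end

section \<open>Clairaut submersions have totally umbilical fibres\<close>

locale connection_submersion = submersion M g N \<pi> + affine_manifold M nabla
  for M :: "('m::{t2_space, second_countable_topology}, 'e::euclidean_space) chart set"
    and g :: "'m metric"
    and N :: "('n::{t2_space, second_countable_topology}, 'f::euclidean_space) chart set"
    and \<pi> :: "'m \<Rightarrow> 'n" and nabla :: "'m conn" +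
  assumes lc: "levi_civita M g nabla"
begin

section \<open>Levi-Civita identities and the second fundamental form\<close>

lemma torsion_free:
  "E \<in> XM \<Longrightarrow> F \<in> XM \<Longrightarrow> nabla E F p = nabla F E p + lie_bracket E F p"
proof -
  assume "E \<in> XM" "F \<in> XM"
  then have "nabla E F - nabla F E = lie_bracket E F" using lc by (simp add: levi_civita_def)
  from fun_cong[OF this, of p] show ?thesis by (simp add: diff_eq_eq add.commute)
qed

lemma compatible:
  "E \<in> XM \<Longrightarrow> F \<in> XM \<Longrightarrow> G \<in> XM \<Longrightarrow>
    E p (\<lambda>q. g q (F q) (G q)) = g p (nabla E F p) (G p) + g p (F p) (nabla E G p)"
  using lc by (simp add: levi_civita_def)

lemma compatible_orth:
  assumes "E \<in> XM" "F \<in> XM" "G \<in> XM"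
    and "\<And>q. g q (F q) (G q) = 0"
  shows "g p (F p) (nabla E G p) = - g p (nabla E F p) (G p)"
  using compatible[OF assms(1-3), of p] tangent_const[OF smooth_fieldsD(1)[OF assms(1)], of p 0] assms(4)
  by simp

lemma sectionsD:
  "E \<in> sections M D \<Longrightarrow> E \<in> XM" "E \<in> sections M D \<Longrightarrow> E p \<in> D p"
  by (auto simp: sections_def)

lemma lie_bracket_tangent:
  assumes "E \<in> XM" "F \<in> XM"
  shows "lie_bracket E F p \<in> TM p"
proof -
  have "lie_bracket E F p = nabla E F p - nabla F E p" using torsion_free[OF assms, of p] by simp
  then show ?thesis using assms by (simp add: tangent_closed nabla_tangent)
qed

text \<open>The last assumption says that E maps functions pulled back from the base to such
  functions. V annihilates all of them, so both terms of the bracket do. It is applied to vertical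
  E, with b = 0, and to a basic E.\<close>

lemma lie_bracket_vertical:
  assumes "E \<in> XM" "V \<in> sections M Ver"
    and "\<And>a. a \<in> smooth_functions N \<Longrightarrow> \<exists>b\<in>smooth_functions N. \<forall>q. E q (\<lambda>q. a (\<pi> q)) = b (\<pi> q)"
  shows "lie_bracket E V p \<in> Ver p"
  unfolding Ver_iff
proof (intro conjI ballI)
  note V = sectionsD[OF assms(2)]
  show "lie_bracket E V p \<in> TM p" by (rule lie_bracket_tangent[OF assms(1) V(1)])
  fix a assume a: "a \<in> smooth_functions N"
  obtain b where b: "b \<in> smooth_functions N" "\<And>q. E q (\<lambda>q. a (\<pi> q)) = b (\<pi> q)" using assms(3)[OF a] by auto
  have Va: "V q (\<lambda>q. c (\<pi> q)) = 0" if "c \<in> smooth_functions N" for c q using V(2)[of q] that by (simp add: Ver_iff)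
  show "lie_bracket E V p (\<lambda>q. a (\<pi> q)) = 0"
    using tangent_const[OF smooth_fieldsD(1)[OF assms(1)], of p 0]
    by (simp add: lie_bracket_def Va[OF a] b(2) Va[OF b(1)])
qed

text \<open>The two derivatives differ by a bracket of vertical fields, which is again
  vertical.\<close>

lemma second_form_commute:
  assumes "U \<in> sections M Ver" "V \<in> sections M Ver" "z \<in> Hor p"
  shows "g p z (nabla U V p) = g p z (nabla V U p)"
proof -
  note U = sectionsD[OF assms(1)] and V = sectionsD[OF assms(2)]
  have "lie_bracket U V p \<in> Ver p"
  proof (rule lie_bracket_vertical[OF U(1) assms(2)])
    fix a assume "a \<in> smooth_functions N"
    then have "\<forall>q. U q (\<lambda>q. a (\<pi> q)) = (\<lambda>_. 0) (\<pi> q)" using U(2) by (simp add: Ver_iff)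
    then show "\<exists>b\<in>smooth_functions N. \<forall>q. U q (\<lambda>q. a (\<pi> q)) = b (\<pi> q)"
      using N.smooth_functions_const by (intro bexI[of _ "\<lambda>_. 0"])
  qed
  then show ?thesis
    unfolding torsion_free[OF U(1) V(1)]
    using g_add_right[OF Hor_tangent[OF assms(3)] nabla_tangent[OF V(1) U(1)] lie_bracket_tangent[OF U(1) V(1)]]
      Hor_Ver[OF assms(3)] by simp
qed

lemma hor_nabla_ver:
  assumes "X \<in> XM" "Z \<in> sections M Hor" "U \<in> sections M Ver"
  shows "g p (Z p) (nabla X U p) = - g p (nabla X Z p) (U p)"
  using compatible_orth[OF assms(1) sectionsD(1)[OF assms(2)] sectionsD(1)[OF assms(3)]]
    Hor_Ver sectionsD(2)[OF assms(2)] sectionsD(2)[OF assms(3)] by blast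

text \<open>Moving the derivative onto a horizontal extension of z leaves the vertical field
  undifferentiated, so only its value at p counts.\<close>

lemma hor_nabla_ver_pointwise:
  assumes "X \<in> XM" "z \<in> Hor p" "U \<in> sections M Ver" "U' \<in> sections M Ver" "U p = U' p"
  shows "g p z (nabla X U p) = g p z (nabla X U' p)"
proof -
  obtain Z where Z: "Z \<in> sections M Hor" "Z p = z" using section_through(2)[OF assms(2)] by blast
  show ?thesis
    using hor_nabla_ver[OF assms(1) Z(1) assms(3), of p] hor_nabla_ver[OF assms(1) Z(1) assms(4), of p] assms(5) Z(2)
    by simp
qed

text \<open>Pythagoras for the two parts of v. The squared form removes the roots; v must be nonzero
  because the angle of the zero vector is a default value.\<close>

lemma sin_hor_angle:
  assumes v: "v \<in> TM p" "v \<noteq> 0"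
  shows "(sin (hor_angle M g N \<pi> p v))\<^sup>2 * g p v v = g p (vproj p v) (vproj p v)"
proof -
  let ?h = "hproj p v" and ?u = "vproj p v"
  note d = decomposition[OF v(1)]
  have t: "?h \<in> TM p" "?u \<in> TM p" using d Ver_tangent Hor_tangent by blast+
  have "g p v v = g p (?u + ?h) (?u + ?h)" using d(3) by simp
  also have "... = g p ?u ?u + g p ?h ?h"
    using t Hor_Ver[OF d(2,1)] Ver_Hor[OF d(2,1)]
    by (simp add: g_add_left g_add_right tangent_closed)
  finally have pyth: "g p v v = g p ?u ?u + g p ?h ?h" .
  have nn: "0 \<le> g p ?u ?u" "0 \<le> g p ?h ?h" "0 < g p v v" using t g_nonneg g_pos[OF v] by auto
  let ?r = "sqrt (g p ?h ?h) / sqrt (g p v v)"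
  have r: "0 \<le> ?r" "?r \<le> 1" using nn pyth by (simp_all add: divide_le_eq)
  have "sin (hor_angle M g N \<pi> p v) = sqrt (1 - ?r\<^sup>2)"
    unfolding hor_angle_def Let_def by (rule sin_arccos) (use r in auto)
  moreover have "?r\<^sup>2 \<le> 1" using r by (simp add: power_le_one)
  moreover have "?r\<^sup>2 = g p ?h ?h / g p v v" using nn by (simp add: power_divide)
  ultimately show ?thesis using nn pyth by (simp add: field_simps)
qed

text \<open>Differentiating the Clairaut relation at time \<open>0\<close> along the geodesic with initial velocity
  \<open>U p + Z p\<close>.\<close>

lemma clairaut_derivative:
  assumes f: "f \<in> CM" and cl: "clairaut M g nabla N \<pi> (\<lambda>p. exp (f p))"
    and U: "U \<in> sections M Ver" and Z: "Z \<in> sections M Hor"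
  shows "g p (Z p) (nabla (U + Z) U p) = - (U + Z) p f * g p (U p) (U p)"
proof (cases "U p + Z p = 0")
  case True
  note Us = sectionsD[OF U] and Zs = sectionsD[OF Z]
  have "U p = - Z p" using True by (simp add: eq_neg_iff_add_eq_0)
  then have "U p \<in> Hor p" using Zs(2) subspace_neg[OF Hor_subspace] by simp
  then have U0: "U p = 0" using Ver_Hor_0 Us(2) by blast
  then have "Z p = 0" using True by simp
  then show ?thesis
    using U0 by (simp add: g_zero_left tangent_closed nabla_tangent smooth_fields_add Us Zs)
next
  case False
  note Us = sectionsD[OF U] and Zs = sectionsD[OF Z]
  let ?v = "U p + Z p"
  have Ut: "U p \<in> TM p" and Zt: "Z p \<in> TM p"
    using Us Zs smooth_fieldsD(1) by blast+
  have v: "?v \<in> TM p" by (rule tangent_closed(2)[OF Ut Zt])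
  obtain X h e where X: "X \<in> XM" "X p = ?v" and e: "0 < (e::real)" and h0: "h 0 = p"
    and geo: "geodesic_on M nabla {-e<..<e} h" and vel0: "velocity M h 0 = ?v"
    and vt: "\<And>t. t \<in> {-e<..<e} \<Longrightarrow> velocity M h t \<in> TM (h t)"
    and dh: "\<And>a. a \<in> CM \<Longrightarrow> ((\<lambda>t. a (h t)) has_real_derivative ?v a) (at 0)"
    and dB: "\<And>B. symmetric_form M B \<Longrightarrow> ((\<lambda>t. B (h t) (velocity M h t) (velocity M h t)) has_real_derivative
       X p (\<lambda>q. B q (X q) (X q)) - 2 * B p (nabla X X p) ?v) (at 0)"
    by (rule geodesic_exists[OF v]) (rule that)
  define \<gamma> where "\<gamma> t = g (h t) (velocity M h t) (velocity M h t)" for t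
  define \<beta> where "\<beta> t = g (h t) (vproj (h t) (velocity M h t)) (vproj (h t) (velocity M h t))" for t
  \<comment> \<open>The derivative formula comes with its own field X, known only to take the value
    \<open>U p + Z p\<close> at p. Its parts agree with U and Z at p but not nearby.\<close>
  define U1 where "U1 = apply_endo vproj X"
  define Z1 where "Z1 = apply_endo hproj X"
  have U1: "U1 \<in> sections M Ver" and Z1: "Z1 \<in> sections M Hor"
    unfolding U1_def Z1_def using proj_smooth[OF X(1)] by blast+
  note U1s = sectionsD[OF U1] and Z1s = sectionsD[OF Z1]
  have XUZ: "X = U1 + Z1"
    using decomposition(3)[OF smooth_fieldsD(1)[OF X(1)]]
    by (intro ext) (simp add: U1_def Z1_def apply_endo_def fun_eq_iff)
  have pv: "vproj p ?v = U p" "hproj p ?v = Z p"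
    by (rule proj_eqI[OF Zs(2) Us(2) refl])+
  then have U1p: "U1 p = U p" and Z1p: "Z1 p = Z p" by (simp_all add: U1_def Z1_def apply_endo_def X(2))
  have NX: "nabla X X p \<in> TM p" by (rule nabla_tangent[OF X(1) X(1)])
  \<comment> \<open>For B = g, metric compatibility cancels everything: the squared speed has
    derivative 0 at time 0.\<close>
  have "X p (\<lambda>q. g q (X q) (X q)) - 2 * g p (nabla X X p) ?v = 0"
    unfolding compatible[OF X(1) X(1) X(1)] using g_commute[OF NX v] by (simp add: X(2))
  with dB[OF g_form] have d\<gamma>: "(\<gamma> has_real_derivative 0) (at 0)" by (simp add: \<gamma>_def[abs_def])
  have "X p (\<lambda>q. g q (vproj q (X q)) (vproj q (X q))) - 2 * g p (vproj p (nabla X X p)) (vproj p ?v)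
      = 2 * g p (Z p) (nabla (U + Z) U p)"
  proof -
    have t: "nabla X U1 p \<in> TM p" "nabla X Z1 p \<in> TM p"
      using nabla_tangent[OF X(1)] U1s(1) Z1s(1) by blast+
    have "X p (\<lambda>q. g q (vproj q (X q)) (vproj q (X q))) = X p (\<lambda>q. g q (U1 q) (U1 q))"
      by (simp add: U1_def apply_endo_def)
    also have "... = 2 * g p (nabla X U1 p) (U p)"
      unfolding compatible[OF X(1) U1s(1) U1s(1)] U1p using g_commute[OF t(1) Ut] by simp
    finally have 1: "X p (\<lambda>q. g q (vproj q (X q)) (vproj q (X q))) = 2 * g p (nabla X U1 p) (U p)" .
    note d = decomposition[OF NX]
    have "g p (nabla X X p) (U p) = g p (vproj p (nabla X X p) + hproj p (nabla X X p)) (U p)"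
      using d(3) by simp
    also have "... = g p (vproj p (nabla X X p)) (U p)"
      using g_add_left[OF Ut Ver_tangent[OF d(1)] Hor_tangent[OF d(2)]] Hor_Ver[OF d(2) Us(2)] by simp
    finally have 2: "g p (vproj p (nabla X X p)) (vproj p ?v) = g p (nabla X X p) (U p)" by (simp add: pv)
    have "nabla X X = nabla X U1 + nabla X Z1"
      using nabla_add_right[OF U1s(1) Z1s(1) X(1)] XUZ by metis
    then have 3: "g p (nabla X X p) (U p) = g p (nabla X U1 p) (U p) + g p (nabla X Z1 p) (U p)"
      by (simp add: g_add_left[OF Ut t])
    have "g p (nabla X Z1 p) (U p) = - g p (Z p) (nabla X U1 p)"
      using hor_nabla_ver[OF X(1) Z1 U1, of p] by (simp add: U1p Z1p)
    \<comment> \<open>Here the auxiliary fields are exchanged for the given ones: U1 by pointwise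
      dependence of the horizontal component, and next X by tensoriality of the first slot.\<close>
    also have "g p (Z p) (nabla X U1 p) = g p (Z p) (nabla X U p)"
      by (rule hor_nabla_ver_pointwise[OF X(1) Zs(2) U1 U U1p])
    also have "nabla X U p = nabla (U + Z) U p"
      by (rule nabla_pointwise[OF X(1) smooth_fields_add[OF Us(1) Zs(1)] Us(1)]) (simp add: X(2))
    finally show ?thesis using 1 2 3 by simp
  qed
  with dB[OF vertical_form] have d\<beta>: "(\<beta> has_real_derivative 2 * g p (Z p) (nabla (U + Z) U p)) (at 0)"
    by (simp add: \<beta>_def[abs_def])
  have "(\<lambda>s. exp (f (h s)) * sin (hor_angle M g N \<pi> (h s) (velocity M h s))) constant_on {-e<..<e}"
    using cl geo unfolding clairaut_def by blast
  then obtain C where C: "\<And>t. t \<in> {-e<..<e} \<Longrightarrow>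
      exp (f (h t)) * sin (hor_angle M g N \<pi> (h t) (velocity M h t)) = C"
    unfolding constant_on_def by blast
  \<comment> \<open>Positivity of the squared speed persists near time 0, so the velocity is nonzero
    there and \<open>sin_hor_angle\<close> applies.\<close>
  have g0: "\<gamma> 0 > 0" using g_pos[OF v False] by (simp add: \<gamma>_def h0 vel0)
  have "\<forall>\<^sub>F t in nhds 0. \<gamma> t \<in> {0<..}"
    using DERIV_isCont[OF d\<gamma>] g0 unfolding isCont_def tendsto_at_iff_tendsto_nhds
    by (intro topological_tendstoD) auto
  moreover have "\<forall>\<^sub>F t in nhds 0. t \<in> {-e<..<e}" using e by (intro eventually_nhds_in_open) auto
  ultimately have ev: "\<forall>\<^sub>F t in nhds 0. (exp (f (h t)))\<^sup>2 * \<beta> t = C\<^sup>2 * \<gamma> t"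
  proof eventually_elim
    case (elim t)
    have "velocity M h t \<noteq> 0"
      using elim(1) g_zero_right[OF vt[OF elim(2)]] by (auto simp: \<gamma>_def)
    from sin_hor_angle[OF vt[OF elim(2)] this]
    have "\<beta> t = (sin (hor_angle M g N \<pi> (h t) (velocity M h t)))\<^sup>2 * \<gamma> t" by (simp add: \<beta>_def \<gamma>_def)
    then show ?case unfolding C[OF elim(2), symmetric] by (simp add: power_mult_distrib)
  qed
  have "((\<lambda>t. (exp (f (h t)))\<^sup>2 * \<beta> t) has_real_derivative
      2 * exp (f p) * (exp (f p) * ?v f) * \<beta> 0 + (2 * g p (Z p) (nabla (U + Z) U p)) * (exp (f p))\<^sup>2) (at 0)"
    by (rule derivative_eq_intros dh[OF f] d\<beta> refl)+ (simp add: h0 power2_eq_square)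
  moreover have "((\<lambda>t. C\<^sup>2 * \<gamma> t) has_real_derivative 0) (at 0)"
    using DERIV_cmult[OF d\<gamma>, of "C\<^sup>2"] by simp
  then have "((\<lambda>t. (exp (f (h t)))\<^sup>2 * \<beta> t) has_real_derivative 0) (at 0)"
    using DERIV_cong_ev[OF refl ev refl] by blast
  ultimately have "2 * exp (f p) * (exp (f p) * ?v f) * \<beta> 0 + (2 * g p (Z p) (nabla (U + Z) U p)) * (exp (f p))\<^sup>2 = 0"
    by (rule DERIV_unique)
  then have "(2 * (exp (f p))\<^sup>2) * (?v f * \<beta> 0 + g p (Z p) (nabla (U + Z) U p)) = 0"
    by (simp add: algebra_simps power2_eq_square)
  then have "?v f * \<beta> 0 + g p (Z p) (nabla (U + Z) U p) = 0" by simp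
  moreover have "\<beta> 0 = g p (U p) (U p)" by (simp add: \<beta>_def h0 vel0 pv)
  ultimately have "g p (Z p) (nabla (U + Z) U p) = - (?v f * g p (U p) (U p))" by (simp only:)
  then show ?thesis by (simp add: algebra_simps)
qed

text \<open>Since f has zero derivative in vertical directions, the factor (U + Z) f of
  \<open>clairaut_derivative\<close> is just z f, unaffected by the sign of U.\<close>

lemma clairaut_umbilic:
  assumes f: "f \<in> CM" and cl: "clairaut M g nabla N \<pi> (\<lambda>p. exp (f p))"
    and fV: "\<forall>q. \<forall>u\<in>Ver q. u f = 0"
    and U: "U \<in> sections M Ver" and V: "V \<in> sections M Ver" and z: "z \<in> Hor p"
  shows "g p z (nabla U V p) = - z f * g p (U p) (V p)"
proof -
  obtain Z where Z: "Z \<in> sections M Hor" "Z p = z" using section_through(2)[OF z] by blast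
  note Zs = sectionsD[OF Z(1)]
  have zt: "z \<in> TM p" by (rule Hor_tangent[OF z])
  have diag: "g p z (nabla U U p) = - z f * g p (U p) (U p)" if U: "U \<in> sections M Ver" for U
  proof -
    note Us = sectionsD[OF U]
    have Uf: "U p f = 0" using fV Us(2) by blast
    \<comment> \<open>Under U to -U the term with \<open>nabla U U\<close> is unchanged and the term
      with \<open>nabla Z U\<close> changes sign, so adding the two relations isolates the
      former.\<close>
    have U': "(-1) *\<^sub>R U \<in> sections M Ver"
      using smooth_fields_uminus[OF Us(1)] subspace_neg[OF Ver_subspace Us(2)] by (simp add: sections_def)
    have t: "nabla U U p \<in> TM p" "nabla Z U p \<in> TM p" "U p \<in> TM p"
      by (rule nabla_tangent[OF Us(1) Us(1)], rule nabla_tangent[OF Zs(1) Us(1)], rule Ver_tangent[OF Us(2)])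
    have "g p z (nabla U U p) + g p z (nabla Z U p) = - z f * g p (U p) (U p)"
      using clairaut_derivative[OF f cl U Z(1), of p] Z(2) Uf
      by (simp add: nabla_add_left[OF Us(1) Zs(1) Us(1)] g_add_right[OF zt t(1,2)])
    moreover have "g p z (nabla U U p) - g p z (nabla Z U p) = - z f * g p (U p) (U p)"
      using clairaut_derivative[OF f cl U' Z(1), of p] Z(2) Uf t zt
      by (simp only: nabla_add_left[OF smooth_fields_scaleR[OF Us(1)] Zs(1) smooth_fields_scaleR[OF Us(1)]]
          nabla_scaleR_left[OF Us(1) smooth_fields_scaleR[OF Us(1)]] nabla_scaleR_right[OF Us(1) Us(1)]
          nabla_scaleR_right[OF Zs(1) Us(1)])
        (simp add: g_diff_right g_minus_right g_minus_left tangent_closed)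
    ultimately show ?thesis by simp
  qed
  note Us = sectionsD[OF U] and Vs = sectionsD[OF V]
  have UV: "U + V \<in> sections M Ver"
    using smooth_fields_add[OF Us(1) Vs(1)] subspace_add[OF Ver_subspace Us(2) Vs(2)] by (simp add: sections_def)
  have t: "U p \<in> TM p" "V p \<in> TM p" using Us Vs Ver_tangent by blast+
  have nt: "nabla E F p \<in> TM p" if "E \<in> {U, V}" "F \<in> {U, V}" for E F
    using nabla_tangent that Us(1) Vs(1) by blast
  have "nabla (U + V) (U + V) p = (nabla U U p + nabla V U p) + (nabla U V p + nabla V V p)"
    by (simp add: nabla_add_right[OF Us(1) Vs(1) smooth_fields_add[OF Us(1) Vs(1)]]
        nabla_add_left[OF Us(1) Vs(1) Us(1)] nabla_add_left[OF Us(1) Vs(1) Vs(1)])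
  then have "g p z (nabla (U + V) (U + V) p) =
      g p z (nabla U U p) + g p z (nabla V U p) + (g p z (nabla U V p) + g p z (nabla V V p))"
    by (simp add: g_add_right[OF zt] tangent_closed nt)
  \<comment> \<open>Polarisation: the two mixed terms coincide because the second fundamental form
    is symmetric.\<close>
  then have "2 * g p z (nabla U V p) = - z f * (g p (U p + V p) (U p + V p) - g p (U p) (U p) - g p (V p) (V p))"
    using diag[OF U] diag[OF V] diag[OF UV] second_form_commute[OF U V z]
    by (simp add: algebra_simps)
  also have "... = 2 * (- z f * g p (U p) (V p))"
    using g_commute[OF t] by (simp add: g_add_left g_add_right t tangent_closed algebra_simps)
  finally show ?thesis by simp
qed

end

section \<open>Anti-invariant submersions from nearly Kaehler manifolds\<close>

locale nearly_kaehler_submersion = connection_submersion M g N \<pi> nabla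
  for M :: "('m::{t2_space, second_countable_topology}, 'e::euclidean_space) chart set"
    and g :: "'m metric"
    and N :: "('n::{t2_space, second_countable_topology}, 'f::euclidean_space) chart set"
    and \<pi> :: "'m \<Rightarrow> 'n" and nabla :: "'m conn" +
  fixes \<phi> :: "'m endo"
  assumes nk: "nearly_kaehler M \<phi> g nabla"
    and anti: "anti_invariant M \<phi> g N \<pi>"
begin

section \<open>The almost complex structure and its covariant derivative\<close>

lemma hermitian: "almost_hermitian M \<phi> g"
  using nk by (simp add: nearly_kaehler_def)

lemma phi_tangent: "v \<in> TM p \<Longrightarrow> \<phi> p v \<in> TM p"
  using hermitian by (auto simp: almost_hermitian_def tensor_field_11_def linear_between_def)

lemma phi_smooth: "E \<in> XM \<Longrightarrow> apply_endo \<phi> E \<in> XM"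
  using hermitian by (simp add: almost_hermitian_def tensor_field_11_def)

lemma phi_phi: "v \<in> TM p \<Longrightarrow> \<phi> p (\<phi> p v) = - v"
  using hermitian by (simp add: almost_hermitian_def)

lemma phi_isometry: "v \<in> TM p \<Longrightarrow> w \<in> TM p \<Longrightarrow> g p (\<phi> p v) (\<phi> p w) = g p v w"
  using hermitian by (simp add: almost_hermitian_def)

lemma phi_skew:
  assumes "v \<in> TM p" "w \<in> TM p"
  shows "g p (\<phi> p v) w = - g p v (\<phi> p w)"
  using phi_isometry[OF assms(1) phi_tangent[OF assms(2)]] phi_phi[OF assms(2)]
    g_minus_right[OF phi_tangent[OF assms(1)] assms(2)] by simp

lemma phi_Ver: "v \<in> Ver p \<Longrightarrow> \<phi> p v \<in> Hor p"
  using anti by (auto simp: anti_invariant_def)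

abbreviation cov_phi :: "'m vfield \<Rightarrow> 'm vfield \<Rightarrow> 'm vfield" where
  "cov_phi \<equiv> cov_deriv_endo nabla \<phi>"

lemma cov_phi_smooth: "E \<in> XM \<Longrightarrow> F \<in> XM \<Longrightarrow> cov_phi E F \<in> XM"
  unfolding cov_deriv_endo_def by (intro smooth_fields_diff phi_smooth nabla_smooth)

lemma nabla_phi: "nabla E (apply_endo \<phi> F) p = cov_phi E F p + \<phi> p (nabla E F p)"
  by (simp add: cov_deriv_endo_def apply_endo_def)

lemma cov_phi_anticommute:
  "E \<in> XM \<Longrightarrow> F \<in> XM \<Longrightarrow> cov_phi E F p = - cov_phi F E p"
proof -
  assume "E \<in> XM" "F \<in> XM"
  then have "cov_phi E F + cov_phi F E = 0" using nk by (simp add: nearly_kaehler_def)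
  from fun_cong[OF this, of p] show ?thesis by (simp add: eq_neg_iff_add_eq_0)
qed

lemma cov_phi_self: "E \<in> XM \<Longrightarrow> cov_phi E E p = 0"
  using fun_cong[OF cov_phi_anticommute[of E E p]] by (intro ext) simp

text \<open>The covariant derivative of \<open>\<phi>\<close> inherits skewness from
  \<open>\<phi>\<close>: differentiate g(phi F, G) = - g(F, phi G); the terms with phi outside the
  derivative cancel.\<close>

lemma cov_phi_skew:
  assumes E: "E \<in> XM" and F: "F \<in> XM" and G: "G \<in> XM"
  shows "g p (cov_phi E F p) (G p) = - g p (F p) (cov_phi E G p)"
proof -
  note t = smooth_fieldsD(1)[OF F] smooth_fieldsD(1)[OF G] nabla_tangent[OF E F, of p] nabla_tangent[OF E G, of p]
    smooth_fieldsD(1)[OF cov_phi_smooth[OF E F], of p] smooth_fieldsD(1)[OF cov_phi_smooth[OF E G], of p]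
  note pF = phi_smooth[OF F] and pG = phi_smooth[OF G]
  have eq: "(\<lambda>q. g q (apply_endo \<phi> F q) (G q)) = (\<lambda>q. (-1) * g q (F q) (apply_endo \<phi> G q))"
    by (simp add: apply_endo_def phi_skew t)
  have "E p (\<lambda>q. g q (apply_endo \<phi> F q) (G q)) = - E p (\<lambda>q. g q (F q) (apply_endo \<phi> G q))"
    unfolding eq using tangent_cmult[OF smooth_fieldsD(1)[OF E] g_smooth[OF F pG], of p "-1"] by simp
  then have "g p (nabla E (apply_endo \<phi> F) p) (G p) + g p (apply_endo \<phi> F p) (nabla E G p)
      = - (g p (nabla E F p) (apply_endo \<phi> G p) + g p (F p) (nabla E (apply_endo \<phi> G) p))"
    by (simp only: compatible[OF E pF G] compatible[OF E F pG])
  moreover have "g p (nabla E (apply_endo \<phi> F) p) (G p) = g p (cov_phi E F p) (G p) - g p (nabla E F p) (\<phi> p (G p))"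
    unfolding nabla_phi by (simp add: g_add_left t phi_tangent phi_skew)
  moreover have "g p (F p) (nabla E (apply_endo \<phi> G) p) = g p (F p) (cov_phi E G p) - g p (\<phi> p (F p)) (nabla E G p)"
    unfolding nabla_phi by (simp add: g_add_right t phi_tangent phi_skew)
  ultimately show ?thesis by (simp add: apply_endo_def)
qed

text \<open>Differentiating g(phi U, W) = 0 along U moves the derivative onto phi U. The diagonal
  case (nabla_U phi) U = 0 of the nearly Kaehler condition pulls phi out, and skewness moves it to
  W.\<close>

lemma second_form_exchange:
  assumes U: "U \<in> sections M Ver" and W: "W \<in> sections M Ver"
  shows "g p (\<phi> p (U p)) (nabla U W p) = g p (\<phi> p (W p)) (nabla U U p)"
proof -
  note Us = sectionsD[OF U] and Ws = sectionsD[OF W]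
  have t: "W p \<in> TM p" "nabla U U p \<in> TM p"
    by (rule smooth_fieldsD(1)[OF Ws(1)], rule nabla_tangent[OF Us(1) Us(1)])
  have PU: "apply_endo \<phi> U \<in> sections M Hor"
    using phi_smooth[OF Us(1)] phi_Ver[OF Us(2)] by (simp add: sections_def apply_endo_def)
  have nt: "nabla U (apply_endo \<phi> U) p \<in> TM p" by (rule nabla_tangent[OF Us(1) phi_smooth[OF Us(1)]])
  have "g p (\<phi> p (U p)) (nabla U W p) = - g p (nabla U (apply_endo \<phi> U) p) (W p)"
    using hor_nabla_ver[OF Us(1) PU W, of p] by (simp add: apply_endo_def)
  also have "... = - g p (\<phi> p (nabla U U p)) (W p)"
    unfolding nabla_phi cov_phi_self[OF Us(1)] by simp
  also have "... = g p (nabla U U p) (\<phi> p (W p))" using phi_skew[OF t(2,1)] by simp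
  also have "... = g p (\<phi> p (W p)) (nabla U U p)" by (rule g_commute[OF t(2) phi_tangent[OF t(1)]])
  finally show ?thesis .
qed

text \<open>For u orthogonal to w, umbilicity makes one side of \<open>second_form_exchange\<close>
  a multiple of g(u, w) = 0 and the other equal to - (phi w)(f) g(u, u). Since phi w is the
  gradient, (phi w)(f) is its squared length.\<close>

lemma grad_vanishes:
  assumes f: "f \<in> CM" and cl: "clairaut M g nabla N \<pi> (\<lambda>p. exp (f p))"
    and gf: "grad M g f \<in> sections M (\<lambda>p. \<phi> p ` Ver p)" and dim: "dim (Ver p) > 1"
  shows "grad M g f p = 0"
proof -
  have gfp: "grad M g f q \<in> \<phi> q ` Ver q" for q using sectionsD(2)[OF gf] .
  have fV: "\<forall>q. \<forall>u\<in>Ver q. u f = 0"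
  proof (intro allI ballI)
    fix q u assume u: "u \<in> Ver q"
    obtain w where "w \<in> Ver q" "grad M g f q = \<phi> q w" using gfp[of q] by blast
    then have "grad M g f q \<in> Hor q" using phi_Ver by simp
    from Hor_Ver[OF this u] show "u f = 0" using grad(2)[OF f Ver_tangent[OF u]] by simp
  qed
  obtain w where w: "w \<in> Ver p" "grad M g f p = \<phi> p w" using gfp[of p] by blast
  have wt: "w \<in> TM p" by (rule Ver_tangent[OF w(1)])
  have "\<not> Ver p \<subseteq> span {w}"
    using dim_le_card[of "Ver p" "{w}"] dim by auto
  then obtain u0 where u0: "u0 \<in> Ver p" "u0 \<notin> span {w}" by blast
  \<comment> \<open>The component of u0 orthogonal to w. For w = 0 the quotient has the value 0 by
    convention and u is u0, which is nonzero since it lies outside the span.\<close>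
  define u where "u = u0 - (g p w u0 / g p w w) *\<^sub>R w"
  have u: "u \<in> Ver p"
    unfolding u_def by (intro subspace_diff[OF Ver_subspace] subspace_scale[OF Ver_subspace] u0 w)
  have ut: "u \<in> TM p" by (rule Ver_tangent[OF u])
  have "u \<noteq> 0"
  proof
    assume "u = 0"
    then have "u0 = (g p w u0 / g p w w) *\<^sub>R w" by (simp add: u_def)
    then show False using u0(2) span_scale[OF span_base[of w "{w}"]] by (metis singletonI)
  qed
  then have uu: "g p u u \<noteq> 0" using g_eq_0_iff[OF ut] by simp
  have wu: "g p u w = 0"
  proof (cases "w = 0")
    case True
    then show ?thesis by (simp add: g_zero_right ut)
  next
    case False
    then have "g p w u = 0"
      using g_eq_0_iff[OF wt] Ver_tangent[OF u0(1)] wt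
      by (simp add: u_def g_diff_right g_scaleR_right tangent_closed)
    then show ?thesis using g_commute[OF ut wt] by simp
  qed
  obtain U W where U: "U \<in> sections M Ver" "U p = u" and W: "W \<in> sections M Ver" "W p = w"
    using section_through(1)[OF u] section_through(1)[OF w(1)] by blast
  note umb = clairaut_umbilic[OF f cl fV]
  have "g p (\<phi> p u) (nabla U W p) = 0"
    using umb[OF U(1) W(1) phi_Ver[OF u]] U(2) W(2) wu by simp
  moreover have "g p (\<phi> p w) (nabla U U p) = - \<phi> p w f * g p u u"
    using umb[OF U(1) U(1) phi_Ver[OF w(1)]] U(2) by simp
  ultimately have "\<phi> p w f = 0"
    using second_form_exchange[OF U(1) W(1), of p] U(2) W(2) uu by simp
  then have "g p (\<phi> p w) (\<phi> p w) = 0"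
    using grad(2)[OF f phi_tangent[OF wt]] w(2) by simp
  then show ?thesis using w(2) g_eq_0_iff[OF phi_tangent[OF wt]] by simp
qed

lemma fibres_totally_geodesic:
  assumes f: "f \<in> CM" and cl: "clairaut M g nabla N \<pi> (\<lambda>p. exp (f p))"
    and gf: "grad M g f \<in> sections M (\<lambda>p. \<phi> p ` Ver p)" and dim: "\<And>p. dim (Ver p) > 1"
  shows "totally_geodesic_fibres M g nabla N \<pi>"
  unfolding totally_geodesic_fibres_def
proof (intro ballI, rule ext)
  fix U V p assume U: "U \<in> sections M Ver" and V: "V \<in> sections M Ver"
  have df: "v f = 0" if "v \<in> TM q" for v q
    using grad(2)[OF f that] grad_vanishes[OF f cl gf dim] g_zero_left[OF that] by simp
  have fV: "\<forall>q. \<forall>v\<in>Ver q. v f = 0" by (intro allI ballI) (rule df[OF Ver_tangent])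
  have nt: "nabla U V p \<in> TM p"
    by (rule nabla_tangent[OF sectionsD(1)[OF U] sectionsD(1)[OF V]])
  note d = decomposition[OF nt]
  let ?h = "hproj p (nabla U V p)"
  have ht: "?h \<in> TM p" by (rule Hor_tangent[OF d(2)])
  \<comment> \<open>The horizontal part itself serves as the test vector; umbilicity with vanishing
    differential of f makes its squared length 0.\<close>
  have "g p ?h (nabla U V p) = 0"
    using clairaut_umbilic[OF f cl fV U V d(2)] df[OF ht] by simp
  moreover have "g p ?h (nabla U V p) = g p ?h (vproj p (nabla U V p) + ?h)" using d(3) by simp
  ultimately have "g p ?h ?h = 0"
    using g_add_right[OF ht Ver_tangent[OF d(1)] ht] Hor_Ver[OF d(2,1)] by simp
  then show "apply_endo hproj (nabla U V) p = 0 p" using g_eq_0_iff[OF ht] by (simp add: apply_endo_def)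
qed

text \<open>The derivatives of \<open>\<phi>\<close> cancel in the pairing with a vertical V:
  skewness turns the Q part into one with \<open>cov_phi W V\<close>, and anticommutation makes this
  the negative of the \<open>cov_phi V W\<close> contributed by the O'Neill part.\<close>

lemma oneill_Q_vanishes:
  assumes tg: "totally_geodesic_fibres M g nabla N \<pi>"
    and W: "W \<in> sections M Ver" and X: "X \<in> sections M (mu_space M \<phi> g N \<pi>)"
    and basic: "basic_field M g N \<pi> (apply_endo \<phi> W)"
  shows "oneill_A M g nabla N \<pi> (apply_endo \<phi> W) (apply_endo \<phi> X)
    + Q_tensor M \<phi> g nabla N \<pi> W (apply_endo \<phi> X) = 0"
proof
  fix p
  let ?PW = "apply_endo \<phi> W" and ?PX = "apply_endo \<phi> X"
  note Ws = sectionsD[OF W] and Xs = sectionsD[OF X]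
  have PW: "?PW \<in> XM" and PX: "?PX \<in> XM" using phi_smooth Ws(1) Xs(1) by blast+
  have XH: "X q \<in> Hor q" and Xmu: "\<And>v. v \<in> Ver q \<Longrightarrow> g q (X q) (\<phi> q v) = 0" for q
    using Xs(2)[of q] by (auto simp: mu_space_def orth_compl_def)
  have PWH: "?PW q \<in> Hor q" for q using phi_Ver[OF Ws(2)] by (simp add: apply_endo_def)
  \<comment> \<open>Skewness of \<open>\<phi>\<close> gives g(phi X, V) = - g(X, phi V), and X in mu
    is orthogonal to phi V.\<close>
  have PXH: "?PX q \<in> Hor q" for q
    unfolding Hor_iff
    using phi_tangent[OF Hor_tangent[OF XH]] phi_skew[OF Hor_tangent[OF XH] Ver_tangent] Xmu
    by (simp add: apply_endo_def)
  have PXs: "?PX \<in> sections M Hor" using PX PXH by (simp add: sections_def)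
  have 1: "apply_endo hproj ?PW = ?PW" "apply_endo hproj ?PX = ?PX" "apply_endo vproj ?PX = 0"
    using proj_Hor(1)[OF PXH] proj_Hor(2)[OF PXH] proj_Hor(2)[OF PWH] by (auto simp: apply_endo_def fun_eq_iff)
  \<comment> \<open>Since phi X has no vertical part, the first term of \<open>oneill_A\<close> is
    the horizontal part of a derivative of the zero field and drops out.\<close>
  have h0: "hproj p 0 = 0" by (rule proj_Hor(2)[OF subspace_0[OF Hor_subspace]])
  let ?a = "nabla ?PW ?PX p" and ?b = "cov_phi W ?PX p"
  have t: "?a \<in> TM p" "?b \<in> TM p"
    by (rule nabla_tangent[OF PW PX], rule smooth_fieldsD(1)[OF cov_phi_smooth[OF Ws(1) PX]])
  have "(oneill_A M g nabla N \<pi> ?PW ?PX + Q_tensor M \<phi> g nabla N \<pi> W ?PX) p = vproj p ?a + vproj p ?b"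
    unfolding oneill_A_def Q_tensor_def Let_def 1 nabla_zero_right[OF PW] by (simp add: apply_endo_def h0)
  also have "... = vproj p (?a + ?b)" using vproj_comb[OF t, of 1 1] by simp
  also have "... = 0"
  proof -
    let ?y = "vproj p (?a + ?b)"
    have s: "?a + ?b \<in> TM p" by (rule tangent_closed(2)[OF t])
    note d = decomposition[OF s]
    have yt: "?y \<in> TM p" by (rule Ver_tangent[OF d(1)])
    \<comment> \<open>The vertical vector to be shown zero is extended to a vertical field and
      paired with itself.\<close>
    obtain V where V: "V \<in> sections M Ver" "V p = ?y" using section_through(1)[OF d(1)] by blast
    note Vs = sectionsD[OF V(1)]
    have Vt: "V p \<in> TM p" by (rule smooth_fieldsD(1)[OF Vs(1)])
    have PXt: "?PX p \<in> TM p" by (rule smooth_fieldsD(1)[OF PX])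
    have br: "lie_bracket ?PW V p \<in> Ver p"
    proof (rule lie_bracket_vertical[OF PW V(1)])
      fix a assume a: "a \<in> smooth_functions N"
      obtain Y where Y: "Y \<in> smooth_fields N" "\<And>q. differential N \<pi> (?PW q) = Y (\<pi> q)"
        using basic by (auto simp: basic_field_def)
      have "?PW q (\<lambda>q. a (\<pi> q)) = Y (\<pi> q) a" for q
        using differential_apply[OF a, of "?PW q"] Y(2)[of q] by simp
      then show "\<exists>b\<in>smooth_functions N. \<forall>q. ?PW q (\<lambda>q. a (\<pi> q)) = b (\<pi> q)"
        using N.smooth_fieldsD(2)[OF Y(1) a] by (intro bexI[of _ "\<lambda>n. Y n a"]) simp_all
    qed
    have ct: "cov_phi V W p \<in> TM p" "nabla V W p \<in> TM p"
      by (rule smooth_fieldsD(1)[OF cov_phi_smooth[OF Vs(1) Ws(1)]], rule nabla_tangent[OF Vs(1) Ws(1)])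
    have XnVW: "g p (X p) (nabla V W p) = 0"
    proof -
      \<comment> \<open>Total geodesy enters here: \<open>nabla V W\<close> is vertical and hence
        orthogonal to X.\<close>
      have "apply_endo hproj (nabla V W) p = 0"
        using tg V(1) W unfolding totally_geodesic_fibres_def by (simp add: fun_eq_iff)
      then have "nabla V W p = vproj p (nabla V W p)"
        using decomposition(3)[OF ct(2)] by (simp add: apply_endo_def)
      then have "nabla V W p \<in> Ver p" using decomposition(1)[OF ct(2)] by simp
      then show ?thesis by (rule Hor_Ver[OF XH])
    qed
    have "g p ?a (V p) = - g p (?PX p) (nabla ?PW V p)"
      using hor_nabla_ver[OF PW PXs V(1), of p] by simp
    \<comment> \<open>The derivative of V along phi W is traded for that of phi W along V. The
      bracket that appears is vertical, since phi W is basic, and so is orthogonal to phi X.\<close>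
    also have "nabla ?PW V p = (cov_phi V W p + \<phi> p (nabla V W p)) + lie_bracket ?PW V p"
      unfolding torsion_free[OF PW Vs(1)] nabla_phi ..
    also have "g p (?PX p) ... = g p (?PX p) (cov_phi V W p)"
      using Hor_Ver[OF PXH br] XnVW phi_isometry[OF Hor_tangent[OF XH] ct(2)]
      by (simp add: g_add_right[OF PXt] ct phi_tangent tangent_closed Ver_tangent[OF br])
        (simp add: apply_endo_def)
    finally have "g p ?a (V p) = - g p (?PX p) (cov_phi V W p)" .
    moreover have "g p ?b (V p) = - g p (?PX p) (cov_phi W V p)"
      by (rule cov_phi_skew[OF Ws(1) PX Vs(1)])
    moreover have "g p (?PX p) (cov_phi W V p) = - g p (?PX p) (cov_phi V W p)"
      unfolding cov_phi_anticommute[OF Ws(1) Vs(1)] by (rule g_minus_right[OF PXt ct(1)])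
    ultimately have "g p (?a + ?b) (V p) = 0" by (simp add: g_add_left[OF Vt t])
    moreover have "g p (?a + ?b) ?y = g p (?y + hproj p (?a + ?b)) ?y" using d(3) by simp
    moreover have "... = g p ?y ?y"
      using g_add_left[OF yt yt Hor_tangent[OF d(2)]] Hor_Ver[OF d(2,1)] by simp
    ultimately show ?thesis using V(2) g_eq_0_iff[OF yt] by simp
  qed
  finally show "(oneill_A M g nabla N \<pi> ?PW ?PX + Q_tensor M \<phi> g nabla N \<pi> W ?PX) p = 0 p" by simp
qed

end

theorem corollary3p5:
  fixes M :: "('m::{t2_space, second_countable_topology}, 'e::euclidean_space) chart set"
    and N :: "('n::{t2_space, second_countable_topology}, 'f::euclidean_space) chart set"
    and \<phi> :: "'m endo" and g :: "'m metric" and g\<^sub>N :: "'n metric" and nabla :: "'m conn"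
    and \<pi> :: "'m \<Rightarrow> 'n" and f :: "'m \<Rightarrow> real"
  assumes "smooth_manifold M" and "smooth_manifold N"
    and "nearly_kaehler M \<phi> g nabla" and "riemannian_metric N g\<^sub>N"
    and "riemannian_submersion M g N g\<^sub>N \<pi>"
    and "anti_invariant M \<phi> g N \<pi>"
    and "f \<in> smooth_functions M"
    and "clairaut M g nabla N \<pi> (\<lambda>p. exp (f p))"
    and "grad M g f \<in> sections M (\<lambda>p. \<phi> p ` ker_space M N \<pi> p)"
    and "\<forall>p. dim (ker_space M N \<pi> p) > 1"
  shows "totally_geodesic_fibres M g nabla N \<pi> \<longleftrightarrow>
    (\<forall>W\<in>sections M (ker_space M N \<pi>). \<forall>X\<in>sections M (mu_space M \<phi> g N \<pi>).
       basic_field M g N \<pi> (apply_endo \<phi> W) \<longrightarrow>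
       oneill_A M g nabla N \<pi> (apply_endo \<phi> W) (apply_endo \<phi> X)
         + Q_tensor M \<phi> g nabla N \<pi> W (apply_endo \<phi> X) = 0)"
proof -
  interpret nearly_kaehler_submersion M g N \<pi> nabla \<phi>
    using assms(1-6)
    by unfold_locales
      (auto simp: nearly_kaehler_def almost_hermitian_def levi_civita_def riemannian_submersion_def)
  have "totally_geodesic_fibres M g nabla N \<pi>"
    using fibres_totally_geodesic[OF assms(7-9)] assms(10) by blast
  then show ?thesis using oneill_Q_vanishes by blast
qed

end
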